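(* Let $\mathbb K\in\{\mathbb R,\mathbb C,\mathbb H\}$, let $p$ be a positive integer, let $E,F\in X_p(\mathbb K)$ and let $(\alpha_i)_{1\le i\le p}$ be their family of hyperbolic principal angles. Then \[d(E,F)^2=2\,\dim_{\mathbb R}(\mathbb K)\sum_{i=1}^p\alpha_i^2.\]
   Context: **The space $X_p(\mathbb K)$.** Let $\mathcal H$ be a separable infinite-dimensional right $\mathbb K$-Hilbert space with form $\langle\cdot,\cdot\rangle$ (so $\langle x,y\lambda+z\rangle=\langle x,y\rangle\lambda+\langle x,z\rangle$, $\langle x,y\rangle=\overline{\langle y,x\rangle}$), and $\mathcal H_{\mathbb R}$ the underlying real Hilbert space with scalar product $\mathrm{Re}\langle\cdot,\cdot\rangle$. Fix a $\mathbb K$-subspace $E_0$ of dimension $p$, let $\Phi=\mathrm{Id}$ on $E_0$ and $-\mathrm{Id}$ on $E_0^\perp$, $B(x,y)=\langle x,\Phi y\rangle$, $Q(x)=B(x,x)$. $X_p(\mathbb K)$ is the set of $p$-dimensional $\mathbb K$-subspaces $E$ of $\mathcal H$ with $B|_{E\times E}$ positive definite. The group $\mathbf O_{p,\infty}(\mathbb K)$ of invertible bounded $\mathbb K$-linear operators $g$ with $g^*\Phi g=\Phi$ acts transitively on $X_p(\mathbb K)$. Let $\mathfrak p$ be the space of $\mathbb K$-linear symmetric operators $A$ ($A=A^*$) that are Hilbert–Schmidt on $\mathcal H_{\mathbb R}$ and satisfy $A^*\Phi+\Phi A=0$. The map $A\mapsto\frac{d}{dt}|_{t=0}\exp(tA)E_0$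 identifies $\mathfrak p$ with $T_{E_0}X_p(\mathbb K)$, and $X_p(\mathbb K)$ carries the $\mathbf O_{p,\infty}(\mathbb K)$-invariant Riemannian metric with $\|A\|^2=\mathrm{Trace}({}^tAA)$ at $E_0$ (trace over $\mathcal H_{\mathbb R}$). $d$ is the associated distance; $X_p(\mathbb K)$ is a complete simply connected Riemannian manifold of non-positive sectional curvature whose geodesics through $E_0$ are $t\mapsto\exp(tA)E_0$, $A\in\mathfrak p$. **Hyperbolic principal angles** between $E,F\in X_p(\mathbb K)$: set $E_{(0)}=E$, $F_{(0)}=F$. Inductively for $l=0,\dots,p-1$ let $c_{l+1}=\sup\{\mathrm{Re}\,B(x,y): x\in E_{(l)},\,y\in F_{(l)},\,Q(x)=Q(y)=1\}$, choose $x_{l+1}\in E_{(l)}$, $y_{l+1}\in F_{(l)}$ with $Q(x_{l+1})=Q(y_{l+1})=1$ and $B(x_{l+1},y_{l+1})=c_{l+1}$, and let $E_{(l+1)}$, $F_{(l+1)}$ be the $B$-orthogonals of $\{x_1,\dots,x_{l+1}\}$ in $E$ and of $\{y_1,\dots,y_{l+1}\}$ in $F$. The numbers $c_i$ do not depend on the choices and satisfy $c_i\ge1$; $\alpha_i=\mathrm{arccosh}(c_i)\ge0$. *)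

theory Defs
  imports "HOL-Analysis.Analysis"
begin

section \<open>Quaternions\<close>

datatype quat = Quat (qRe: real) (qI: real) (qJ: real) (qK: real)

lemma quat_eq_iff: "x = y \<longleftrightarrow> qRe x = qRe y \<and> qI x = qI y \<and> qJ x = qJ y \<and> qK x = qK y"
  by (cases x; cases y) auto

instantiation quat :: real_vector
begin

definition "0 = Quat 0 0 0 0"
definition "x + y = Quat (qRe x + qRe y) (qI x + qI y) (qJ x + qJ y) (qK x + qK y)"
definition "- x = Quat (- qRe x) (- qI x) (- qJ x) (- qK x)"
definition "x - y = Quat (qRe x - qRe y) (qI x - qI y) (qJ x - qJ y) (qK x - qK y)"
definition "r *\<^sub>R x = Quat (r * qRe x) (r * qI x) (r * qJ x) (r * qK x)"

instance
  by standard
    (auto simp: quat_eq_iff zero_quat_def plus_quat_def uminus_quat_def minus_quat_def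
      scaleR_quat_def algebra_simps)

end

instantiation quat :: real_div_algebra
begin

definition "1 = Quat 1 0 0 0"
definition "x * y = Quat
  (qRe x * qRe y - qI x * qI y - qJ x * qJ y - qK x * qK y)
  (qRe x * qI y + qI x * qRe y + qJ x * qK y - qK x * qJ y)
  (qRe x * qJ y - qI x * qK y + qJ x * qRe y + qK x * qI y)
  (qRe x * qK y + qI x * qJ y - qJ x * qI y + qK x * qRe y)"
definition "inverse x = inverse ((qRe x)\<^sup>2 + (qI x)\<^sup>2 + (qJ x)\<^sup>2 + (qK x)\<^sup>2) *\<^sub>R
  Quat (qRe x) (- qI x) (- qJ x) (- qK x)"
definition "x div y = x * inverse (y :: quat)"

instance
proof
  fix x y z :: quat and r :: real
  let ?n = "(qRe x)\<^sup>2 + (qI x)\<^sup>2 + (qJ x)\<^sup>2 + (qK x)\<^sup>2"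
  show "x * y * z = x * (y * z)" "1 * x = x" "x * 1 = x"
    "(x + y) * z = x * z + y * z" "x * (y + z) = x * y + x * z"
    "(0::quat) \<noteq> 1" "r *\<^sub>R x * y = r *\<^sub>R (x * y)" "x * r *\<^sub>R y = r *\<^sub>R (x * y)"
    "x div y = x * inverse y" "inverse (0::quat) = 0"
    by (auto simp: quat_eq_iff zero_quat_def one_quat_def plus_quat_def times_quat_def
        scaleR_quat_def inverse_quat_def divide_quat_def algebra_simps)
  assume "x \<noteq> 0"
  have nz: "?n \<noteq> 0"
  proof
    assume n0: "?n = 0"
    have "0 \<le> (qRe x)\<^sup>2" "0 \<le> (qI x)\<^sup>2" "0 \<le> (qJ x)\<^sup>2" "0 \<le> (qK x)\<^sup>2"
      by simp_all
    with n0 have "(qRe x)\<^sup>2 = 0" "(qI x)\<^sup>2 = 0" "(qJ x)\<^sup>2 = 0" "(qK x)\<^sup>2 = 0"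
      by linarith+
    then have "x = 0"
      by (simp add: quat_eq_iff zero_quat_def)
    with \<open>x \<noteq> 0\<close> show False ..
  qed
  have "inverse ?n * (qRe x * qRe x) + inverse ?n * (qI x * qI x)
      + inverse ?n * (qJ x * qJ x) + inverse ?n * (qK x * qK x) = inverse ?n * ?n"
    by (simp add: power2_eq_square algebra_simps)
  also have "\<dots> = 1"
    using nz by simp
  finally have "inverse ?n * (qRe x * qRe x) + inverse ?n * (qI x * qI x)
      + inverse ?n * (qJ x * qJ x) + inverse ?n * (qK x * qK x) = 1" .
  then show "inverse x * x = 1" "x * inverse x = 1"
    by (simp_all add: quat_eq_iff one_quat_def times_quat_def scaleR_quat_def inverse_quat_def mult_ac)
qed

end

definition qcnj :: "quat \<Rightarrow> quat" where
  "qcnj x = Quat (qRe x) (- qI x) (- qJ x) (- qK x)"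

definition quat_Complexes :: "quat set" where
  "quat_Complexes = {x. qJ x = 0 \<and> qK x = 0}"


section \<open>Trace on a real Hilbert space\<close>

definition orthonormal_basis :: "'h::real_inner set \<Rightarrow> bool" where
  "orthonormal_basis S \<longleftrightarrow>
     pairwise orthogonal S \<and> (\<forall>e\<in>S. norm e = 1) \<and> closure (span S) = UNIV"

definition hilbert_schmidt :: "('h::real_inner \<Rightarrow> 'h) \<Rightarrow> bool" where
  "hilbert_schmidt A \<longleftrightarrow> bounded_linear A \<and>
     (\<exists>S. orthonormal_basis S \<and> (\<lambda>e. (norm (A e))\<^sup>2) summable_on S)"

text \<open>For trace class operators, in particular for \<open>adjoint A \<circ> A\<close> with \<open>A\<close> Hilbert--Schmidt,
  the value does not depend on the basis chosen.\<close>

definition op_trace :: "('h::real_inner \<Rightarrow> 'h) \<Rightarrow> real" where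
  "op_trace T = (\<Sum>\<^sub>\<infinity>e\<in>(SOME S. orthonormal_basis S). e \<bullet> T e)"

definition op_exp :: "('h::real_normed_vector \<Rightarrow> 'h) \<Rightarrow> 'h \<Rightarrow> 'h" where
  "op_exp A x = (\<Sum>n. (A ^^ n) x /\<^sub>R fact n)"


section \<open>Right Hilbert spaces over the reals, the complex numbers and the quaternions\<close>

text \<open>The scalars \<open>K\<close> are the reals, the complex numbers or the quaternions, each realised inside
  the quaternions; \<open>x \<odot> a\<close> and \<open>form x y\<close> matter only for \<open>a \<in> K\<close> and take
  values \<open>form x y \<in> K\<close>.  The type \<open>'h\<close>, with its inner product and norm, is the underlying real
  Hilbert space; completeness and positive definiteness of \<open>form\<close> come from its type class.\<close>

locale right_hilbert_space =
  fixes K :: "quat set"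
    and rscale :: "'h::{real_inner,complete_space} \<Rightarrow> quat \<Rightarrow> 'h" (infixl \<open>\<odot>\<close> 75)
    and form :: "'h \<Rightarrow> 'h \<Rightarrow> quat"
  assumes K_cases: "K \<in> {\<real>, quat_Complexes, UNIV}"
    and rscale_add_left: "a \<in> K \<Longrightarrow> (x + y) \<odot> a = x \<odot> a + y \<odot> a"
    and rscale_add_right: "a \<in> K \<Longrightarrow> b \<in> K \<Longrightarrow> x \<odot> (a + b) = x \<odot> a + x \<odot> b"
    and rscale_mult: "a \<in> K \<Longrightarrow> b \<in> K \<Longrightarrow> x \<odot> (a * b) = x \<odot> a \<odot> b"
    and rscale_of_real: "x \<odot> of_real r = r *\<^sub>R x"
    and form_in_K: "form x y \<in> K"
    and form_right: "a \<in> K \<Longrightarrow> form x (y \<odot> a + z) = form x y * a + form x z"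
    and form_cnj: "form x y = qcnj (form y x)"
    and Re_form: "qRe (form x y) = x \<bullet> y"
begin

definition is_subspace :: "'h set \<Rightarrow> bool" where
  "is_subspace E \<longleftrightarrow> 0 \<in> E \<and> (\<forall>x\<in>E. \<forall>y\<in>E. x + y \<in> E) \<and> (\<forall>x\<in>E. \<forall>a\<in>K. x \<odot> a \<in> E)"

text \<open>A basis \<open>b 0, \<dots>, b (n - 1)\<close> of \<open>E\<close> over \<open>K\<close>: each element of \<open>E\<close> is a linear combination in
  exactly one way.\<close>

definition has_dimension :: "'h set \<Rightarrow> nat \<Rightarrow> bool" where
  "has_dimension E n \<longleftrightarrow>
     (\<exists>b :: nat \<Rightarrow> 'h. bij_betw (\<lambda>c. \<Sum>i<n. b i \<odot> c i) ({..<n} \<rightarrow>\<^sub>E K) E)"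

definition orth :: "'h set \<Rightarrow> 'h set" where
  "orth E = {y. \<forall>x\<in>E. form x y = 0}"

definition K_linear :: "('h \<Rightarrow> 'h) \<Rightarrow> bool" where
  "K_linear T \<longleftrightarrow> (\<forall>x y. T (x + y) = T x + T y) \<and> (\<forall>x. \<forall>a\<in>K. T (x \<odot> a) = T x \<odot> a)"

definition is_adjoint :: "('h \<Rightarrow> 'h) \<Rightarrow> ('h \<Rightarrow> 'h) \<Rightarrow> bool" where
  "is_adjoint T T' \<longleftrightarrow> (\<forall>x y. form (T x) y = form x (T' y))"

end


section \<open>The space of positive definite subspaces of dimension \<open>p\<close>\<close>

locale hyperbolic_grassmannian = right_hilbert_space K rscale form
  for K :: "quat set"
    and rscale :: "'h::{real_inner,complete_space} \<Rightarrow> quat \<Rightarrow> 'h" (infixl \<open>\<odot>\<close> 75)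
    and form :: "'h \<Rightarrow> 'h \<Rightarrow> quat" +
  fixes p :: nat and E0 :: "'h set"
  assumes separable: "separable_space (euclidean :: 'h topology)"
    and infinite_dimensional: "\<not> has_dimension (UNIV :: 'h set) n"
    and p_pos: "p > 0"
    and E0_subspace: "is_subspace E0"
    and E0_dimension: "has_dimension E0 p"
begin

definition \<Phi> :: "'h \<Rightarrow> 'h" where
  "\<Phi> x = (THE z. \<exists>u\<in>E0. \<exists>v\<in>orth E0. x = u + v \<and> z = u - v)"

definition B :: "'h \<Rightarrow> 'h \<Rightarrow> quat" where
  "B x y = form x (\<Phi> y)"

definition Q :: "'h \<Rightarrow> quat" where
  "Q x = B x x"

text \<open>\<open>Q x\<close> is real because \<open>B\<close> is Hermitian.\<close>

definition X :: "'h set set" where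
  "X = {E. is_subspace E \<and> has_dimension E p \<and> (\<forall>x\<in>E. x \<noteq> 0 \<longrightarrow> qRe (Q x) > 0)}"

definition O_group :: "('h \<Rightarrow> 'h) set" where
  "O_group = {g. bounded_linear g \<and> K_linear g \<and>
     (\<exists>h. bounded_linear h \<and> g \<circ> h = id \<and> h \<circ> g = id) \<and>
     (\<exists>g'. is_adjoint g g' \<and> g' \<circ> \<Phi> \<circ> g = \<Phi>)}"

text \<open>Since \<open>A\<close> is its own adjoint, the last condition is the equation
  \<open>A\<^sup>* \<Phi> + \<Phi> A = 0\<close>.\<close>

definition \<pp> :: "('h \<Rightarrow> 'h) set" where
  "\<pp> = {A. K_linear A \<and> is_adjoint A A \<and> hilbert_schmidt A \<and> (\<forall>x. A (\<Phi> x) + \<Phi> (A x) = 0)}"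


subsection \<open>The Riemannian distance\<close>

text \<open>The projection onto \<open>E\<close> along the \<open>B\<close>-orthogonal of \<open>E\<close>.  The map \<open>B_proj\<close> embeds \<open>X\<close> as a
  submanifold of the Banach space of bounded operators, and it is equivariant:
  \<open>B_proj (g ` E) = g \<circ> B_proj E \<circ> g\<^sup>-\<^sup>1\<close> for \<open>g \<in> O_group\<close>.  Curves in \<open>X\<close> are
  differentiated, and tangent vectors to \<open>X\<close> are represented, through this embedding.\<close>

definition B_proj :: "'h set \<Rightarrow> 'h \<Rightarrow>\<^sub>L 'h" where
  "B_proj E = Blinfun (\<lambda>x. THE u. u \<in> E \<and> (\<forall>v\<in>E. B v (x - u) = 0))"

text \<open>The invariant metric: a vector \<open>V\<close> tangent to \<open>X\<close> at \<open>E\<close> is the image under some \<open>g\<close> with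
  \<open>g E0 = E\<close> of the vector at \<open>E0\<close> given by a unique \<open>A \<in> \<pp>\<close>, and its norm is that of \<open>A\<close>.
  Another \<open>g\<close> changes \<open>A\<close> by conjugation with an isometry.\<close>

definition riem_norm :: "'h set \<Rightarrow> ('h \<Rightarrow>\<^sub>L 'h) \<Rightarrow> real" where
  "riem_norm E V = (THE r. \<exists>g\<in>O_group. \<exists>A\<in>\<pp>. g ` E0 = E \<and>
     ((\<lambda>s. B_proj (g ` op_exp (\<lambda>x. s *\<^sub>R A x) ` E0)) has_vector_derivative V) (at 0) \<and>
     r = sqrt (op_trace (adjoint A \<circ> A)))"

text \<open>The predicate \<open>piecewise_C1_differentiable_on\<close> puts no bound on the derivative near the break points;
  requiring the speed to have an integral leaves exactly the curves of finite length.\<close>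

definition has_length :: "(real \<Rightarrow> 'h set) \<Rightarrow> real \<Rightarrow> bool" where
  "has_length \<gamma> L \<longleftrightarrow>
     (\<forall>t\<in>{0..1}. \<gamma> t \<in> X) \<and>
     (\<lambda>t. B_proj (\<gamma> t)) piecewise_C1_differentiable_on {0..1} \<and>
     ((\<lambda>t. riem_norm (\<gamma> t) (vector_derivative (\<lambda>t. B_proj (\<gamma> t)) (at t))) has_integral L) {0..1}"

definition riem_dist :: "'h set \<Rightarrow> 'h set \<Rightarrow> real" where
  "riem_dist E F = Inf {L. \<exists>\<gamma>. has_length \<gamma> L \<and> \<gamma> 0 = E \<and> \<gamma> 1 = F}"


subsection \<open>Hyperbolic principal angles\<close>

text \<open>\<open>B_orth_in E x l\<close> is the \<open>B\<close>-orthogonal of \<open>x 1, \<dots>, x l\<close> in \<open>E\<close>.\<close>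

definition B_orth_in :: "'h set \<Rightarrow> (nat \<Rightarrow> 'h) \<Rightarrow> nat \<Rightarrow> 'h set" where
  "B_orth_in E x l = {u\<in>E. \<forall>j\<in>{1..l}. B (x j) u = 0}"

text \<open>The values \<open>\<alpha> 1, \<dots>, \<alpha> p\<close> arise from some admissible choice of the vectors
  \<open>x 1, \<dots>, x p\<close> and \<open>y 1, \<dots>, y p\<close>.\<close>

definition hyperbolic_principal_angles :: "'h set \<Rightarrow> 'h set \<Rightarrow> (nat \<Rightarrow> real) \<Rightarrow> bool" where
  "hyperbolic_principal_angles E F \<alpha> \<longleftrightarrow>
     (\<exists>(x :: nat \<Rightarrow> 'h) (y :: nat \<Rightarrow> 'h) (c :: nat \<Rightarrow> real). \<forall>l<p.
        c (Suc l) = Sup {qRe (B u v) |u v.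
          u \<in> B_orth_in E x l \<and> v \<in> B_orth_in F y l \<and> Q u = 1 \<and> Q v = 1} \<and>
        x (Suc l) \<in> B_orth_in E x l \<and> y (Suc l) \<in> B_orth_in F y l \<and>
        Q (x (Suc l)) = 1 \<and> Q (y (Suc l)) = 1 \<and>
        B (x (Suc l)) (y (Suc l)) = of_real (c (Suc l)) \<and>
        \<alpha> (Suc l) = arcosh (c (Suc l)))"

end

end

theory Submission
  imports Defs
begin

text \<open>Maximality of the \<open>c\<^sub>i\<close> yields \<open>B\<close>-orthonormal bases \<open>x\<^sub>i\<close> of \<open>E\<close> and \<open>y\<^sub>i\<close> of \<open>F\<close> with
  \<open>y\<^sub>i = cosh \<alpha>\<^sub>i x\<^sub>i + sinh \<alpha>\<^sub>i z\<^sub>i\<close>, where the \<open>z\<^sub>i\<close> are \<open>B\<close>-orthogonal to \<open>E\<close> and to each other and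
  \<open>Q z\<^sub>i = -1\<close> if \<open>\<alpha>\<^sub>i \<noteq> 0\<close>. The spans of \<open>cosh (t \<alpha>\<^sub>i) x\<^sub>i + sinh (t \<alpha>\<^sub>i) z\<^sub>i\<close> form a curve of constant
  speed from \<open>E\<close> to \<open>F\<close> with the required length. That no curve is shorter is shown with a Busemann
  function instead of curvature: the vectors \<open>\<xi>\<^sub>i = x\<^sub>i + z\<^sub>i\<close> with \<open>\<alpha>\<^sub>i \<noteq> 0\<close> span a totally isotropic space.
  Apply the Gram--Schmidt process to the projections of the \<open>\<xi>\<^sub>i\<close> to a variable subspace \<open>G\<close> and let
  \<open>r\<^sub>i(G)\<close> be the squared lengths it produces. The function \<open>G \<mapsto> - \<Sum> \<alpha>\<^sub>i ln r\<^sub>i(G)\<close> changes by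
  \<open>2 \<Sum> \<alpha>\<^sub>i\<^sup>2\<close> from \<open>E\<close> to \<open>F\<close>, and by the Cauchy--Schwarz inequality its differential is bounded by
  the Riemannian norm with the right constant. The argument is carried out over the reals, where
  each angle occurs \<open>dim\<^sub>\<real> K\<close> times.\<close>

section \<open>Quaternions\<close>

text \<open>The distance is an infimum over curves whose speed is a definite description, so both
  bounds rest on evaluating that speed. A velocity is the derivative \<open>V\<close> of the
  projections. It satisfies the linear identities collected in \<open>tangent\<close>, and these
  suffice to recover the operator \<open>A\<close> in \<open>\<pp>\<close>. The trace of
  \<open>A\<^sup>* A\<close> sees \<open>A\<close> once from \<open>E0\<close> to its orthogonal and
  once back; this gives the factor 2 in front of the finite sum of the
  \<open>- b (V u) (V u)\<close>. The lengths along the isotropic vectors shrink by the factor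
  \<open>exp (- 2 * a i)\<close> between \<open>E\<close> and \<open>F\<close>, so each logarithm
  changes by twice an angle. Weights proportional to the angles make the Cauchy--Schwarz estimate
  sharp along the geodesic. Since the weights differ from each other, a determinant of the projected
  vectors would not do: each length must be seen separately, hence Gram--Schmidt, which respects the
  flag. A vanishing angle has \<open>z i = 0\<close> in place of a negative partner of
  \<open>x i\<close>, so it yields no isotropic vector and contributes to neither bound.\<close>

lemmas quat_comp_defs = quat_eq_iff zero_quat_def one_quat_def plus_quat_def uminus_quat_def
  minus_quat_def times_quat_def scaleR_quat_def of_real_def qcnj_def

lemma qRe_simps [simp]:
  "qRe 0 = 0" "qRe 1 = 1" "qRe (x + y) = qRe x + qRe y" "qRe (x - y) = qRe x - qRe y"
  "qRe (- x) = - qRe x" "qRe (r *\<^sub>R x) = r * qRe x" "qRe (of_real r) = r"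
  "qRe (of_real r * x) = r * qRe x" "qRe (x * of_real r) = qRe x * r" "qRe (qcnj x) = qRe x"
  by (simp_all add: quat_comp_defs)

lemma qRe_sum: "qRe (sum f A) = (\<Sum>i\<in>A. qRe (f i))"
  by (induction A rule: infinite_finite_induct) auto

lemma qcnj_simps [simp]:
  "qcnj 0 = 0" "qcnj 1 = 1" "qcnj (x + y) = qcnj x + qcnj y" "qcnj (x - y) = qcnj x - qcnj y"
  "qcnj (- x) = - qcnj x" "qcnj (r *\<^sub>R x) = r *\<^sub>R qcnj x" "qcnj (of_real r) = of_real r"
  "qcnj (x * y) = qcnj y * qcnj x" "qcnj (qcnj x) = x"
  by (simp_all add: quat_comp_defs algebra_simps)

lemma qRe_mult_commute: "qRe (x * y) = qRe (y * x)"
  by (simp add: quat_comp_defs algebra_simps)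

lemma of_real_mult_quat: "of_real r * x = r *\<^sub>R (x :: quat)" "x * of_real r = r *\<^sub>R x"
  by (simp_all add: of_real_def)

definition qnorm :: "quat \<Rightarrow> real" where
  "qnorm x = sqrt ((qRe x)\<^sup>2 + (qI x)\<^sup>2 + (qJ x)\<^sup>2 + (qK x)\<^sup>2)"

lemma qnorm_nonneg [simp]: "qnorm x \<ge> 0"
  by (simp add: qnorm_def)

lemma qnorm_sq: "(qnorm x)\<^sup>2 = (qRe x)\<^sup>2 + (qI x)\<^sup>2 + (qJ x)\<^sup>2 + (qK x)\<^sup>2"
  by (simp add: qnorm_def)

lemma qcnj_mult_self: "qcnj x * x = of_real ((qnorm x)\<^sup>2)"
  and mult_qcnj_self: "x * qcnj x = of_real ((qnorm x)\<^sup>2)"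
  by (simp_all add: qnorm_sq) (simp_all add: quat_comp_defs power2_eq_square)

lemma qnorm_eq_0_iff [simp]: "qnorm x = 0 \<longleftrightarrow> x = 0"
proof -
  have "(qnorm x)\<^sup>2 = 0 \<longleftrightarrow> x = 0"
    unfolding qnorm_sq by (auto simp: quat_comp_defs add_nonneg_eq_0_iff)
  then show ?thesis by simp
qed

lemma qRe_cnj_mult_self_eq_0: "qRe (qcnj x * x) = 0 \<longleftrightarrow> x = 0"
  unfolding qcnj_mult_self by (simp del: of_real_power)

lemma quat_eq_of_real_iff: "x = qcnj x \<longleftrightarrow> x = of_real (qRe x)"
  by (auto simp: quat_comp_defs)

lemma quat_Reals_iff: "x \<in> \<real> \<longleftrightarrow> qI x = 0 \<and> qJ x = 0 \<and> qK x = 0" for x :: quat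
  by (auto simp: Reals_def quat_comp_defs image_iff)

section \<open>Finite orthonormal sets\<close>

definition onset :: "'a::real_inner set \<Rightarrow> bool" where
  "onset S \<longleftrightarrow> (\<forall>u\<in>S. \<forall>v\<in>S. u \<bullet> v = (if u = v then 1 else 0))"

lemma onset_subset: "onset S \<Longrightarrow> T \<subseteq> S \<Longrightarrow> onset T"
  unfolding onset_def by blast

lemma onset_imp_orthonormal: "onset S \<Longrightarrow> pairwise orthogonal S \<and> (\<forall>e\<in>S. norm e = 1)"
  by (auto simp: onset_def pairwise_def orthogonal_def norm_eq_sqrt_inner)

lemma orthonormal_imp_onset: "pairwise orthogonal S \<Longrightarrow> (\<forall>e\<in>S. norm e = 1) \<Longrightarrow> onset S"
  by (auto simp: onset_def pairwise_def orthogonal_def dot_square_norm)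

lemma onset_inner_sum:
  assumes "onset S" "finite S" "u \<in> S"
  shows "u \<bullet> (\<Sum>v\<in>S. c v *\<^sub>R v) = c u"
proof -
  have "u \<bullet> (\<Sum>v\<in>S. c v *\<^sub>R v) = (\<Sum>v\<in>S. if u = v then c v else 0)"
    unfolding inner_sum_right using assms by (intro sum.cong) (auto simp: onset_def)
  then show ?thesis using assms by simp
qed

lemma onset_expand:
  assumes "onset S" "finite S" "x \<in> span S"
  shows "x = (\<Sum>u\<in>S. (u \<bullet> x) *\<^sub>R u)"
proof -
  obtain c where c: "x = (\<Sum>v\<in>S. c v *\<^sub>R v)"
    using assms(2,3) by (auto simp: span_finite)
  then have "u \<bullet> x = c u" if "u \<in> S" for u
    using onset_inner_sum assms that by blast
  with c show ?thesis by simp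
qed

lemma onset_norm_sq:
  assumes "onset S" "finite S" "x \<in> span S"
  shows "(norm x)\<^sup>2 = (\<Sum>u\<in>S. (u \<bullet> x)\<^sup>2)"
proof -
  have "(norm x)\<^sup>2 = x \<bullet> (\<Sum>u\<in>S. (u \<bullet> x) *\<^sub>R u)"
    using onset_expand[OF assms] by (simp flip: power2_norm_eq_inner)
  then show ?thesis
    by (simp add: inner_sum_right power2_eq_square inner_commute)
qed

lemma onset_residual:
  assumes "onset S" "finite S" "y \<in> span S"
  shows "(x - (\<Sum>u\<in>S. (u \<bullet> x) *\<^sub>R u)) \<bullet> y = 0"
proof -
  have "(x - (\<Sum>u\<in>S. (u \<bullet> x) *\<^sub>R u)) \<bullet> v = 0" if "v \<in> S" for v
    using onset_inner_sum[OF assms(1,2) that, of "\<lambda>u. u \<bullet> x"]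
    by (simp add: inner_diff_left inner_diff_right inner_commute)
  then show ?thesis
    using onset_expand[OF assms] by (metis (mono_tags, lifting) inner_scaleR_right inner_sum_right mult_zero_right sum.neutral)
qed

lemma onset_residual_norm:
  assumes "onset S" "finite S"
  shows "(norm x)\<^sup>2 = (norm (x - (\<Sum>u\<in>S. (u \<bullet> x) *\<^sub>R u)))\<^sup>2 + (\<Sum>u\<in>S. (u \<bullet> x)\<^sup>2)"
proof -
  let ?y = "\<Sum>u\<in>S. (u \<bullet> x) *\<^sub>R u"
  have y: "?y \<in> span S" by (intro span_sum span_scale span_base)
  have "u \<bullet> ?y = u \<bullet> x" if "u \<in> S" for u
    by (rule onset_inner_sum[OF assms that])
  then have "(norm ?y)\<^sup>2 = (\<Sum>u\<in>S. (u \<bullet> x)\<^sup>2)"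
    using onset_norm_sq[OF assms y] by simp
  moreover have "(norm ((x - ?y) + ?y))\<^sup>2 = (norm (x - ?y))\<^sup>2 + (norm ?y)\<^sup>2"
    using onset_residual[OF assms y, of x] by (intro norm_add_Pythagorean) (simp add: orthogonal_def)
  ultimately show ?thesis by simp
qed

text \<open>Gram--Schmidt, one vector of \<open>T\<close> at a time. The last clause keeps the
  extension inside any subspace that contains \<open>S\<close> and \<open>T\<close>, which is needed
  when a partial frame of \<open>E0\<close> is completed.\<close>

lemma onset_extend:
  assumes "onset S" "finite S" "finite T"
  obtains S' where "onset S'" "finite S'" "S \<subseteq> S'" "T \<subseteq> span S'" "S' \<subseteq> span (S \<union> T)"
proof -
  have "\<exists>S'. onset S' \<and> finite S' \<and> S \<subseteq> S' \<and> T \<subseteq> span S' \<and> S' \<subseteq> span (S \<union> T)"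
    using assms(3)
  proof (induction T)
    case empty
    then show ?case using assms by (auto intro: span_superset[THEN subsetD])
  next
    case (insert x T)
    then obtain R where R: "onset R" "finite R" "S \<subseteq> R" "T \<subseteq> span R" "R \<subseteq> span (S \<union> T)"
      by blast
    have mono: "span (S \<union> T) \<subseteq> span (S \<union> insert x T)"
      by (intro span_mono) auto
    show ?case
    proof (cases "x \<in> span R")
      case True
      with R mono show ?thesis by (intro exI[of _ R]) auto
    next
      case False
      define y where "y = (\<Sum>u\<in>R. (u \<bullet> x) *\<^sub>R u)"
      define v where "v = (1 / norm (x - y)) *\<^sub>R (x - y)"
      have y: "y \<in> span R" unfolding y_def by (intro span_sum span_scale span_base)
      have ne: "x - y \<noteq> 0" using False y by auto
      have vu: "v \<bullet> u = 0" if "u \<in> R" for u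
        using onset_residual[OF R(1,2) span_base[OF that], of x] by (simp add: v_def y_def)
      have vv: "v \<bullet> v = 1" using ne
        by (simp add: v_def dot_square_norm power2_eq_square)
      have "v \<notin> R" using vu[of v] vv by auto
      have on: "onset (insert v R)"
        using R(1) vu vv by (auto simp: onset_def inner_commute)
      have "x = norm (x - y) *\<^sub>R v + y" using ne by (simp add: v_def)
      moreover have "y \<in> span (insert v R)" "v \<in> span (insert v R)"
        using y span_mono[OF subset_insertI, of R v] by (auto intro: span_base)
      then have "norm (x - y) *\<^sub>R v + y \<in> span (insert v R)"
        by (intro span_add span_scale)
      ultimately have x: "x \<in> span (insert v R)" by simp
      have "span R \<subseteq> span (insert v R)" by (intro span_mono) auto
      with R(4) x have 1: "insert x T \<subseteq> span (insert v R)" by auto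
      have "span R \<subseteq> span (S \<union> T)" using R(5) by (metis span_mono span_span)
      then have "y \<in> span (S \<union> insert x T)" using y mono by auto
      then have "v \<in> span (S \<union> insert x T)" unfolding v_def
        by (intro span_scale span_diff) (auto intro: span_base)
      then have 2: "insert v R \<subseteq> span (S \<union> insert x T)" using R(5) mono by auto
      show ?thesis using on R(2,3) 1 2 by (intro exI[of _ "insert v R"]) auto
    qed
  qed
  then show ?thesis using that by blast
qed

text \<open>\<open>op_trace\<close> selects its basis by \<open>SOME\<close>, so it has a meaning
  only once a basis is known. Absorbing a dense sequence member by member gives an increasing chain
  of finite orthonormal sets whose union has dense span.\<close>

lemma orthonormal_basis_exists:
  assumes "separable_space (euclidean :: 'a::real_inner topology)"
  shows "\<exists>S::'a set. orthonormal_basis S"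
proof -
  obtain D :: "'a set" where D: "countable D" "closure D = UNIV"
    using assms by (auto simp: separable_space_def)
  then have "D \<noteq> {}" by auto
  define d where "d = from_nat_into D"
  have rd: "range d = D" using D \<open>D \<noteq> {}\<close> by (simp add: d_def)
  let ?P = "\<lambda>(n::nat) S. onset S \<and> finite (S :: 'a set)"
  let ?R = "\<lambda>n S S'. S \<subseteq> S' \<and> d n \<in> span S'"
  have "\<exists>f. \<forall>n. ?P n (f n) \<and> ?R n (f n) (f (Suc n))"
  proof (rule dependent_nat_choice)
    show "\<exists>S::'a set. onset S \<and> finite S" by (rule exI[of _ "{}"]) (simp add: onset_def)
  next
    fix S :: "'a set" and n assume "onset S \<and> finite S"
    then show "\<exists>S'. (onset S' \<and> finite S') \<and> S \<subseteq> S' \<and> d n \<in> span S'"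
      using onset_extend[of S "{d n}"] by (metis finite.emptyI finite_insert insert_subset)
  qed
  then obtain f where f: "\<And>n. onset (f n)" "\<And>n. f n \<subseteq> f (Suc n)" "\<And>n. d n \<in> span (f (Suc n))"
    by auto
  have mono: "f m \<subseteq> f n" if "m \<le> n" for m n
    using lift_Suc_mono_le[of f, OF f(2) that] .
  let ?S = "\<Union>n. f n"
  have "onset ?S"
    unfolding onset_def
  proof safe
    fix u v m n assume uv: "u \<in> f m" "v \<in> f n"
    then have "u \<in> f (max m n)" "v \<in> f (max m n)" using mono[of m "max m n"] mono[of n "max m n"] by auto
    then show "u \<bullet> v = (if u = v then 1 else 0)" using f(1) by (simp add: onset_def)
  qed
  moreover have "D \<subseteq> span ?S"
  proof -
    have "d n \<in> span ?S" for n
      using f(3)[of n] span_mono[of "f (Suc n)" ?S] by auto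
    then show ?thesis using rd by auto
  qed
  then have "closure (span ?S) = UNIV" using D(2) closure_mono by blast
  ultimately show ?thesis using onset_imp_orthonormal unfolding orthonormal_basis_def by blast
qed

text \<open>Parseval's identity. Bessel's inequality bounds the finite sums from above. From below,
  the expansion of \<open>x\<close> in a finite part of \<open>S\<close> is the best approximation
  from its span, hence at least as good as any approximation \<open>z\<close> that density
  provides.\<close>

lemma orthonormal_basis_norm_sq:
  assumes S: "orthonormal_basis S"
  shows "((\<lambda>e. (e \<bullet> x)\<^sup>2) has_sum (norm x)\<^sup>2) S"
proof -
  have on: "onset S" using S orthonormal_imp_onset by (auto simp: orthonormal_basis_def)
  have fin: "\<exists>F. finite F \<and> F \<subseteq> S \<and> (\<forall>G. finite G \<longrightarrow> F \<subseteq> G \<longrightarrow> G \<subseteq> S \<longrightarrow>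
      (norm x)\<^sup>2 - e\<^sup>2 \<le> (\<Sum>u\<in>G. (u \<bullet> x)\<^sup>2))" if e: "e > 0" for e :: real
  proof -
    have "x \<in> closure (span S)" using S by (simp add: orthonormal_basis_def)
    then obtain z where z: "z \<in> span S" "dist z x < e"
      using e unfolding closure_approachable by blast
    obtain F r where F: "finite F" "F \<subseteq> S" "z = (\<Sum>a\<in>F. r a *\<^sub>R a)"
      using z(1) unfolding span_explicit by auto
    have "(norm x)\<^sup>2 - e\<^sup>2 \<le> (\<Sum>u\<in>G. (u \<bullet> x)\<^sup>2)" if G: "finite G" "F \<subseteq> G" "G \<subseteq> S" for G
    proof -
      have onG: "onset G" using on G onset_subset by blast
      let ?y = "\<Sum>u\<in>G. (u \<bullet> x) *\<^sub>R u"
      have zG: "z \<in> span G" using F G by (auto intro!: span_sum span_scale intro: span_base)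
      have yG: "?y \<in> span G" by (intro span_sum span_scale span_base)
      have "(x - ?y) \<bullet> (?y - z) = 0"
        using onset_residual[OF onG G(1), of "?y - z" x] zG yG by (simp add: span_diff)
      then have "(norm ((x - ?y) + (?y - z)))\<^sup>2 = (norm (x - ?y))\<^sup>2 + (norm (?y - z))\<^sup>2"
        by (intro norm_add_Pythagorean) (simp add: orthogonal_def)
      then have "(norm (x - ?y))\<^sup>2 \<le> (norm (x - z))\<^sup>2" by simp
      also have "\<dots> \<le> e\<^sup>2" using z(2) by (intro power_mono) (auto simp: dist_norm norm_minus_commute)
      finally show ?thesis using onset_residual_norm[OF onG G(1), of x] by linarith
    qed
    then show ?thesis using F by blast
  qed
  have le: "(\<Sum>u\<in>G. (u \<bullet> x)\<^sup>2) \<le> (norm x)\<^sup>2" if "finite G" "G \<subseteq> S" for G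
    using onset_residual_norm[OF onset_subset[OF on that(2)] that(1), of x] by simp
  show ?thesis
    unfolding has_sum_def tendsto_iff eventually_finite_subsets_at_top
  proof (intro allI impI)
    fix e :: real assume e: "e > 0"
    define d where "d = sqrt (e / 2)"
    have d: "d > 0" "d\<^sup>2 = e / 2" using e by (auto simp: d_def)
    obtain F where F: "finite F" "F \<subseteq> S" "\<And>G. finite G \<Longrightarrow> F \<subseteq> G \<Longrightarrow> G \<subseteq> S \<Longrightarrow>
      (norm x)\<^sup>2 - d\<^sup>2 \<le> (\<Sum>u\<in>G. (u \<bullet> x)\<^sup>2)" using fin[OF d(1)] by auto
    show "\<exists>X. finite X \<and> X \<subseteq> S \<and> (\<forall>Y. finite Y \<and> X \<subseteq> Y \<and> Y \<subseteq> S \<longrightarrow>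
        dist (\<Sum>e\<in>Y. (e \<bullet> x)\<^sup>2) ((norm x)\<^sup>2) < e)"
    proof (intro exI[of _ F] conjI allI impI F(1,2))
      fix Y assume Y: "finite Y \<and> F \<subseteq> Y \<and> Y \<subseteq> S"
      then show "dist (\<Sum>e\<in>Y. (e \<bullet> x)\<^sup>2) ((norm x)\<^sup>2) < e"
        using F(3)[of Y] le[of Y] d e by (auto simp: dist_real_def)
    qed
  qed
qed

text \<open>Polarisation of Parseval's identity.\<close>

lemma orthonormal_basis_inner:
  assumes S: "orthonormal_basis S"
  shows "((\<lambda>e. (e \<bullet> x) * (e \<bullet> y)) has_sum (x \<bullet> y)) S"
proof -
  have "((\<lambda>e. (1/4) * (e \<bullet> (x + y))\<^sup>2 + (-1/4) * (e \<bullet> (x - y))\<^sup>2) has_sum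
      (1/4) * (norm (x + y))\<^sup>2 + (-1/4) * (norm (x - y))\<^sup>2) S"
    by (intro has_sum_cmult_right has_sum_add orthonormal_basis_norm_sq S)
  moreover have "(1/4) * (e \<bullet> (x + y))\<^sup>2 + (-1/4) * (e \<bullet> (x - y))\<^sup>2 = (e \<bullet> x) * (e \<bullet> y)" for e
    by (simp add: inner_add_right inner_diff_right power2_eq_square algebra_simps)
  moreover have "(1/4) * (norm (x + y))\<^sup>2 + (-1/4) * (norm (x - y))\<^sup>2 = x \<bullet> y"
    by (simp add: power2_norm_eq_inner inner_add_right inner_diff_right inner_add_left inner_diff_left
        inner_commute field_simps)
  ultimately show ?thesis by simp
qed

section \<open>Right Hilbert spaces\<close>

context right_hilbert_space
begin

section \<open>The scalars as a real vector space\<close>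

lemma K_closed [simp, intro]:
  "0 \<in> K" "1 \<in> K" "of_real r \<in> K"
  "a \<in> K \<Longrightarrow> b \<in> K \<Longrightarrow> a + b \<in> K" "a \<in> K \<Longrightarrow> b \<in> K \<Longrightarrow> a - b \<in> K"
  "a \<in> K \<Longrightarrow> b \<in> K \<Longrightarrow> a * b \<in> K" "a \<in> K \<Longrightarrow> - a \<in> K" "a \<in> K \<Longrightarrow> qcnj a \<in> K"
  "a \<in> K \<Longrightarrow> r *\<^sub>R a \<in> K"
  using K_cases by (auto simp: quat_Reals_iff quat_Complexes_def quat_comp_defs)

text \<open>An orthonormal basis of the scalars for the Euclidean scalar product
  \<open>qRe (qcnj a * c)\<close>. The clause on \<open>card U\<close> is the source of the factor
  \<open>dim K\<close> in the distance formula.\<close>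

definition K_real_basis :: "quat set \<Rightarrow> bool" where
  "K_real_basis U \<longleftrightarrow> finite U \<and> U \<subseteq> K \<and> card U = dim K \<and>
     (\<forall>u\<in>U. \<forall>v\<in>U. qRe (qcnj u * v) = (if u = v then 1 else 0)) \<and>
     (\<forall>a\<in>K. a = (\<Sum>u\<in>U. qRe (qcnj u * a) *\<^sub>R u))"

lemma K_real_basisD:
  assumes "K_real_basis U"
  shows "finite U" "U \<subseteq> K" "card U = dim K" "u \<in> U \<Longrightarrow> u \<in> K"
    "u \<in> U \<Longrightarrow> v \<in> U \<Longrightarrow> qRe (qcnj u * v) = (if u = v then 1 else 0)"
    "a \<in> K \<Longrightarrow> a = (\<Sum>u\<in>U. qRe (qcnj u * a) *\<^sub>R u)"
  using assms by (auto simp only: K_real_basis_def subset_iff)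

lemma K_real_basis_exists:
  obtains U where "K_real_basis U"
proof -
  note K_basisI = that
  have *: thesis if U: "finite U" "U \<subseteq> K"
    and on: "\<And>u v. u \<in> U \<Longrightarrow> v \<in> U \<Longrightarrow> qRe (qcnj u * v) = (if u = v then 1 else 0)"
    and ex: "\<And>a. a \<in> K \<Longrightarrow> a = (\<Sum>u\<in>U. qRe (qcnj u * a) *\<^sub>R u)" for U
  proof -
    have "independent U"
    proof (rule independent_if_scalars_zero[OF U(1)])
      fix c u assume z: "(\<Sum>v\<in>U. c v *\<^sub>R v) = 0" and u: "u \<in> U"
      have "0 = qRe (qcnj u * (\<Sum>v\<in>U. c v *\<^sub>R v))" by (simp add: z)
      also have "\<dots> = (\<Sum>v\<in>U. c v * qRe (qcnj u * v))"
        by (simp add: sum_distrib_left qRe_sum)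
      also have "\<dots> = (\<Sum>v\<in>U. if u = v then c v else 0)"
        using on u by (intro sum.cong) auto
      finally show "c u = 0" using U(1) u by simp
    qed
    moreover have "K \<subseteq> span U"
    proof
      fix a assume "a \<in> K"
      have "(\<Sum>u\<in>U. qRe (qcnj u * a) *\<^sub>R u) \<in> span U"
        by (intro span_sum span_scale span_base)
      then show "a \<in> span U" using ex[OF \<open>a \<in> K\<close>] by simp
    qed
    ultimately have "card U = dim K" using U by (metis dim_unique)
    then show thesis using K_basisI[of U] U on ex unfolding K_real_basis_def by blast
  qed
  consider "K = \<real>" | "K = quat_Complexes" | "K = UNIV" using K_cases by auto
  then show thesis
  proof cases
    case 1
    show thesis
    proof (rule *[of "{1}"])
      show "a = (\<Sum>u\<in>{1}. qRe (qcnj u * a) *\<^sub>R u)" if "a \<in> K" for a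
        using that unfolding 1 quat_Reals_iff by (simp add: quat_comp_defs)
    qed (auto simp: 1)
  next
    case 2
    have ne: "1 \<noteq> Quat 0 1 0 0" by (simp add: quat_comp_defs)
    show thesis
    proof (rule *[of "{1, Quat 0 1 0 0}"])
      show "a = (\<Sum>u\<in>{1, Quat 0 1 0 0}. qRe (qcnj u * a) *\<^sub>R u)" if "a \<in> K" for a
        using that ne unfolding 2 quat_Complexes_def by simp (simp add: quat_comp_defs)
      have "\<forall>u\<in>{1, Quat 0 1 0 0}. \<forall>v\<in>{1, Quat 0 1 0 0}. qRe (qcnj u * v) = (if u = v then 1 else 0)"
        by (simp add: quat_comp_defs)
      then show "qRe (qcnj u * v) = (if u = v then 1 else 0)"
        if "u \<in> {1, Quat 0 1 0 0}" "v \<in> {1, Quat 0 1 0 0}" for u v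
        using that by blast
      show "{1, Quat 0 1 0 0} \<subseteq> K" unfolding 2 quat_Complexes_def by (simp add: quat_comp_defs)
    qed simp
  next
    case 3
    let ?U = "{1, Quat 0 1 0 0, Quat 0 0 1 0, Quat 0 0 0 1}"
    have ne: "1 \<noteq> Quat 0 1 0 0" "1 \<noteq> Quat 0 0 1 0" "1 \<noteq> Quat 0 0 0 1" by (simp_all add: quat_comp_defs)
    show thesis
    proof (rule *[of ?U])
      show "a = (\<Sum>u\<in>?U. qRe (qcnj u * a) *\<^sub>R u)" for a
        using ne by simp (simp add: quat_comp_defs)
      have "\<forall>u\<in>?U. \<forall>v\<in>?U. qRe (qcnj u * v) = (if u = v then 1 else 0)"
        by (simp add: quat_comp_defs)
      then show "qRe (qcnj u * v) = (if u = v then 1 else 0)" if "u \<in> ?U" "v \<in> ?U" for u v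
        using that by blast
    qed (simp_all add: 3)
  qed
qed

section \<open>Scalar multiplication and Hermitian forms\<close>

lemma rscale_simps [simp]:
  "x \<odot> 0 = 0" "x \<odot> 1 = x" "x \<odot> of_real r = r *\<^sub>R x"
  "a \<in> K \<Longrightarrow> 0 \<odot> a = 0" "a \<in> K \<Longrightarrow> (- x) \<odot> a = - (x \<odot> a)"
  "a \<in> K \<Longrightarrow> x \<odot> (- a) = - (x \<odot> a)"
proof -
  show 0: "x \<odot> 0 = 0" for x using rscale_of_real[of x 0] by simp
  show "x \<odot> 1 = x" using rscale_of_real[of x 1] by simp
  show "x \<odot> of_real r = r *\<^sub>R x" by (rule rscale_of_real)
  assume a: "a \<in> K"
  show 1: "0 \<odot> a = 0" using rscale_add_left[OF a, of 0 0] by simp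
  show "(- x) \<odot> a = - (x \<odot> a)"
    using rscale_add_left[OF a, of "-x" x] 1 by (simp add: eq_neg_iff_add_eq_0)
  show "x \<odot> (- a) = - (x \<odot> a)"
    using rscale_add_right[of "-a" a x] a 0[of x] by (simp add: eq_neg_iff_add_eq_0)
qed

lemma rscale_scaleR [simp]:
  assumes "a \<in> K"
  shows "x \<odot> (r *\<^sub>R a) = r *\<^sub>R (x \<odot> a)" "(r *\<^sub>R x) \<odot> a = r *\<^sub>R (x \<odot> a)"
proof -
  show "x \<odot> (r *\<^sub>R a) = r *\<^sub>R (x \<odot> a)"
    using rscale_mult[of a "of_real r" x] assms by (simp add: of_real_mult_quat)
  then show "(r *\<^sub>R x) \<odot> a = r *\<^sub>R (x \<odot> a)"
    using rscale_mult[of "of_real r" a x] assms by (simp add: of_real_mult_quat)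
qed

lemma rscale_sum_right:
  "(\<And>i. i \<in> A \<Longrightarrow> f i \<in> K) \<Longrightarrow> x \<odot> sum f A = (\<Sum>i\<in>A. x \<odot> f i) \<and> sum f A \<in> K"
  by (induction A rule: infinite_finite_induct) (auto simp: rscale_add_right)

lemma rscale_sum_left: "a \<in> K \<Longrightarrow> sum f A \<odot> a = (\<Sum>i\<in>A. f i \<odot> a)"
  by (induction A rule: infinite_finite_induct) (auto simp: rscale_add_left)

lemma rscale_inverse:
  assumes "a \<in> K" "qnorm a = 1"
  shows "x \<odot> a \<odot> qcnj a = x"
proof -
  have "x \<odot> a \<odot> qcnj a = x \<odot> (a * qcnj a)" using assms by (simp add: rscale_mult)
  then show ?thesis by (simp add: mult_qcnj_self assms)
qed

text \<open>No definiteness is asked, so that \<open>form\<close> and the indefinite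
  \<open>B\<close> are treated together; positivity is assumed only on the subspace being
  orthonormalised.\<close>

definition hermitian :: "('h \<Rightarrow> 'h \<Rightarrow> quat) \<Rightarrow> bool" where
  "hermitian h \<longleftrightarrow> (\<forall>x y. h x y \<in> K \<and> h x y = qcnj (h y x)) \<and>
     (\<forall>x y z. h x (y + z) = h x y + h x z) \<and> (\<forall>x y. \<forall>a\<in>K. h x (y \<odot> a) = h x y * a)"

lemma hermitianD:
  assumes "hermitian h"
  shows "h x y \<in> K" "h x (y + z) = h x y + h x z" "h (x + y) z = h x z + h y z"
    "a \<in> K \<Longrightarrow> h x (y \<odot> a) = h x y * a" "a \<in> K \<Longrightarrow> h (x \<odot> a) y = qcnj a * h x y"
    "h x 0 = 0" "h 0 y = 0" "h x (- y) = - h x y" "h (- x) y = - h x y"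
    "h x (y - z) = h x y - h x z" "h (x - y) z = h x z - h y z"
    "h x (r *\<^sub>R y) = r *\<^sub>R h x y" "h (r *\<^sub>R x) y = r *\<^sub>R h x y"
    "h x (sum f A) = (\<Sum>i\<in>A. h x (f i))" "h (sum f A) y = (\<Sum>i\<in>A. h (f i) y)"
proof -
  have c: "h x y = qcnj (h y x)" for x y using assms unfolding hermitian_def by blast
  show "h x y \<in> K" using assms unfolding hermitian_def by blast
  show a2: "h x (y + z) = h x y + h x z" for x y z using assms unfolding hermitian_def by blast
  show a1: "h (x + y) z = h x z + h y z" for x y z
    using c[of "x+y" z] c[of x z] c[of y z] a2[of z x y] by simp
  show s2: "h x (y \<odot> a) = h x y * a" if "a \<in> K" for x y a
    using assms that unfolding hermitian_def by blast
  show "h (x \<odot> a) y = qcnj a * h x y" if "a \<in> K"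
    using c[of "x \<odot> a" y] c[of x y] s2[OF that, of y x] by simp
  show r2: "h x (r *\<^sub>R y) = r *\<^sub>R h x y" for x y r
    using s2[of "of_real r" x y] by (simp add: of_real_mult_quat)
  show r1: "h (r *\<^sub>R x) y = r *\<^sub>R h x y" for x y r
    using c[of "r *\<^sub>R x" y] c[of x y] r2[of y r x] by simp
  show z2: "h x 0 = 0" for x using r2[of x 0 0] by simp
  show z1: "h 0 y = 0" for y using r1[of 0 0 y] by simp
  show n2: "h x (- y) = - h x y" for x y using r2[of x "-1" y] by simp
  show n1: "h (- x) y = - h x y" for x y using r1[of "-1" x y] by simp
  show "h x (y - z) = h x y - h x z" using a2[of x y "-z"] n2 by simp
  show "h (x - y) z = h x z - h y z" using a1[of x "-y" z] n1 by simp
  show "h x (sum f A) = (\<Sum>i\<in>A. h x (f i))"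
    by (induction A rule: infinite_finite_induct) (simp_all add: a2 z2)
  show "h (sum f A) y = (\<Sum>i\<in>A. h (f i) y)"
    by (induction A rule: infinite_finite_induct) (simp_all add: a1 z1)
qed

lemma hermitian_cnj: "hermitian h \<Longrightarrow> h x y = qcnj (h y x)"
  unfolding hermitian_def by blast

lemma hermitian_self: "hermitian h \<Longrightarrow> h x x = of_real (qRe (h x x))"
  using hermitian_cnj[of h x x] by (simp only: quat_eq_of_real_iff)

lemma hermitian_form: "hermitian form"
proof -
  have a: "form x (y + z) = form x y + form x z" for x y z
    using form_right[of 1 x y z] by simp
  then have "form x 0 = 0" for x by (metis add_cancel_right_right)
  then have "form x (y \<odot> a) = form x y * a" if "a \<in> K" for x y a
    using form_right[OF that, of x y 0] by simp
  with a form_in_K form_cnj show ?thesis unfolding hermitian_def by blast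
qed

text \<open>Testing with \<open>a = qcnj (h x y)\<close> produces the squared modulus of
  \<open>h x y\<close>. Through this equivalence statements over \<open>K\<close> are proved from
  real parts.\<close>

lemma hermitian_zero_iff:
  assumes "hermitian h"
  shows "h x y = 0 \<longleftrightarrow> (\<forall>a\<in>K. qRe (h x (y \<odot> a)) = 0)"
proof
  assume *: "\<forall>a\<in>K. qRe (h x (y \<odot> a)) = 0"
  have "qcnj (h x y) \<in> K" using hermitianD(1)[OF assms] by blast
  then have "qRe (h x y * qcnj (h x y)) = 0" using * hermitianD(4)[OF assms] by metis
  then show "h x y = 0" using qRe_cnj_mult_self_eq_0[of "h x y"] by (simp add: qRe_mult_commute)
qed (use hermitianD(4)[OF assms] in auto)

lemma subspace_is_subspace: "is_subspace E \<Longrightarrow> subspace E"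
  unfolding is_subspace_def subspace_def using K_closed(3) rscale_of_real by metis

lemma is_subspaceD:
  assumes "is_subspace E"
  shows "0 \<in> E" "x \<in> E \<Longrightarrow> y \<in> E \<Longrightarrow> x + y \<in> E" "x \<in> E \<Longrightarrow> y \<in> E \<Longrightarrow> x - y \<in> E"
    "x \<in> E \<Longrightarrow> a \<in> K \<Longrightarrow> x \<odot> a \<in> E" "x \<in> E \<Longrightarrow> r *\<^sub>R x \<in> E" "x \<in> E \<Longrightarrow> - x \<in> E"
    "(\<And>i. i \<in> A \<Longrightarrow> f i \<in> E) \<Longrightarrow> sum f A \<in> E"
  using assms subspace_is_subspace[OF assms]
  by (auto simp: is_subspace_def intro: subspace_diff subspace_scale subspace_neg subspace_sum)

subsection \<open>Gram--Schmidt orthonormalisation over \<open>K\<close>\<close>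

definition K_on :: "('h \<Rightarrow> 'h \<Rightarrow> quat) \<Rightarrow> (nat \<Rightarrow> 'h) \<Rightarrow> nat \<Rightarrow> bool" where
  "K_on h f n \<longleftrightarrow> (\<forall>i<n. \<forall>j<n. h (f i) (f j) = (if i = j then 1 else 0))"

definition K_onb :: "('h \<Rightarrow> 'h \<Rightarrow> quat) \<Rightarrow> (nat \<Rightarrow> 'h) \<Rightarrow> nat \<Rightarrow> 'h set \<Rightarrow> bool" where
  "K_onb h f n E \<longleftrightarrow> K_on h f n \<and> (\<forall>i<n. f i \<in> E) \<and> (\<forall>x\<in>E. x = (\<Sum>i<n. f i \<odot> h (f i) x))"

lemma K_on_expand_component:
  assumes "hermitian h" "K_on h f n" "k < n" "\<And>i. i < n \<Longrightarrow> c i \<in> K"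
  shows "h (f k) (\<Sum>i<n. f i \<odot> c i) = c k"
proof -
  have "h (f k) (\<Sum>i<n. f i \<odot> c i) = (\<Sum>i<n. if k = i then c i else 0)"
    unfolding hermitianD(14)[OF assms(1)]
    using assms hermitianD(4)[OF assms(1)] by (intro sum.cong) (auto simp: K_on_def)
  then show ?thesis using assms by simp
qed

definition K_span :: "(nat \<Rightarrow> 'h) \<Rightarrow> nat \<Rightarrow> 'h set" where
  "K_span f n = {\<Sum>i<n. f i \<odot> c i |c. \<forall>i. c i \<in> K}"

lemma K_spanI: "(\<And>i. i < n \<Longrightarrow> c i \<in> K) \<Longrightarrow> (\<Sum>i<n. f i \<odot> c i) \<in> K_span f n"
  unfolding K_span_def mem_Collect_eq
  by (intro exI[of _ "\<lambda>i. if i < n then c i else 0"]) simp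

lemma K_spanE:
  assumes "x \<in> K_span f n"
  obtains c where "\<And>i. c i \<in> K" "x = (\<Sum>i<n. f i \<odot> c i)"
proof -
  from assms have "\<exists>c. x = (\<Sum>i<n. f i \<odot> c i) \<and> (\<forall>i. c i \<in> K)"
    unfolding K_span_def mem_Collect_eq .
  then obtain c where "x = (\<Sum>i<n. f i \<odot> c i)" "\<forall>i. c i \<in> K" by (elim exE conjE)
  then show thesis by (intro that[of c]) auto
qed

lemma is_subspace_K_span: "is_subspace (K_span f n)"
  unfolding is_subspace_def
proof (intro conjI ballI)
  show "0 \<in> K_span f n" using K_spanI[of n "\<lambda>_. 0" f] by simp
next
  fix x y assume "x \<in> K_span f n" "y \<in> K_span f n"
  then obtain c d where c: "\<And>i. c i \<in> K" "x = (\<Sum>i<n. f i \<odot> c i)"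
    and d: "\<And>i. d i \<in> K" "y = (\<Sum>i<n. f i \<odot> d i)" by (metis K_spanE)
  have "x + y = (\<Sum>i<n. f i \<odot> (c i + d i))" using c d by (simp add: rscale_add_right sum.distrib)
  also have "\<dots> \<in> K_span f n" using c d by (intro K_spanI) auto
  finally show "x + y \<in> K_span f n" .
next
  fix x a assume "x \<in> K_span f n" and a: "a \<in> K"
  then obtain c where c: "\<And>i. c i \<in> K" "x = (\<Sum>i<n. f i \<odot> c i)" by (metis K_spanE)
  have "x \<odot> a = (\<Sum>i<n. f i \<odot> (c i * a))" using c a by (simp add: rscale_mult rscale_sum_left)
  also have "\<dots> \<in> K_span f n" using c a by (intro K_spanI) auto
  finally show "x \<odot> a \<in> K_span f n" .
qed

lemma Gram_Schmidt_K:
  assumes h: "hermitian h" and pos: "\<And>x. x \<in> E \<Longrightarrow> x \<noteq> 0 \<Longrightarrow> qRe (h x x) > 0"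
    and E: "is_subspace E" and dim: "has_dimension E n"
  obtains f where "K_onb h f n E"
proof -
  note hD = hermitianD[OF h]
  obtain b where b: "bij_betw (\<lambda>c. \<Sum>i<n. b i \<odot> c i) ({..<n} \<rightarrow>\<^sub>E K) E"
    using dim by (auto simp: has_dimension_def)
  define S where "S = K_span b"
  have Sn: "S n = E"
  proof (intro equalityI subsetI)
    fix x assume "x \<in> S n"
    then obtain c where c: "\<And>i. c i \<in> K" "x = (\<Sum>i<n. b i \<odot> c i)"
      unfolding S_def by (metis K_spanE)
    then have "x = (\<Sum>i<n. b i \<odot> restrict c {..<n} i)" by simp
    moreover have "restrict c {..<n} \<in> {..<n} \<rightarrow>\<^sub>E K" using c by auto
    ultimately show "x \<in> E" using b unfolding bij_betw_def by blast
  next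
    fix x assume "x \<in> E"
    then obtain c where "c \<in> {..<n} \<rightarrow>\<^sub>E K" "x = (\<Sum>i<n. b i \<odot> c i)"
      using b unfolding bij_betw_def by blast
    then show "x \<in> S n" unfolding S_def by (auto intro!: K_spanI)
  qed
  \<comment> \<open>\<open>has_dimension\<close> speaks of extensional coefficient functions, so
    uniqueness of coordinates is applied to restrictions.\<close>
  have ind: "c i = 0" if c: "\<And>i. i < n \<Longrightarrow> c i \<in> K" and z: "(\<Sum>i<n. b i \<odot> c i) = 0" and i: "i < n" for c i
  proof -
    have "(\<Sum>i<n. b i \<odot> restrict c {..<n} i) = (\<Sum>i<n. b i \<odot> (restrict (\<lambda>_. 0) {..<n}) i)"
      using z by simp
    moreover have "restrict c {..<n} \<in> {..<n} \<rightarrow>\<^sub>E K" "restrict (\<lambda>_. 0) {..<n} \<in> {..<n} \<rightarrow>\<^sub>E K"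
      using c by auto
    ultimately have "restrict c {..<n} = restrict (\<lambda>_. 0) {..<n}"
      using b unfolding bij_betw_def inj_on_def by blast
    then show ?thesis using i by (metis lessThan_iff restrict_apply')
  qed
  have Ssub: "is_subspace (S m)" for m unfolding S_def by (rule is_subspace_K_span)
  have Smono: "S m \<subseteq> S (Suc m)" and bS: "b m \<in> S (Suc m)" for m
  proof -
    show "S m \<subseteq> S (Suc m)"
    proof
      fix x assume "x \<in> S m"
      then obtain c where c: "\<And>i. c i \<in> K" "x = (\<Sum>i<m. b i \<odot> c i)"
        unfolding S_def by (metis K_spanE)
      then show "x \<in> S (Suc m)" using K_spanI[of "Suc m" "c(m := 0)" b] unfolding S_def by simp
    qed
    show "b m \<in> S (Suc m)"
      using K_spanI[of "Suc m" "(\<lambda>_. 0)(m := 1)" b] unfolding S_def by simp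
  qed
  have SE: "S m \<subseteq> E" if "m \<le> n" for m
    using lift_Suc_mono_le[of S, OF Smono that] Sn by simp
  have bnot: "b m \<notin> S m" if m: "m < n" for m
  proof
    assume "b m \<in> S m"
    then obtain c where c: "\<And>i. c i \<in> K" "b m = (\<Sum>i<m. b i \<odot> c i)"
      unfolding S_def by (metis K_spanE)
    let ?d = "\<lambda>i. if i < m then c i else if i = m then -1 else 0"
    have "(\<Sum>i<n. b i \<odot> ?d i) = (\<Sum>i<Suc m. b i \<odot> ?d i)"
      using m by (intro sum.mono_neutral_right) auto
    also have "\<dots> = 0" using c by simp
    finally have z: "(\<Sum>i<n. b i \<odot> ?d i) = 0" .
    have "- 1 \<in> K" using K_closed(7)[OF K_closed(2)] by simp
    then have "?d i \<in> K" for i using c(1) by auto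
    then have "?d m = 0" using ind[of ?d m, OF _ z m] by blast
    then show False by simp
  qed
  have "\<exists>f. K_onb h f m (S m)" if "m \<le> n" for m
    using that
  proof (induction m)
    case 0
    then show ?case by (auto simp: K_onb_def K_on_def S_def K_span_def)
  next
    case (Suc m)
    then obtain f where f: "K_on h f m" "\<And>i. i < m \<Longrightarrow> f i \<in> S m"
      "\<And>x. x \<in> S m \<Longrightarrow> x = (\<Sum>i<m. f i \<odot> h (f i) x)"
      by (auto simp: K_onb_def)
    have mn: "m < n" using Suc.prems by simp
    define y where "y = (\<Sum>i<m. f i \<odot> h (f i) (b m))"
    define v where "v = b m - y"
    have yS: "y \<in> S m" unfolding y_def
      using f(2) is_subspaceD[OF Ssub] hD(1) by (intro is_subspaceD(7)[OF Ssub]) auto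
    have v0: "v \<noteq> 0" using yS bnot[OF mn] by (auto simp: v_def)
    have vS: "v \<in> S (Suc m)" unfolding v_def
      using yS bS[of m] Smono[of m] is_subspaceD(3)[OF Ssub] by blast
    have vE: "v \<in> E" using vS SE[OF Suc.prems] by blast
    have vpos: "qRe (h v v) > 0" using pos vE v0 by blast
    have fv: "h (f k) v = 0" if "k < m" for k
      using K_on_expand_component[OF h f(1) that, of "\<lambda>i. h (f i) (b m)"] hD(1)
      by (simp add: v_def y_def hD(10))
    define w where "w = (1 / sqrt (qRe (h v v))) *\<^sub>R v"
    have vw: "v = sqrt (qRe (h v v)) *\<^sub>R w" using vpos by (simp add: w_def)
    have ww: "h w w = 1"
    proof -
      have "h w w = (1 / qRe (h v v)) *\<^sub>R h v v"
        using vpos by (simp add: w_def hD(12,13))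
      also have "\<dots> = (1 / qRe (h v v)) *\<^sub>R of_real (qRe (h v v))"
        using hermitian_self[OF h, of v] by simp
      finally show ?thesis using vpos by (simp add: of_real_def)
    qed
    have fw: "h (f k) w = 0" "h w (f k) = 0" if "k < m" for k
      using fv[OF that] hermitian_cnj[OF h, of w "f k"] by (simp_all add: w_def hD(12))
    define g where "g = f(m := w)"
    have on: "K_on h g (Suc m)"
      using f(1) fw ww by (auto simp: K_on_def g_def less_Suc_eq)
    have wS: "w \<in> S (Suc m)" unfolding w_def using is_subspaceD(5)[OF Ssub vS] .
    have gS: "g i \<in> S (Suc m)" if "i < Suc m" for i
      using that wS f(2) Smono[of m] by (auto simp: g_def less_Suc_eq)
    \<comment> \<open>\<open>T\<close> is the expansion map of the new system. As it is
      \<open>K\<close>-linear, it is the identity on \<open>S (Suc m)\<close> once it fixes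
      \<open>S m\<close> and \<open>b m\<close>.\<close>
    define T where "T x = (\<Sum>i<Suc m. g i \<odot> h (g i) x)" for x
    have T_add: "T (x + y) = T x + T y" for x y
      by (simp only: T_def hD(2) rscale_add_right[OF hD(1) hD(1)] sum.distrib)
    have T_scale: "T (x \<odot> a) = T x \<odot> a" if "a \<in> K" for x a
      using that by (simp only: T_def hD(4) rscale_mult[OF hD(1)] rscale_sum_left)
    have Tg: "T (g k) = g k" if "k < Suc m" for k
    proof -
      have "T (g k) = (\<Sum>i<Suc m. if i = k then g i else 0)"
        unfolding T_def using on that by (intro sum.cong) (auto simp: K_on_def)
      then show ?thesis using that by simp
    qed
    have TS: "T x = x" if x: "x \<in> S m" for x
    proof -
      have "h w x = 0"
      proof -
        have "h w x = (\<Sum>i<m. h w (f i) * h (f i) x)"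
          by (subst f(3)[OF x]) (simp only: hD(14) hD(4)[OF hD(1)])
        then show ?thesis using fw by simp
      qed
      then have "T x = (\<Sum>i<m. f i \<odot> h (f i) x)" by (simp add: T_def g_def)
      then show ?thesis using f(3)[OF x] by simp
    qed
    have Tb: "T (b m) = b m"
    proof -
      have bm: "b m = y + g m \<odot> of_real (sqrt (qRe (h v v)))"
        using vw by (simp add: g_def v_def)
      have "T (b m) = T y + T (g m) \<odot> of_real (sqrt (qRe (h v v)))"
        by (subst bm) (simp only: T_add T_scale K_closed(3))
      then show ?thesis using TS[OF yS] Tg[of m] bm by simp
    qed
    have "T x = x" if "x \<in> S (Suc m)" for x
    proof -
      from that obtain c where c: "\<And>i. c i \<in> K" "x = (\<Sum>i<Suc m. b i \<odot> c i)"
        unfolding S_def by (metis K_spanE)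
      have "(\<Sum>i<m. b i \<odot> c i) \<in> S m" unfolding S_def by (rule K_spanI[OF c(1)])
      then have "T (\<Sum>i<m. b i \<odot> c i) = (\<Sum>i<m. b i \<odot> c i)" by (rule TS)
      moreover have "T (b m \<odot> c m) = b m \<odot> c m" using T_scale[of "c m" "b m"] Tb c(1) by simp
      ultimately show ?thesis unfolding c(2) sum.lessThan_Suc T_add by simp
    qed
    then have "\<forall>x\<in>S (Suc m). x = (\<Sum>i<Suc m. g i \<odot> h (g i) x)" unfolding T_def by metis
    with on gS have "K_onb h g (Suc m) (S (Suc m))" unfolding K_onb_def by blast
    then show ?case by blast
  qed
  from this[of n] Sn that show thesis by auto
qed

lemma K_onb_span:
  assumes "K_onb h f n E" "hermitian h" and U: "K_real_basis U"
  shows "E \<subseteq> span ((\<lambda>(i, u). f i \<odot> u) ` ({..<n} \<times> U))"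
proof
  let ?M = "(\<lambda>(i, u). f i \<odot> u) ` ({..<n} \<times> U)"
  fix x assume "x \<in> E"
  then have x: "x = (\<Sum>i<n. f i \<odot> h (f i) x)" using assms by (simp add: K_onb_def)
  have "f i \<odot> a \<in> span ?M" if "i < n" "a \<in> K" for i a
  proof -
    have "f i \<odot> a = (\<Sum>u\<in>U. qRe (qcnj u * a) *\<^sub>R (f i \<odot> u))"
      using rscale_sum_right[of U "\<lambda>u. qRe (qcnj u * a) *\<^sub>R u" "f i"] K_real_basisD(4)[OF U]
      by (subst K_real_basisD(6)[OF U that(2)]) (auto intro!: sum.cong)
    also have "\<dots> \<in> span ?M"
      using that by (intro span_sum span_scale span_base) auto
    finally show ?thesis .
  qed
  then have "(\<Sum>i<n. f i \<odot> h (f i) x) \<in> span ?M"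
    using hermitianD(1)[OF assms(2)] by (intro span_sum) auto
  with x show "x \<in> span ?M" by simp
qed

lemma qRe_hermitian_basis:
  assumes "hermitian h" "K_on h f n" "i < n" "j < n" "u \<in> K" "v \<in> K"
  shows "qRe (h (f i \<odot> u) (f j \<odot> v)) = (if i = j then qRe (qcnj u * v) else 0)"
  using assms(2-6) by (simp add: hermitianD[OF assms(1)] K_on_def)

lemma hermitian_zero_iff_left:
  assumes "hermitian h"
  shows "h x y = 0 \<longleftrightarrow> (\<forall>a\<in>K. qRe (h (x \<odot> a) y) = 0)"
proof -
  have "h x y = 0 \<longleftrightarrow> h y x = 0"
    using hermitian_cnj[OF assms, of x y] hermitian_cnj[OF assms, of y x] by (metis qcnj_simps(1))
  moreover have "qRe (h (x \<odot> a) y) = qRe (h y (x \<odot> a))" for a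
    using hermitian_cnj[OF assms, of "x \<odot> a" y] by simp
  ultimately show ?thesis using hermitian_zero_iff[OF assms, of y x] by simp
qed

lemma form_self: "form x x = of_real (x \<bullet> x)"
  by (subst hermitian_self[OF hermitian_form]) (simp add: Re_form)

lemma norm_rscale:
  assumes "a \<in> K"
  shows "norm (x \<odot> a) = qnorm a * norm x"
proof -
  have "form (x \<odot> a) (x \<odot> a) = qcnj a * form x x * a"
    using assms by (simp only: hermitianD(4,5)[OF hermitian_form] mult.assoc)
  also have "\<dots> = (x \<bullet> x) *\<^sub>R (qcnj a * a)" by (simp add: form_self of_real_mult_quat)
  finally have "(x \<odot> a) \<bullet> (x \<odot> a) = (x \<bullet> x) * qRe (qcnj a * a)"
    using Re_form[of "x \<odot> a" "x \<odot> a"] by simp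
  then have "(norm (x \<odot> a))\<^sup>2 = (qnorm a * norm x)\<^sup>2"
    by (simp add: qcnj_mult_self power2_norm_eq_inner power_mult_distrib mult.commute del: of_real_power)
  then show ?thesis by (simp add: power2_eq_iff_nonneg)
qed

lemma bounded_linear_rscale: "a \<in> K \<Longrightarrow> bounded_linear (\<lambda>x. x \<odot> a)"
  by (rule bounded_linear_intro[where K = "qnorm a"])
    (auto simp: rscale_add_left norm_rscale mult.commute)

lemma K_onbD:
  assumes "K_onb h f n E"
  shows "K_on h f n" "i < n \<Longrightarrow> f i \<in> E" "x \<in> E \<Longrightarrow> x = (\<Sum>i<n. f i \<odot> h (f i) x)"
    "i < n \<Longrightarrow> j < n \<Longrightarrow> h (f i) (f j) = (if i = j then 1 else 0)"
proof -
  show on: "K_on h f n" and "i < n \<Longrightarrow> f i \<in> E"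
    using assms unfolding K_onb_def by blast+
  show "x \<in> E \<Longrightarrow> x = (\<Sum>i<n. f i \<odot> h (f i) x)"
    using assms unfolding K_onb_def by (elim conjE) (erule (1) bspec)
  show "i < n \<Longrightarrow> j < n \<Longrightarrow> h (f i) (f j) = (if i = j then 1 else 0)"
    using on unfolding K_on_def by blast
qed

section \<open>Real frames from bases over the scalars\<close>

definition real_frame :: "quat set \<Rightarrow> (nat \<Rightarrow> 'h) \<Rightarrow> nat \<Rightarrow> 'h set" where
  "real_frame U f n = (\<lambda>(i, u). f i \<odot> u) ` ({..<n} \<times> U)"

lemma qnorm_zero [simp]: "qnorm 0 = 0"
  by simp

text \<open>For unit vectors of a \<open>K\<close>-orthonormal basis,
  \<open>qRe (h (f i \<odot> u) (f i \<odot> v))\<close> is the scalar product of \<open>u\<close>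
  and \<open>v\<close> in \<open>K\<close>, so every basis vector splits into \<open>dim K\<close>
  real ones. Injectivity is recorded because sums over the frame count each pair once.\<close>

lemma real_frame:
  assumes h: "hermitian h" and f: "K_onb h f n E" and E: "is_subspace E" and "K_real_basis U"
  shows "finite (real_frame U f n)" "real_frame U f n \<subseteq> E" "E \<subseteq> span (real_frame U f n)"
    "\<And>x y. x \<in> real_frame U f n \<Longrightarrow> y \<in> real_frame U f n \<Longrightarrow> qRe (h x y) = (if x = y then 1 else 0)"
    "inj_on (\<lambda>(i, u). f i \<odot> u) ({..<n} \<times> U)"
proof -
  note q = qRe_hermitian_basis[OF h, of f n]
  note on = K_onbD(1)[OF f] and fE = K_onbD(2)[OF f] and U = K_real_basisD[OF assms(4)]
  show "finite (real_frame U f n)" using U(1) by (simp add: real_frame_def)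
  show "real_frame U f n \<subseteq> E" using U(2) fE is_subspaceD(4)[OF E] by (auto simp: real_frame_def)
  show "E \<subseteq> span (real_frame U f n)" unfolding real_frame_def
    by (rule K_onb_span[OF f h assms(4)])
  have g: "qRe (h (f i \<odot> u) (f j \<odot> v)) = (if i = j \<and> u = v then 1 else 0)"
    if "i < n" "j < n" "u \<in> U" "v \<in> U" for i j u v
  proof -
    have "u \<in> K" "v \<in> K" using that U(4) by auto
    then have "qRe (h (f i \<odot> u) (f j \<odot> v)) = (if i = j then (if u = v then 1 else 0) else 0)"
      by (simp only: q[OF on that(1,2)] U(5)[OF that(3,4)])
    then show ?thesis by simp
  qed
  show inj: "inj_on (\<lambda>(i, u). f i \<odot> u) ({..<n} \<times> U)"
  proof (rule inj_onI)
    fix s t assume st: "s \<in> {..<n} \<times> U" "t \<in> {..<n} \<times> U"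
      "(\<lambda>(i, u). f i \<odot> u) s = (\<lambda>(i, u). f i \<odot> u) t"
    obtain i u j v where eq: "s = (i, u)" "t = (j, v)" by fastforce
    then have *: "i < n" "u \<in> U" "j < n" "v \<in> U" "f i \<odot> u = f j \<odot> v" using st by auto
    then have "qRe (h (f i \<odot> u) (f j \<odot> v)) = 1" using g[of i i u u] by simp
    then show "s = t" using g[of i j u v] * eq by (auto split: if_splits)
  qed
  fix x y assume "x \<in> real_frame U f n" "y \<in> real_frame U f n"
  then obtain i u j v where *: "x = f i \<odot> u" "y = f j \<odot> v" "i < n" "j < n" "u \<in> U" "v \<in> U"
    by (auto simp: real_frame_def)
  then have "x = y \<longleftrightarrow> i = j \<and> u = v" using inj by (auto simp: inj_on_def)
  then show "qRe (h x y) = (if x = y then 1 else 0)" using g[of i j u v] * by simp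
qed

lemma K_onb_K_span:
  assumes h: "hermitian h" and f: "K_on h f n"
  shows "K_onb h f n (K_span f n)"
  unfolding K_onb_def
proof (intro conjI allI impI ballI f)
  fix i assume i: "i < n"
  have "(\<Sum>j<n. f j \<odot> (if i = j then 1 else 0)) = (\<Sum>j<n. if i = j then f j else 0)"
    by (intro sum.cong) auto
  also have "\<dots> = f i" using i by simp
  finally show "f i \<in> K_span f n" using K_spanI[of n "\<lambda>j. if i = j then 1 else 0" f] by simp
next
  fix x assume "x \<in> K_span f n"
  then obtain c where c: "\<And>i. c i \<in> K" "x = (\<Sum>i<n. f i \<odot> c i)" by (metis K_spanE)
  have "h (f k) x = c k" if "k < n" for k
    unfolding c(2) using K_on_expand_component[OF h f that c(1)] .
  then show "x = (\<Sum>i<n. f i \<odot> h (f i) x)" using c(2) by simp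
qed

lemma K_onb_imp_K_span:
  assumes h: "hermitian h" and f: "K_onb h f n E" and E: "is_subspace E"
  shows "K_span f n = E"
proof (intro equalityI subsetI)
  fix x assume "x \<in> K_span f n"
  then obtain c where c: "\<And>i. c i \<in> K" "x = (\<Sum>i<n. f i \<odot> c i)" by (metis K_spanE)
  show "x \<in> E"
    unfolding c(2) by (intro is_subspaceD(7)[OF E] is_subspaceD(4)[OF E] K_onbD(2)[OF f] c(1)) simp
next
  fix x assume x: "x \<in> E"
  show "x \<in> K_span f n"
    by (subst K_onbD(3)[OF f x]) (intro K_spanI hermitianD(1)[OF h])
qed

lemma has_dimension_K_span:
  assumes h: "hermitian h" and f: "K_on h f n"
  shows "has_dimension (K_span f n) n"
  unfolding has_dimension_def
proof (intro exI[of _ f] bij_betw_imageI inj_onI)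
  fix c d assume cd: "c \<in> {..<n} \<rightarrow>\<^sub>E K" "d \<in> {..<n} \<rightarrow>\<^sub>E K" "(\<Sum>i<n. f i \<odot> c i) = (\<Sum>i<n. f i \<odot> d i)"
  show "c = d"
  proof (rule PiE_ext[OF cd(1,2)])
    fix k assume "k \<in> {..<n}"
    then have k: "k < n" by simp
    have "h (f k) (\<Sum>i<n. f i \<odot> c i) = c k" "h (f k) (\<Sum>i<n. f i \<odot> d i) = d k"
      by (rule K_on_expand_component[OF h f k]; use cd in auto)+
    then show "c k = d k" using cd(3) by simp
  qed
next
  show "(\<lambda>c. \<Sum>i<n. f i \<odot> c i) ` ({..<n} \<rightarrow>\<^sub>E K) = K_span f n"
  proof (intro equalityI subsetI)
    fix x assume "x \<in> (\<lambda>c. \<Sum>i<n. f i \<odot> c i) ` ({..<n} \<rightarrow>\<^sub>E K)"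
    then show "x \<in> K_span f n" by (auto intro!: K_spanI)
  next
    fix x assume "x \<in> K_span f n"
    then obtain c where c: "\<And>i. c i \<in> K" "x = (\<Sum>i<n. f i \<odot> c i)" by (metis K_spanE)
    then show "x \<in> (\<lambda>c. \<Sum>i<n. f i \<odot> c i) ` ({..<n} \<rightarrow>\<^sub>E K)"
      by (intro image_eqI[of _ _ "restrict c {..<n}"]) auto
  qed
qed

end

section \<open>The trace of \<open>A\<^sup>* A\<close> for off-diagonal \<open>A\<close>\<close>

lemma has_sum_finite_sum:
  assumes "\<And>i. i \<in> I \<Longrightarrow> (f i has_sum s i) S"
  shows "((\<lambda>x. \<Sum>i\<in>I. f i x) has_sum (\<Sum>i\<in>I. s i :: real)) S"
  using assms by (induction I rule: infinite_finite_induct) (auto intro: has_sum_add)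

text \<open>Split \<open>x\<close> into its part \<open>p\<close> in \<open>span M\<close> and the
  rest. \<open>A\<close> exchanges the two blocks, so the squared norms of the images add. By
  self-adjointness the image of the rest contributes the sum of the
  \<open>(x \<bullet> A u)\<^sup>2\<close>, and the image of \<open>p\<close> is a finite quadratic
  form in the coordinates \<open>x \<bullet> u\<close>. By Parseval each of the two sums to the same
  value, whence the factor 2.\<close>

lemma off_diagonal_has_sum:
  fixes A :: "'a::real_inner \<Rightarrow> 'a"
  assumes A: "linear A" and sa: "\<And>x y. A x \<bullet> y = x \<bullet> A y"
    and M: "onset M" "finite M"
    and d1: "\<And>x y. x \<in> span M \<Longrightarrow> y \<in> span M \<Longrightarrow> A x \<bullet> y = 0"
    and d2: "\<And>x. (\<And>y. y \<in> M \<Longrightarrow> y \<bullet> x = 0) \<Longrightarrow> A x \<in> span M"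
    and S: "orthonormal_basis S"
  shows "((\<lambda>e. (norm (A e))\<^sup>2) has_sum 2 * (\<Sum>u\<in>M. (norm (A u))\<^sup>2)) S"
proof -
  have norm: "(norm (A x))\<^sup>2 = (\<Sum>u\<in>M. (x \<bullet> A u)\<^sup>2) +
      (\<Sum>u\<in>M. \<Sum>v\<in>M. (A u \<bullet> A v) * ((x \<bullet> u) * (x \<bullet> v)))" for x
  proof -
    define p where "p = (\<Sum>u\<in>M. (u \<bullet> x) *\<^sub>R u)"
    have pM: "p \<in> span M" unfolding p_def by (intro span_sum span_scale span_base)
    have "y \<bullet> (x - p) = 0" if "y \<in> M" for y
      using onset_residual[OF M span_base[OF that], of x] by (simp add: p_def inner_commute)
    then have qM: "A (x - p) \<in> span M" by (rule d2)
    have split: "A x = A p + A (x - p)" using linear_add[OF A, of p "x - p"] by simp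
    have 1: "u \<bullet> A (x - p) = x \<bullet> A u" if "u \<in> M" for u
    proof -
      have "u \<bullet> A x = u \<bullet> A (x - p)"
        using d1[OF pM span_base[OF that]] by (simp add: split inner_add_right inner_commute)
      then show ?thesis using sa[of u x] by (simp add: inner_commute)
    qed
    have Ap: "A p = (\<Sum>u\<in>M. (u \<bullet> x) *\<^sub>R A u)"
      by (simp add: p_def linear_sum[OF A] linear_scale[OF A])
    have "(norm (A x))\<^sup>2 = (norm (A p))\<^sup>2 + (norm (A (x - p)))\<^sup>2"
      unfolding split using d1[OF pM qM] by (intro norm_add_Pythagorean) (simp add: orthogonal_def)
    also have "(norm (A (x - p)))\<^sup>2 = (\<Sum>u\<in>M. (x \<bullet> A u)\<^sup>2)"
      using onset_norm_sq[OF M qM] 1 by simp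
    also have "(norm (A p))\<^sup>2 = (\<Sum>u\<in>M. \<Sum>v\<in>M. (A u \<bullet> A v) * ((x \<bullet> u) * (x \<bullet> v)))"
      unfolding power2_norm_eq_inner Ap inner_sum_left inner_sum_right
      by (simp add: inner_commute mult_ac)
    finally show ?thesis by simp
  qed
  have "((\<lambda>e. (\<Sum>u\<in>M. (e \<bullet> A u)\<^sup>2) + (\<Sum>u\<in>M. \<Sum>v\<in>M. (A u \<bullet> A v) * ((e \<bullet> u) * (e \<bullet> v)))) has_sum
      (\<Sum>u\<in>M. (norm (A u))\<^sup>2) + (\<Sum>u\<in>M. \<Sum>v\<in>M. (A u \<bullet> A v) * (u \<bullet> v))) S"
    by (intro has_sum_add has_sum_finite_sum has_sum_cmult_right orthonormal_basis_norm_sq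
        orthonormal_basis_inner S)
  moreover have "(\<Sum>u\<in>M. \<Sum>v\<in>M. (A u \<bullet> A v) * (u \<bullet> v)) = (\<Sum>u\<in>M. (norm (A u))\<^sup>2)"
  proof (intro sum.cong refl)
    fix u assume u: "u \<in> M"
    have "(\<Sum>v\<in>M. (A u \<bullet> A v) * (u \<bullet> v)) = (\<Sum>v\<in>M. if u = v then (norm (A u))\<^sup>2 else 0)"
      using M u by (intro sum.cong) (auto simp: onset_def power2_norm_eq_inner)
    then show "(\<Sum>v\<in>M. (A u \<bullet> A v) * (u \<bullet> v)) = (norm (A u))\<^sup>2" using M u by simp
  qed
  ultimately show ?thesis by (simp add: norm[abs_def])
qed

lemma off_diagonal_op_trace:
  fixes A :: "'a::real_inner \<Rightarrow> 'a"
  assumes A: "linear A" and sa: "\<And>x y. A x \<bullet> y = x \<bullet> A y"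
    and M: "onset M" "finite M"
    and d1: "\<And>x y. x \<in> span M \<Longrightarrow> y \<in> span M \<Longrightarrow> A x \<bullet> y = 0"
    and d2: "\<And>x. (\<And>y. y \<in> M \<Longrightarrow> y \<bullet> x = 0) \<Longrightarrow> A x \<in> span M"
    and ex: "\<exists>S::'a set. orthonormal_basis S"
  shows "op_trace (adjoint A \<circ> A) = 2 * (\<Sum>u\<in>M. (norm (A u))\<^sup>2)"
proof -
  have "orthonormal_basis (SOME S::'a set. orthonormal_basis S)" using ex by (rule someI_ex)
  from infsumI[OF off_diagonal_has_sum[OF A sa M d1 d2 this]]
  have "(\<Sum>\<^sub>\<infinity>e\<in>(SOME S. orthonormal_basis S). (norm (A e))\<^sup>2) = 2 * (\<Sum>u\<in>M. (norm (A u))\<^sup>2)"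
    by blast
  moreover have "adjoint A = A" using sa by (intro adjoint_unique) auto
  moreover have "e \<bullet> A (A e) = (norm (A e))\<^sup>2" for e
    using sa[of e "A e"] by (simp add: power2_norm_eq_inner)
  ultimately show ?thesis by (simp add: op_trace_def)
qed

section \<open>The exponential of a bounded operator\<close>

text \<open>The library states this for the class \<open>banach\<close>, to which the sort used here does not belong.\<close>

lemma summable_norm_cancel_complete:
  fixes f :: "nat \<Rightarrow> 'a::{real_normed_vector,complete_space}"
  assumes "summable (\<lambda>n. norm (f n))"
  shows "summable f"
proof -
  have "Cauchy (\<lambda>n. \<Sum>i<n. f i)"
  proof (rule CauchyI')
    fix e :: real assume "e > 0"
    then obtain N where N: "\<And>m n. m \<ge> N \<Longrightarrow> norm (\<Sum>i=m..<n. norm (f i)) < e"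
      using assms[unfolded summable_Cauchy] by blast
    have "dist (\<Sum>i<m. f i) (\<Sum>i<n. f i) < e" if "m \<ge> N" "n > m" for m n
    proof -
      have "(\<Sum>i<n. f i) - (\<Sum>i<m. f i) = (\<Sum>i=m..<n. f i)"
        using sum_diff_nat_ivl[of 0 m n f] that by (simp add: atLeast0LessThan)
      then have "dist (\<Sum>i<m. f i) (\<Sum>i<n. f i) = norm (\<Sum>i=m..<n. f i)"
        unfolding dist_norm by (metis norm_minus_commute)
      also have "\<dots> \<le> (\<Sum>i=m..<n. norm (f i))" by (rule norm_sum)
      also have "\<dots> \<le> norm (\<Sum>i=m..<n. norm (f i))" by simp
      finally show ?thesis using N[OF that(1), of n] by linarith
    qed
    then show "\<exists>M. \<forall>m\<ge>M. \<forall>n>m. dist (\<Sum>i<m. f i) (\<Sum>i<n. f i) < e" by blast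
  qed
  then show ?thesis unfolding summable_iff_convergent by (rule Cauchy_convergent)
qed

abbreviation exp_op :: "('a::real_normed_vector \<Rightarrow> 'a) \<Rightarrow> real \<Rightarrow> 'a \<Rightarrow> 'a" where
  "exp_op A s \<equiv> op_exp (\<lambda>x. s *\<^sub>R A x)"

text \<open>The remainder is a polynomial in \<open>s\<close> and \<open>h\<close> with nonnegative
  coefficients, so absolute values may be moved onto the variables. This reduces remainder estimates
  for operator exponentials to the scalar exponential.\<close>

lemma power_remainder_bound:
  fixes s h :: real
  shows "\<bar>(s + h) ^ n - s ^ n - real n * h * s ^ (n - 1)\<bar>
    \<le> (\<bar>s\<bar> + \<bar>h\<bar>) ^ n - \<bar>s\<bar> ^ n - real n * \<bar>h\<bar> * \<bar>s\<bar> ^ (n - 1)"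
proof (induction n)
  case (Suc n)
  define D where "D s h = (s + h) ^ n - s ^ n - real n * h * s ^ (n - 1)" for s h :: real
  have step: "(s + h) ^ Suc n - s ^ Suc n - real (Suc n) * h * s ^ (Suc n - 1)
      = (s + h) * D s h + real n * h\<^sup>2 * s ^ (n - 1)" for s h :: real
    by (cases n) (simp_all add: D_def algebra_simps power2_eq_square)
  have IH: "\<bar>D s h\<bar> \<le> D \<bar>s\<bar> \<bar>h\<bar>" using Suc.IH by (simp add: D_def)
  have "\<bar>(s + h) * D s h + real n * h\<^sup>2 * s ^ (n - 1)\<bar>
      \<le> \<bar>s + h\<bar> * \<bar>D s h\<bar> + real n * \<bar>h\<bar>\<^sup>2 * \<bar>s\<bar> ^ (n - 1)"
    by (rule order_trans[OF abs_triangle_ineq]) (simp add: abs_mult power_abs)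
  also have "\<dots> \<le> (\<bar>s\<bar> + \<bar>h\<bar>) * D \<bar>s\<bar> \<bar>h\<bar> + real n * \<bar>h\<bar>\<^sup>2 * \<bar>s\<bar> ^ (n - 1)"
    using IH by (intro add_right_mono mult_mono) auto
  finally show ?case by (simp only: step)
qed simp

lemma norm_funpow_le:
  fixes A :: "'a::real_normed_vector \<Rightarrow> 'a"
  assumes k: "\<And>x. norm (A x) \<le> norm x * k" "0 \<le> k"
  shows "norm ((A ^^ n) x) \<le> k ^ n * norm x"
proof (induction n)
  case (Suc n)
  have "norm ((A ^^ Suc n) x) \<le> norm ((A ^^ n) x) * k" using k by simp
  also have "\<dots> \<le> (k ^ n * norm x) * k" using Suc k by (intro mult_right_mono) auto
  finally show ?case by (simp add: mult_ac)
qed simp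

lemma fact_Suc_cancel: "real (Suc n) * c / fact (Suc n) = c / fact n"
  by (simp del: of_nat_Suc)

lemma op_exp_scaleR_sums:
  fixes A :: "'a::{real_normed_vector,complete_space} \<Rightarrow> 'a"
  assumes "bounded_linear A"
  shows "(\<lambda>n. (s ^ n / fact n) *\<^sub>R (A ^^ n) x) sums exp_op A s x"
proof -
  interpret A: bounded_linear A by fact
  obtain k where k: "\<And>x. norm (A x) \<le> norm x * k" "0 \<le> k" using A.nonneg_bounded by blast
  note bd = norm_funpow_le[where A = A, OF k]
  have eq: "((\<lambda>x. s *\<^sub>R A x) ^^ n) x = s ^ n *\<^sub>R (A ^^ n) x" for n
    by (induction n) (simp_all add: A.scaleR mult_ac)
  have "summable (\<lambda>n. (\<bar>s\<bar> * k) ^ n /\<^sub>R fact n * norm x)"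
    by (intro summable_mult2 summable_exp_generic)
  then have "summable (\<lambda>n. norm ((s ^ n / fact n) *\<^sub>R (A ^^ n) x))"
  proof (rule summable_comparison_test'[where N = 0])
    fix n :: nat
    have "norm ((s ^ n / fact n) *\<^sub>R (A ^^ n) x) = \<bar>s\<bar> ^ n / fact n * norm ((A ^^ n) x)"
      by (simp add: power_abs)
    also have "\<dots> \<le> \<bar>s\<bar> ^ n / fact n * (k ^ n * norm x)"
      by (intro mult_left_mono bd) auto
    finally show "norm (norm ((s ^ n / fact n) *\<^sub>R (A ^^ n) x)) \<le> (\<bar>s\<bar> * k) ^ n /\<^sub>R fact n * norm x"
      by (simp add: power_mult_distrib divide_inverse mult_ac)
  qed
  then have "summable (\<lambda>n. (s ^ n / fact n) *\<^sub>R (A ^^ n) x)" by (rule summable_norm_cancel_complete)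
  then have "(\<lambda>n. (s ^ n / fact n) *\<^sub>R (A ^^ n) x) sums (\<Sum>n. (s ^ n / fact n) *\<^sub>R (A ^^ n) x)"
    by (rule summable_sums)
  then show ?thesis by (simp add: op_exp_def eq divide_inverse mult_ac)
qed

text \<open>Termwise comparison with the scalar series at
  \<open>k * (\<bar>s\<bar> + \<bar>h\<bar>)\<close>. Since \<open>x\<close> enters the bound only
  through \<open>norm x\<close>, it also controls the remainder in operator norm.\<close>

lemma op_exp_remainder:
  fixes A :: "'a::{real_normed_vector,complete_space} \<Rightarrow> 'a"
  assumes A: "bounded_linear A" and k: "\<And>x. norm (A x) \<le> norm x * k" "0 \<le> k"
  shows "norm (exp_op A (s + h) x - exp_op A s x
      - h *\<^sub>R A (exp_op A s x))
    \<le> (exp (k * (\<bar>s\<bar> + \<bar>h\<bar>)) - exp (k * \<bar>s\<bar>) - k * \<bar>h\<bar> * exp (k * \<bar>s\<bar>)) * norm x"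
    (is "norm ?L \<le> ?R")
proof -
  interpret A: bounded_linear A by fact
  note bd = norm_funpow_le[where A = A, OF k]
  have "(\<lambda>n. h *\<^sub>R A ((s ^ n / fact n) *\<^sub>R (A ^^ n) x)) sums (h *\<^sub>R A (exp_op A s x))"
    by (intro sums_scaleR_right A.sums op_exp_scaleR_sums A)
  moreover have "h *\<^sub>R A ((s ^ n / fact n) *\<^sub>R (A ^^ n) x)
      = (real (Suc n) * h * s ^ (Suc n - 1) / fact (Suc n)) *\<^sub>R (A ^^ Suc n) x" for n
    by (simp only: mult.assoc fact_Suc_cancel A.scaleR) simp
  ultimately have "(\<lambda>n. (real (Suc n) * h * s ^ (Suc n - 1) / fact (Suc n)) *\<^sub>R (A ^^ Suc n) x) sums
      (h *\<^sub>R A (exp_op A s x))" by simp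
  \<comment> \<open>The shift aligns the powers of \<open>A\<close> with those of the other two
    series. The new term at index 0 vanishes by its factor \<open>real n\<close>, whatever the
    truncated exponent \<open>n - 1\<close> is.\<close>
  from sums_Suc[OF this]
  have s3: "(\<lambda>n. (real n * h * s ^ (n - 1) / fact n) *\<^sub>R (A ^^ n) x) sums
      (h *\<^sub>R A (exp_op A s x))" by simp
  have sL: "(\<lambda>n. (((s + h) ^ n - s ^ n - real n * h * s ^ (n - 1)) / fact n) *\<^sub>R (A ^^ n) x) sums ?L"
    using sums_diff[OF sums_diff[OF op_exp_scaleR_sums[OF A] op_exp_scaleR_sums[OF A]] s3]
    by (simp add: scaleR_diff_left diff_divide_distrib)
  have e: "(\<lambda>n. (k * r) ^ n / fact n) sums exp (k * r)" for r :: real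
    using exp_converges[of "k * r"] by (simp add: divide_inverse mult_ac)
  have "(\<lambda>n. (k * \<bar>h\<bar>) * ((k * \<bar>s\<bar>) ^ n / fact n)) sums ((k * \<bar>h\<bar>) * exp (k * \<bar>s\<bar>))"
    by (intro sums_mult e)
  moreover have "(k * \<bar>h\<bar>) * ((k * \<bar>s\<bar>) ^ n / fact n) =
      k ^ Suc n * (real (Suc n) * \<bar>h\<bar> * \<bar>s\<bar> ^ (Suc n - 1)) / fact (Suc n)" for n
    by (simp only: mult.assoc mult.left_commute[of "k ^ Suc n"] fact_Suc_cancel)
      (simp add: power_mult_distrib)
  ultimately have "(\<lambda>n. k ^ Suc n * (real (Suc n) * \<bar>h\<bar> * \<bar>s\<bar> ^ (Suc n - 1)) / fact (Suc n)) sums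
      ((k * \<bar>h\<bar>) * exp (k * \<bar>s\<bar>))" by (simp only:)
  from sums_Suc[OF this]
  have t3: "(\<lambda>n. k ^ n * (real n * \<bar>h\<bar> * \<bar>s\<bar> ^ (n - 1)) / fact n) sums ((k * \<bar>h\<bar>) * exp (k * \<bar>s\<bar>))"
    by simp
  have "(\<lambda>n. ((k * (\<bar>s\<bar> + \<bar>h\<bar>)) ^ n / fact n - (k * \<bar>s\<bar>) ^ n / fact n -
      k ^ n * (real n * \<bar>h\<bar> * \<bar>s\<bar> ^ (n - 1)) / fact n) * norm x) sums ?R"
    by (intro sums_mult2 sums_diff e t3)
  then have sR: "(\<lambda>n. ((\<bar>s\<bar> + \<bar>h\<bar>) ^ n - \<bar>s\<bar> ^ n - real n * \<bar>h\<bar> * \<bar>s\<bar> ^ (n - 1)) / fact n * (k ^ n * norm x))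
      sums ?R"
  proof (rule back_subst[where P = "\<lambda>f. f sums ?R"], intro ext)
    fix n
    have *: "(K * P / F - K * S / F - K * T / F) * N = (P - S - T) / F * (K * N)" for K P S T F N :: real
      by (simp add: algebra_simps diff_divide_distrib add_divide_distrib)
    show "((k * (\<bar>s\<bar> + \<bar>h\<bar>)) ^ n / fact n - (k * \<bar>s\<bar>) ^ n / fact n -
      k ^ n * (real n * \<bar>h\<bar> * \<bar>s\<bar> ^ (n - 1)) / fact n) * norm x =
      ((\<bar>s\<bar> + \<bar>h\<bar>) ^ n - \<bar>s\<bar> ^ n - real n * \<bar>h\<bar> * \<bar>s\<bar> ^ (n - 1)) / fact n * (k ^ n * norm x)"
      unfolding power_mult_distrib by (rule *)
  qed
  have "norm ((((s + h) ^ n - s ^ n - real n * h * s ^ (n - 1)) / fact n) *\<^sub>R (A ^^ n) x)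
      \<le> ((\<bar>s\<bar> + \<bar>h\<bar>) ^ n - \<bar>s\<bar> ^ n - real n * \<bar>h\<bar> * \<bar>s\<bar> ^ (n - 1)) / fact n * (k ^ n * norm x)" for n
  proof -
    have "norm ((((s + h) ^ n - s ^ n - real n * h * s ^ (n - 1)) / fact n) *\<^sub>R (A ^^ n) x)
        = \<bar>(s + h) ^ n - s ^ n - real n * h * s ^ (n - 1)\<bar> / fact n * norm ((A ^^ n) x)"
      by simp
    also have "\<dots> \<le> ((\<bar>s\<bar> + \<bar>h\<bar>) ^ n - \<bar>s\<bar> ^ n - real n * \<bar>h\<bar> * \<bar>s\<bar> ^ (n - 1)) / fact n * (k ^ n * norm x)"
      by (intro mult_mono bd divide_right_mono divide_nonneg_nonneg power_remainder_bound
          order_trans[OF abs_ge_zero power_remainder_bound]) auto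
    finally show ?thesis .
  qed
  then have "norm (\<Sum>n<m. (((s + h) ^ n - s ^ n - real n * h * s ^ (n - 1)) / fact n) *\<^sub>R (A ^^ n) x)
      \<le> (\<Sum>n<m. ((\<bar>s\<bar> + \<bar>h\<bar>) ^ n - \<bar>s\<bar> ^ n - real n * \<bar>h\<bar> * \<bar>s\<bar> ^ (n - 1)) / fact n * (k ^ n * norm x))" for m
    by (intro sum_norm_le) auto
  then show ?thesis
    using tendsto_norm[OF sL[unfolded sums_def]] sR[unfolded sums_def]
    by (intro LIMSEQ_le[of _ "norm ?L" _ ?R]) auto
qed

lemma exp_remainder_tendsto:
  fixes k S :: real
  shows "((\<lambda>h. (exp (k * (S + \<bar>h\<bar>)) - exp (k * S) - k * \<bar>h\<bar> * exp (k * S)) / \<bar>h\<bar>) \<longlongrightarrow> 0) (at 0)"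
proof -
  have "((\<lambda>t. exp (k * (S + t))) has_real_derivative k * exp (k * S)) (at 0)"
    by (auto intro!: derivative_eq_intros)
  then have "((\<lambda>t. (exp (k * (S + t)) - exp (k * S)) / t) \<longlongrightarrow> k * exp (k * S)) (at 0)"
    by (simp add: DERIV_def)
  then have "((\<lambda>t. (exp (k * (S + t)) - exp (k * S)) / t - k * exp (k * S)) \<longlongrightarrow> 0) (at 0)"
    by (simp add: LIM_zero_iff)
  moreover have "filterlim (\<lambda>h::real. \<bar>h\<bar>) (at 0) (at 0)"
    by (auto simp: filterlim_at eventually_at_filter intro!: tendsto_eq_intros)
  ultimately have "((\<lambda>h. (exp (k * (S + \<bar>h\<bar>)) - exp (k * S)) / \<bar>h\<bar> - k * exp (k * S)) \<longlongrightarrow> 0) (at 0)"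
    by (rule filterlim_compose)
  then show ?thesis
    by (rule Lim_transform_eventually) (auto simp: eventually_at_filter field_simps)
qed

lemma has_vector_derivative_op_exp:
  fixes A :: "'a::{real_normed_vector,complete_space} \<Rightarrow> 'a"
  assumes A: "bounded_linear A"
  shows "((\<lambda>s. exp_op A s x) has_vector_derivative A (exp_op A s x)) (at s)"
proof -
  interpret A: bounded_linear A by fact
  obtain k where k: "\<And>x. norm (A x) \<le> norm x * k" "0 \<le> k" using A.nonneg_bounded by blast
  let ?r = "\<lambda>h. exp (k * (\<bar>s\<bar> + \<bar>h\<bar>)) - exp (k * \<bar>s\<bar>) - k * \<bar>h\<bar> * exp (k * \<bar>s\<bar>)"
  have lim: "((\<lambda>h. ?r h / \<bar>h\<bar> * norm x) \<longlongrightarrow> 0) (at 0)"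
    by (intro tendsto_mult_left_zero exp_remainder_tendsto)
  have bd: "norm ((exp_op A (s + h) x - exp_op A s x
      - h *\<^sub>R A (exp_op A s x)) /\<^sub>R norm h) \<le> ?r h / \<bar>h\<bar> * norm x" for h
    using divide_right_mono[OF op_exp_remainder[OF A k, of s h x], of "\<bar>h\<bar>"]
    by (simp add: divide_inverse mult_ac)
  have "((\<lambda>h. (exp_op A (s + h) x - exp_op A s x
      - h *\<^sub>R A (exp_op A s x)) /\<^sub>R norm h) \<longlongrightarrow> 0) (at 0)"
    by (rule Lim_null_comparison[OF always_eventually[OF allI[OF bd]] lim])
  from tendsto_norm_zero[OF this] show ?thesis
    by (simp add: mult.commute has_vector_derivative_def has_derivative_at divide_inverse bounded_linear_scaleR_left)
qed

lemma op_exp_zero: "exp_op A 0 x = x"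
proof -
  have z: "((\<lambda>x. 0 *\<^sub>R A x) ^^ n) x = (if n = 0 then x else 0)" for n
    by (cases n) auto
  show ?thesis unfolding op_exp_def z by (subst suminf_finite[of "{0}"]) auto
qed

lemma bounded_linear_op_exp:
  fixes A :: "'a::{real_normed_vector,complete_space} \<Rightarrow> 'a"
  assumes A: "bounded_linear A"
  shows "bounded_linear (exp_op A s)"
proof -
  interpret A: bounded_linear A by fact
  obtain k where k: "\<And>x. norm (A x) \<le> norm x * k" "0 \<le> k" using A.nonneg_bounded by blast
  note S = op_exp_scaleR_sums[OF A]
  have lin: "linear (A ^^ n)" for n
    by (induction n) (auto simp: linear_iff A.add A.scaleR)
  have bd: "norm (exp_op A s x) \<le> norm x * (1 + k * \<bar>s\<bar> + (exp (k * \<bar>s\<bar>) - 1 - k * \<bar>s\<bar>))" for x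
  proof -
    have "norm (exp_op A s x - x - s *\<^sub>R A x) \<le> (exp (k * \<bar>s\<bar>) - 1 - k * \<bar>s\<bar>) * norm x"
      using op_exp_remainder[OF A k, of 0 s x] by (simp only: op_exp_zero) simp
    moreover have "norm (s *\<^sub>R A x) \<le> \<bar>s\<bar> * (norm x * k)" using k by (simp add: mult_left_mono)
    moreover have "norm (exp_op A s x) \<le>
        norm (exp_op A s x - x - s *\<^sub>R A x) + norm x + norm (s *\<^sub>R A x)"
      using norm_triangle_ineq[of "exp_op A s x - x - s *\<^sub>R A x + x" "s *\<^sub>R A x"]
        norm_triangle_ineq[of "exp_op A s x - x - s *\<^sub>R A x" x] by simp
    ultimately show ?thesis by (simp add: algebra_simps)
  qed
  show ?thesis
  proof (rule bounded_linear_intro[OF _ _ bd])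
    show "exp_op A s (x + y) = exp_op A s x + exp_op A s y" for x y
      by (rule sums_unique2[OF S]) (use sums_add[OF S S] in \<open>simp add: linear_add[OF lin] scaleR_add_right\<close>)
    show "exp_op A s (r *\<^sub>R x) = r *\<^sub>R exp_op A s x" for r x
      by (rule sums_unique2[OF S])
        (use sums_scaleR_right[OF S, of r] in \<open>simp add: linear_scale[OF lin] mult_ac\<close>)
  qed
qed

text \<open>\<open>c = 1\<close> serves for scalar multiplications, which commute with
  \<open>A\<close>; \<open>c = - 1\<close> serves for \<open>\<Phi>\<close>, which turns the
  exponential at \<open>s\<close> into the one at \<open>- s\<close>.\<close>

lemma op_exp_intertwine:
  fixes A :: "'a::{real_normed_vector,complete_space} \<Rightarrow> 'a"
  assumes A: "bounded_linear A" and T: "bounded_linear T" and TA: "\<And>x. T (A x) = c *\<^sub>R A (T x)"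
  shows "T (exp_op A s x) = exp_op A (c * s) (T x)"
proof -
  interpret A: bounded_linear A by fact
  interpret T: bounded_linear T by fact
  have "T ((A ^^ n) x) = c ^ n *\<^sub>R (A ^^ n) (T x)" for n
    by (induction n) (simp_all add: TA A.scaleR mult_ac)
  then show ?thesis
    using T.sums[OF op_exp_scaleR_sums[OF A, of s x]]
    by (intro sums_unique2[OF _ op_exp_scaleR_sums[OF A]]) (simp add: T.scaleR power_mult_distrib mult_ac)
qed

lemma op_exp_self_adjoint:
  fixes A :: "'a::{real_inner,complete_space} \<Rightarrow> 'a"
  assumes A: "bounded_linear A" and sa: "\<And>x y. A x \<bullet> y = x \<bullet> A y"
  shows "exp_op A s x \<bullet> y = x \<bullet> exp_op A s y"
proof -
  have "(A ^^ n) x \<bullet> y = x \<bullet> (A ^^ n) y" for n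
    by (induction n arbitrary: x y) (simp_all add: sa funpow_swap1)
  then show ?thesis
    using bounded_linear.sums[OF bounded_linear_inner_left op_exp_scaleR_sums[OF A, of s x], of y]
      bounded_linear.sums[OF bounded_linear_inner_right op_exp_scaleR_sums[OF A, of s y], of x]
    by (intro sums_unique2) (simp_all add: o_def)
qed

text \<open>Differentiating avoids multiplying two series: for self-adjoint \<open>A\<close> the
  pairing of the exponential at \<open>s\<close> of \<open>z\<close> with the exponential at
  \<open>- s\<close> of \<open>x\<close> has derivative zero, so it keeps its value at
  \<open>s = 0\<close>.\<close>

lemma op_exp_inverse:
  fixes A :: "'a::{real_inner,complete_space} \<Rightarrow> 'a"
  assumes A: "bounded_linear A" and sa: "\<And>x y. A x \<bullet> y = x \<bullet> A y"
  shows "exp_op A s (exp_op A (- s) x) = x"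
proof -
  let ?e = "\<lambda>s. exp_op A s"
  have "z \<bullet> ?e s (?e (- s) x) = z \<bullet> x" for z
  proof -
    have d: "((\<lambda>s. ?e s z \<bullet> ?e (- s) x) has_vector_derivative 0) (at s)" for s
    proof -
      have "((\<lambda>s. ?e (- s) x) has_vector_derivative (- 1) *\<^sub>R A (?e (- s) x)) (at s)"
        using vector_diff_chain_at[of uminus "- 1" s "\<lambda>s. ?e s x" "A (?e (- s) x)"]
          has_vector_derivative_op_exp[OF A, of x "- s"]
        by (auto simp: o_def has_vector_derivative_minus)
      then have "((\<lambda>s. ?e s z \<bullet> ?e (- s) x) has_vector_derivative
          ?e s z \<bullet> ((- 1) *\<^sub>R A (?e (- s) x)) + A (?e s z) \<bullet> ?e (- s) x) (at s)"
        by (intro bounded_bilinear.has_vector_derivative[OF bounded_bilinear_inner]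
            has_vector_derivative_op_exp[OF A])
      then show ?thesis by (simp add: sa)
    qed
    have "?e s z \<bullet> ?e (- s) x = ?e 0 z \<bullet> ?e (- 0) x"
      using d by (intro DERIV_isconst_all) (simp only: has_real_derivative_iff_has_vector_derivative simp_thms)
    also have "\<dots> = z \<bullet> x" by (simp only: op_exp_zero minus_zero)
    finally show ?thesis using op_exp_self_adjoint[OF A sa, of s z "?e (- s) x"] by simp
  qed
  then have "(?e s (?e (- s) x) - x) \<bullet> (?e s (?e (- s) x) - x) = 0"
    by (simp only: inner_diff_right)
  then show ?thesis by simp
qed

section \<open>The group action\<close>

context hyperbolic_grassmannian
begin

section \<open>The involution \<open>\<Phi>\<close> and its eigenspaces\<close>

lemma E0_real_basis:
  obtains M where "onset M" "finite M" "span M = E0"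
proof -
  obtain e where e: "K_onb form e p E0"
  proof (rule Gram_Schmidt_K[OF hermitian_form _ E0_subspace E0_dimension])
    show "qRe (form x x) > 0" if "x \<noteq> 0" for x using that by (simp add: Re_form)
  qed
  obtain U where U: "K_real_basis U" by (rule K_real_basis_exists)
  note M = real_frame[OF hermitian_form e E0_subspace U]
  show thesis
  proof (rule that)
    show "onset (real_frame U e p)" using M(4) by (simp add: onset_def Re_form)
    show "span (real_frame U e p) = E0"
      using M(2,3) span_minimal[OF M(2) subspace_is_subspace[OF E0_subspace]] by blast
  qed (rule M(1))
qed

lemma orth_iff_real:
  assumes "is_subspace E"
  shows "y \<in> orth E \<longleftrightarrow> (\<forall>x\<in>E. x \<bullet> y = 0)"
proof
  assume "\<forall>x\<in>E. x \<bullet> y = 0"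
  then show "y \<in> orth E"
    using is_subspaceD(4)[OF assms]
    by (auto simp: orth_def hermitian_zero_iff_left[OF hermitian_form] Re_form)
qed (auto simp: orth_def simp flip: Re_form)

lemma E0_decomposition:
  obtains u v where "x = u + v" "u \<in> E0" "v \<in> orth E0"
proof -
  obtain M where M: "onset M" "finite M" "span M = E0" by (rule E0_real_basis)
  let ?p = "\<Sum>u\<in>M. (u \<bullet> x) *\<^sub>R u"
  have "?p \<in> span M" by (intro span_sum span_scale span_base)
  moreover have "x - ?p \<in> orth E0"
    unfolding orth_iff_real[OF E0_subspace] using onset_residual[OF M(1,2), of _ x] M(3)
    by (simp add: inner_commute)
  ultimately show thesis using that[of ?p "x - ?p"] M(3) by simp
qed

lemma orth_E0_subspace: "is_subspace (orth E0)"
  by (auto simp: is_subspace_def orth_def hermitianD[OF hermitian_form])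

lemma E0_Int_orth: "x \<in> E0 \<Longrightarrow> x \<in> orth E0 \<Longrightarrow> x = 0"
  by (auto simp: orth_iff_real[OF E0_subspace])

lemma \<Phi>_eq:
  assumes "u \<in> E0" "v \<in> orth E0"
  shows "\<Phi> (u + v) = u - v"
  unfolding \<Phi>_def
proof (rule the_equality)
  show "\<exists>u'\<in>E0. \<exists>v'\<in>orth E0. u + v = u' + v' \<and> u - v = u' - v'" using assms by blast
  fix z assume "\<exists>u'\<in>E0. \<exists>v'\<in>orth E0. u + v = u' + v' \<and> z = u' - v'"
  then obtain u' v' where *: "u' \<in> E0" "v' \<in> orth E0" "u + v = u' + v'" "z = u' - v'" by blast
  then have "u - u' = v' - v" by (simp add: algebra_simps)
  moreover have "u - u' \<in> E0" "v' - v \<in> orth E0"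
    using * assms is_subspaceD(3)[OF E0_subspace] is_subspaceD(3)[OF orth_E0_subspace] by auto
  ultimately have "u - u' = 0" "v' - v = 0" using E0_Int_orth by force+
  then show "z = u - v" using * by simp
qed

lemma \<Phi>_add: "\<Phi> (x + y) = \<Phi> x + \<Phi> y"
proof -
  obtain u v where x: "x = u + v" "u \<in> E0" "v \<in> orth E0" by (rule E0_decomposition)
  obtain u' v' where y: "y = u' + v'" "u' \<in> E0" "v' \<in> orth E0" by (rule E0_decomposition)
  have "\<Phi> ((u + u') + (v + v')) = (u + u') - (v + v')"
    using x y is_subspaceD(2)[OF E0_subspace] is_subspaceD(2)[OF orth_E0_subspace] by (intro \<Phi>_eq) auto
  then show ?thesis using x y by (simp add: \<Phi>_eq algebra_simps)
qed

lemma \<Phi>_rscale: "a \<in> K \<Longrightarrow> \<Phi> (x \<odot> a) = \<Phi> x \<odot> a"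
proof -
  assume a: "a \<in> K"
  obtain u v where x: "x = u + v" "u \<in> E0" "v \<in> orth E0" by (rule E0_decomposition)
  have "\<Phi> (u \<odot> a + v \<odot> a) = u \<odot> a - v \<odot> a"
    using x a is_subspaceD(4)[OF E0_subspace] is_subspaceD(4)[OF orth_E0_subspace] by (intro \<Phi>_eq) auto
  then show ?thesis using x a rscale_add_left[OF a, of u "- v"] by (simp add: \<Phi>_eq rscale_add_left)
qed

lemma \<Phi>_scaleR: "\<Phi> (r *\<^sub>R x) = r *\<^sub>R \<Phi> x"
  using \<Phi>_rscale[of "of_real r" x] by simp

lemma \<Phi>_\<Phi> [simp]: "\<Phi> (\<Phi> x) = x"
proof -
  obtain u v where x: "x = u + v" "u \<in> E0" "v \<in> orth E0" by (rule E0_decomposition)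
  have "\<Phi> (u + - v) = u - - v" using x is_subspaceD(6)[OF orth_E0_subspace] by (intro \<Phi>_eq) auto
  then show ?thesis using x by (simp add: \<Phi>_eq)
qed

lemma \<Phi>_form: "form (\<Phi> x) y = form x (\<Phi> y)"
proof -
  obtain u v where x: "x = u + v" "u \<in> E0" "v \<in> orth E0" by (rule E0_decomposition)
  obtain u' v' where y: "y = u' + v'" "u' \<in> E0" "v' \<in> orth E0" by (rule E0_decomposition)
  have "form u v' = 0" "form u' v = 0" using x y by (auto simp: orth_def)
  moreover have "form v u' = 0" using calculation(2) hermitian_cnj[OF hermitian_form, of v u'] by simp
  ultimately show ?thesis using x y by (simp add: \<Phi>_eq hermitianD[OF hermitian_form])
qed

lemma \<Phi>_inner: "\<Phi> x \<bullet> y = x \<bullet> \<Phi> y"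
  using \<Phi>_form[of x y] by (simp flip: Re_form)

lemma norm_\<Phi>: "norm (\<Phi> x) = norm x"
  by (simp add: norm_eq_sqrt_inner \<Phi>_inner)

lemma bounded_linear_\<Phi>: "bounded_linear \<Phi>"
  by (rule bounded_linear_intro[where K = 1]) (auto simp: \<Phi>_add \<Phi>_scaleR norm_\<Phi>)

lemma \<Phi>_fixed_iff: "\<Phi> x = x \<longleftrightarrow> x \<in> E0"
proof
  assume *: "\<Phi> x = x"
  obtain u v where x: "x = u + v" "u \<in> E0" "v \<in> orth E0" by (rule E0_decomposition)
  with * have "u - v = u + v" by (simp add: \<Phi>_eq)
  then have "2 *\<^sub>R v = 0" by (simp add: scaleR_2 algebra_simps)
  then show "x \<in> E0" using x by simp
next
  assume "x \<in> E0"
  then show "\<Phi> x = x" using \<Phi>_eq[of x 0] is_subspaceD(1)[OF orth_E0_subspace] by simp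
qed

lemma \<Phi>_neg_iff: "\<Phi> x = - x \<longleftrightarrow> x \<in> orth E0"
proof
  assume *: "\<Phi> x = - x"
  obtain u v where x: "x = u + v" "u \<in> E0" "v \<in> orth E0" by (rule E0_decomposition)
  with * have "u - v = - (u + v)" by (simp add: \<Phi>_eq)
  then have "2 *\<^sub>R u = 0" by (simp add: scaleR_2 algebra_simps eq_neg_iff_add_eq_0)
  then show "x \<in> orth E0" using x by simp
next
  assume "x \<in> orth E0"
  then show "\<Phi> x = - x" using \<Phi>_eq[of 0 x] is_subspaceD(1)[OF E0_subspace] by simp
qed

text \<open>The orthogonal projection onto \<open>E0\<close>, written through the reflection
  \<open>\<Phi>\<close> so that commutation with \<open>\<Phi>\<close> can be exploited
  later.\<close>

definition p0 :: "'h \<Rightarrow> 'h" where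
  "p0 x = (1/2) *\<^sub>R (x + \<Phi> x)"

lemma p0_in: "p0 x \<in> E0"
  unfolding \<Phi>_fixed_iff[symmetric] by (simp add: p0_def \<Phi>_scaleR \<Phi>_add add.commute)

lemma bounded_linear_p0: "bounded_linear p0"
  unfolding p0_def[abs_def]
  by (intro bounded_linear_intros bounded_linear_compose[OF bounded_linear_scaleR_right] bounded_linear_\<Phi>)

lemma \<Phi>_diff: "\<Phi> (x - y) = \<Phi> x - \<Phi> y"
  and \<Phi>_minus: "\<Phi> (- x) = - \<Phi> x" and \<Phi>_zero: "\<Phi> 0 = 0"
  using bounded_linear_\<Phi> by (auto simp: bounded_linear.linear linear_diff linear_neg linear_0)

section \<open>The real part of \<open>B\<close>\<close>

definition b :: "'h \<Rightarrow> 'h \<Rightarrow> real" where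
  "b x y = x \<bullet> \<Phi> y"

lemma qRe_B: "qRe (B x y) = b x y"
  by (simp add: B_def b_def Re_form)

lemma b_commute: "b x y = b y x"
  by (metis \<Phi>_inner b_def inner_commute)

lemma b_simps:
  "b (x + y) z = b x z + b y z" "b x (y + z) = b x y + b x z"
  "b (x - y) z = b x z - b y z" "b x (y - z) = b x y - b x z"
  "b (r *\<^sub>R x) y = r * b x y" "b x (r *\<^sub>R y) = r * b x y"
  "b (- x) y = - b x y" "b x (- y) = - b x y" "b 0 y = 0" "b x 0 = 0"
  by (simp_all add: b_def inner_simps \<Phi>_add \<Phi>_diff \<Phi>_scaleR \<Phi>_minus \<Phi>_zero)

lemma b_sum: "b (sum f A) y = (\<Sum>i\<in>A. b (f i) y)" "b x (sum g A) = (\<Sum>i\<in>A. b x (g i))"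
  by (induction A rule: infinite_finite_induct) (auto simp: b_simps)

lemma hermitian_B: "hermitian B"
  unfolding hermitian_def
proof (intro conjI allI ballI)
  fix x y z
  show "B x y \<in> K" by (simp add: B_def form_in_K)
  show "B x y = qcnj (B y x)"
    unfolding B_def using \<Phi>_form[of x y] hermitian_cnj[OF hermitian_form, of "\<Phi> x" y] by simp
  show "B x (y + z) = B x y + B x z" by (simp add: B_def \<Phi>_add hermitianD[OF hermitian_form])
  show "B x (y \<odot> a) = B x y * a" if "a \<in> K" for a
    using that by (simp add: B_def \<Phi>_rscale hermitianD[OF hermitian_form])
qed

lemma bounded_bilinear_b: "bounded_bilinear b"
  unfolding b_def[abs_def]
  using bounded_bilinear.comp[OF bounded_bilinear_inner bounded_linear_ident bounded_linear_\<Phi>] .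

lemma B_zero_iff: "is_subspace E \<Longrightarrow> (\<forall>v\<in>E. B v x = 0) \<longleftrightarrow> (\<forall>v\<in>E. b v x = 0)"
  unfolding hermitian_zero_iff_left[OF hermitian_B] qRe_B
  using is_subspaceD(4)[of E] K_closed(2) rscale_simps(2) by metis

lemma b_pos_E0: "x \<in> E0 \<Longrightarrow> b x y = x \<bullet> y"
  using \<Phi>_fixed_iff[of x] \<Phi>_inner[of x y] by (simp add: b_def)

lemma b_\<Phi>_E0: "x \<in> E0 \<Longrightarrow> b x (\<Phi> y) = b x y"
  using b_pos_E0[of x y] by (simp add: b_def)

lemma b_neg_orth: "x \<in> orth E0 \<Longrightarrow> b x y = - (x \<bullet> y)"
  using \<Phi>_neg_iff[of x] \<Phi>_inner[of x y] by (simp add: b_def)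

section \<open>The group \<open>O_group\<close> and its reflections\<close>

lemma O_groupD:
  assumes "g \<in> O_group"
  shows "bounded_linear g" "K_linear g" "B (g x) (g y) = B x y" "b (g x) (g y) = b x y"
proof -
  show "bounded_linear g" "K_linear g" using assms by (auto simp: O_group_def)
  obtain g' where g': "is_adjoint g g'" "g' \<circ> \<Phi> \<circ> g = \<Phi>" using assms by (auto simp: O_group_def)
  then have "g' (\<Phi> (g y)) = \<Phi> y" by (metis comp_apply)
  then show "B (g x) (g y) = B x y" using g'(1) by (simp add: B_def is_adjoint_def)
  then show "b (g x) (g y) = b x y" by (simp flip: qRe_B)
qed

lemma K_linearD: "K_linear T \<Longrightarrow> T (x + y) = T x + T y" "K_linear T \<Longrightarrow> a \<in> K \<Longrightarrow> T (x \<odot> a) = T x \<odot> a"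
  by (simp_all add: K_linear_def)

text \<open>Preservation of the real form is enough: by \<open>K\<close>-linearity it may be tested
  on all \<open>y \<odot> a\<close>, and this recovers the other components of
  \<open>B\<close>.\<close>

lemma O_groupI:
  assumes "bounded_linear g" "K_linear g" "bounded_linear h" "\<And>x. g (h x) = x" "\<And>x. h (g x) = x"
    and b: "\<And>x y. b (g x) (g y) = b x y"
  shows "g \<in> O_group"
proof -
  have B: "B (g x) (g y) = B x y" for x y
  proof -
    have "qRe ((B (g x) (g y) - B x y) * a) = 0" if "a \<in> K" for a
      using b[of x "y \<odot> a"] that hermitianD(4)[OF hermitian_B that]
      by (simp add: K_linearD[OF assms(2)] left_diff_distrib flip: qRe_B)
    moreover have "qcnj (B (g x) (g y) - B x y) \<in> K" using hermitianD(1)[OF hermitian_B] by blast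
    ultimately have "qRe ((B (g x) (g y) - B x y) * qcnj (B (g x) (g y) - B x y)) = 0" by blast
    then have "B (g x) (g y) - B x y = 0"
      using qRe_cnj_mult_self_eq_0 by (simp only: qRe_mult_commute[of "B (g x) (g y) - B x y"])
    then show ?thesis by simp
  qed
  \<comment> \<open>The equation \<open>g\<^sup>* \<Phi> g = \<Phi>\<close> forces the adjoint to be
    the conjugate of the inverse by \<open>\<Phi>\<close>.\<close>
  let ?g = "\<lambda>x. \<Phi> (h (\<Phi> x))"
  have "form (g x) y = form x (?g y)" for x y
    using B[of x "h (\<Phi> y)"] by (simp add: B_def assms)
  then have "is_adjoint g ?g" by (simp add: is_adjoint_def)
  moreover have "?g \<circ> \<Phi> \<circ> g = \<Phi>" by (auto simp: assms)
  moreover have "g \<circ> h = id" "h \<circ> g = id" by (auto simp: assms)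
  ultimately show ?thesis using assms(1-3) unfolding O_group_def by blast
qed

lemma O_group_inverse:
  assumes g: "g \<in> O_group"
  obtains h where "h \<in> O_group" "\<And>x. g (h x) = x" "\<And>x. h (g x) = x"
proof -
  obtain h where h: "bounded_linear h" "g \<circ> h = id" "h \<circ> g = id" using g by (auto simp: O_group_def)
  then have gh: "g (h x) = x" "h (g x) = x" for x by (metis comp_apply id_apply)+
  have "K_linear h"
    unfolding K_linear_def using K_linearD[OF O_groupD(2)[OF g]] gh by metis
  moreover have "b (h x) (h y) = b x y" for x y using O_groupD(4)[OF g, of "h x" "h y"] gh by simp
  ultimately have "h \<in> O_group" using O_groupI[OF h(1) _ O_groupD(1)[OF g]] gh by blast
  with gh that show thesis by blast
qed

lemma O_group_compose:
  assumes "g \<in> O_group" "h \<in> O_group"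
  shows "(\<lambda>x. g (h x)) \<in> O_group"
proof -
  obtain g' where g': "g' \<in> O_group" "\<And>x. g (g' x) = x" "\<And>x. g' (g x) = x"
    using O_group_inverse[OF assms(1)] by blast
  obtain h' where h': "h' \<in> O_group" "\<And>x. h (h' x) = x" "\<And>x. h' (h x) = x"
    using O_group_inverse[OF assms(2)] by blast
  show ?thesis
    by (rule O_groupI[where h = "\<lambda>x. h' (g' x)"])
      (use assms g' h' in \<open>auto simp: O_groupD(4) K_linear_def K_linearD[OF O_groupD(2)]
        intro: bounded_linear_compose O_groupD(1)\<close>)
qed

lemma id_in_O_group: "(\<lambda>x. x) \<in> O_group"
  by (rule O_groupI[where h = "\<lambda>x. x"]) (auto simp: K_linear_def)

lemma reflection_in_O_group:
  assumes q: "b w w \<noteq> 0"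
  shows "(\<lambda>x. x - w \<odot> ((2 / b w w) *\<^sub>R B w x)) \<in> O_group" (is "?r \<in> _")
proof -
  note D = hermitianD[OF hermitian_B]
  have ww: "B w w = of_real (b w w)" by (subst hermitian_self[OF hermitian_B]) (simp add: qRe_B)
  have bl: "bounded_linear ?r"
  proof (rule bounded_linear_intro[where K = "1 + \<bar>2 / b w w\<bar> * norm w * norm w"])
    show "?r (x + y) = ?r x + ?r y" for x y by (simp add: D rscale_add_right algebra_simps)
    show "?r (r *\<^sub>R x) = r *\<^sub>R ?r x" for r x by (simp add: D scaleR_diff_right mult_ac)
    fix x
    have "norm (w \<odot> (r *\<^sub>R B w x)) \<le> \<bar>r\<bar> * norm w * norm w * norm x" for r
    proof -
      have 1: "norm (w \<odot> (r *\<^sub>R B w x)) = \<bar>r\<bar> * (qnorm (B w x) * norm w)"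
        by (simp add: D norm_rscale)
      \<comment> \<open>Cauchy--Schwarz for the \<open>K\<close>-valued form: the real inequality is
        applied to \<open>x \<odot> qcnj (B w x)\<close>, and one factor
        \<open>qnorm (B w x)\<close> is cancelled.\<close>
      have "(qnorm (B w x))\<^sup>2 = qRe (B w x * qcnj (B w x))" by (simp add: mult_qcnj_self del: of_real_power)
      also have "\<dots> = b w (x \<odot> qcnj (B w x))" using D(1) by (simp add: D(4) flip: qRe_B)
      also have "\<dots> \<le> norm w * norm (x \<odot> qcnj (B w x))"
        unfolding b_def by (metis norm_\<Phi> norm_cauchy_schwarz)
      also have "\<dots> = norm w * (qnorm (B w x) * norm x)"
        using D(1) by (simp add: norm_rscale) (simp add: qnorm_def qcnj_def)
      finally have "qnorm (B w x) * qnorm (B w x) \<le> qnorm (B w x) * (norm w * norm x)"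
        by (simp add: power2_eq_square mult_ac)
      then have "qnorm (B w x) \<le> norm w * norm x"
        by (cases "qnorm (B w x) = 0") (auto simp: mult_le_cancel_left order.strict_iff_order[of 0])
      then have "\<bar>r\<bar> * norm w * qnorm (B w x) \<le> \<bar>r\<bar> * norm w * (norm w * norm x)"
        by (intro mult_left_mono) auto
      then show ?thesis unfolding 1 by (simp add: mult_ac)
    qed
    from this[of "2 / b w w"] norm_triangle_ineq4[of x "w \<odot> ((2 / b w w) *\<^sub>R B w x)"]
    show "norm (?r x) \<le> norm x * (1 + \<bar>2 / b w w\<bar> * norm w * norm w)" by (simp add: algebra_simps)
  qed
  have kl: "K_linear ?r"
    unfolding K_linear_def
  proof (intro conjI allI ballI)
    show "?r (x + y) = ?r x + ?r y" for x y by (simp add: D rscale_add_right algebra_simps)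
    fix x a assume a: "a \<in> K"
    have "w \<odot> ((2 / b w w) *\<^sub>R (B w x * a)) = w \<odot> ((2 / b w w) *\<^sub>R B w x) \<odot> a"
      using rscale_mult[of "(2 / b w w) *\<^sub>R B w x" a w] a D(1) by simp
    then show "?r (x \<odot> a) = ?r x \<odot> a"
      using a rscale_add_left[OF a, of x "- (w \<odot> ((2 / b w w) *\<^sub>R B w x))"] D(1)
      by (simp add: D(4))
  qed
  have inv: "?r (?r x) = x" for x
  proof -
    have "B w (w \<odot> ((2 / b w w) *\<^sub>R B w x)) = 2 *\<^sub>R B w x"
      using D(1) q by (simp add: D(4,12) ww of_real_mult_quat)
    then have "B w (?r x) = - B w x" by (simp only: D(10)) (simp add: scaleR_2)
    then show ?thesis using D(1) by simp
  qed
  have iso: "b (?r x) (?r y) = b x y" for x y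
  proof -
    define c where "c = (2 / b w w) *\<^sub>R B w x"
    define d where "d = (2 / b w w) *\<^sub>R B w y"
    have cd: "c \<in> K" "d \<in> K" using D(1) by (auto simp: c_def d_def)
    have 1: "b x (w \<odot> d) = (b w w / 2) * qRe (qcnj c * d)"
    proof -
      have "B x (w \<odot> d) = qcnj (B w x) * d" using cd hermitian_cnj[OF hermitian_B, of x w] by (simp add: D(4))
      also have "qcnj (B w x) = (b w w / 2) *\<^sub>R qcnj c" using q by (simp add: c_def)
      finally show ?thesis by (simp flip: qRe_B)
    qed
    have 2: "b (w \<odot> c) y = (b w w / 2) * qRe (qcnj c * d)"
    proof -
      have "B (w \<odot> c) y = qcnj c * B w y" using cd by (simp add: D(5))
      also have "B w y = (b w w / 2) *\<^sub>R d" using q by (simp add: d_def)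
      finally show ?thesis by (simp flip: qRe_B)
    qed
    have "B (w \<odot> c) (w \<odot> d) = b w w *\<^sub>R (qcnj c * d)"
      using cd by (simp add: D(4,5) ww of_real_mult_quat)
    then have 3: "b (w \<odot> c) (w \<odot> d) = b w w * qRe (qcnj c * d)"
      using qRe_B[of "w \<odot> c" "w \<odot> d"] by simp
    show ?thesis unfolding c_def[symmetric] d_def[symmetric] by (simp add: b_simps 1 2 3)
  qed
  show ?thesis by (rule O_groupI[OF bl kl bl inv inv iso])
qed

section \<open>Transitivity on \<open>X\<close>\<close>

lemma X_basis:
  assumes "E \<in> X"
  obtains f where "K_onb B f p E"
proof (rule Gram_Schmidt_K[OF hermitian_B, of E p])
  show "qRe (B x x) > 0" if "x \<in> E" "x \<noteq> 0" for x using assms that by (simp add: X_def Q_def)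
qed (use assms in \<open>simp_all add: X_def\<close>)

lemma is_subspace_X: "E \<in> X \<Longrightarrow> is_subspace E"
  by (simp add: X_def)

lemma b_pos_X: "E \<in> X \<Longrightarrow> x \<in> E \<Longrightarrow> x \<noteq> 0 \<Longrightarrow> b x x > 0"
  by (simp add: X_def Q_def qRe_B)

lemma E0_in_X: "E0 \<in> X"
  using E0_subspace E0_dimension by (auto simp: X_def Q_def qRe_B b_pos_E0)

text \<open>A Witt-type induction: reflections carry an orthonormal basis of \<open>E0\<close> to
  one of \<open>E\<close>, one vector at a time, each orthogonal to the vectors already placed and
  so fixing them. The unit scalars \<open>a i\<close> are needed because the reflection in
  \<open>y - f k\<close> sends \<open>y\<close> to \<open>f k\<close> only if
  \<open>B y (f k)\<close> is real; they do not affect the span.\<close>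

lemma transitive:
  assumes E: "E \<in> X"
  obtains g where "g \<in> O_group" "g ` E0 = E"
proof -
  note D = hermitianD[OF hermitian_B]
  obtain e where e: "K_onb B e p E0" using X_basis[OF E0_in_X] .
  obtain f where f: "K_onb B f p E" using X_basis[OF E] .
  have ee: "B (e i) (e j) = (if i = j then 1 else 0)" if "i < p" "j < p" for i j
    using K_onbD(4)[OF e that] .
  have ff: "B (f i) (f j) = (if i = j then 1 else 0)" if "i < p" "j < p" for i j
    using K_onbD(4)[OF f that] .
  have "\<exists>g a. g \<in> O_group \<and> (\<forall>i<k. a i \<in> K \<and> qnorm (a i) = 1 \<and> g (e i) \<odot> a i = f i)" if "k \<le> p" for k
    using that
  proof (induction k)
    case 0
    then show ?case using id_in_O_group by auto
  next
    case (Suc k)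
    then obtain g a where g: "g \<in> O_group"
      and a: "\<And>i. i < k \<Longrightarrow> a i \<in> K \<and> qnorm (a i) = 1 \<and> g (e i) \<odot> a i = f i"
      by auto
    have kp: "k < p" using Suc.prems by simp
    define x where "x = g (e k)"
    define \<beta> where "\<beta> = B x (f k)"
    have xx: "B x x = 1" unfolding x_def using O_groupD(3)[OF g] ee kp by simp
    have fx: "B (f i) x = 0" if "i < k" for i
    proof -
      have "B (f i) x = B (g (e i) \<odot> a i) (g (e k))" using a[OF that] by (simp add: x_def)
      also have "\<dots> = qcnj (a i) * B (e i) (e k)"
      proof -
        have "a i \<in> K" using a[OF that] by blast
        then show ?thesis by (simp add: D O_groupD(3)[OF g])
      qed
      finally show ?thesis using ee kp that by simp
    qed
    \<comment> \<open>Scaling \<open>x\<close> so that \<open>B x (f k)\<close> becomes a nonpositive real keeps the reflection vector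
      \<open>x \<odot> c - f k\<close> away from the isotropic cone.\<close>
    obtain c where c: "c \<in> K" "qnorm c = 1" "qcnj c * \<beta> = of_real (- qnorm \<beta>)"
    proof (cases "\<beta> = 0")
      case True
      moreover have "qnorm 1 = 1" by (simp add: qnorm_def one_quat_def)
      ultimately show thesis using that[of 1] by simp
    next
      case False
      let ?c = "(- 1 / qnorm \<beta>) *\<^sub>R \<beta>"
      have n: "qnorm \<beta> \<noteq> 0" using False by simp
      have 1: "qcnj ?c * \<beta> = of_real (- qnorm \<beta>)"
        using n by (simp add: qcnj_mult_self del: of_real_power) (simp add: of_real_def power2_eq_square)
      have "of_real ((qnorm ?c)\<^sup>2) = qcnj ?c * ?c" by (simp only: qcnj_mult_self)
      also have "\<dots> = (- 1 / qnorm \<beta>) *\<^sub>R (qcnj ?c * \<beta>)" by simp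
      also have "\<dots> = 1" unfolding 1 using n by (simp add: of_real_def)
      finally have "(qnorm ?c)\<^sup>2 = 1" by (metis of_real_eq_1_iff)
      then have "qnorm ?c = 1" using qnorm_nonneg[of ?c] unfolding power2_eq_1_iff by linarith
      moreover have "?c \<in> K" using D(1) by (simp add: \<beta>_def)
      ultimately show thesis using that[of ?c] 1 by blast
    qed
    define y where "y = x \<odot> c"
    have yy: "B y y = 1"
      unfolding y_def using c by (simp add: D xx qcnj_mult_self)
    have yf: "B y (f k) = of_real (- qnorm \<beta>)" unfolding y_def using c by (simp add: D \<beta>_def)
    have fy: "B (f k) y = of_real (- qnorm \<beta>)"
      using hermitian_cnj[OF hermitian_B, of "f k" y] yf by simp
    have fyi: "B (f i) y = 0" "B y (f i) = 0" if "i < k" for i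
      using fx[OF that] c hermitian_cnj[OF hermitian_B, of y "f i"] by (simp_all add: y_def D)
    define w where "w = y - f k"
    have ww: "b w w = 2 + 2 * qnorm \<beta>"
      unfolding qRe_B[symmetric] using yy yf fy ff kp by (simp add: w_def D)
    have wpos: "b w w > 0" using ww qnorm_nonneg[of \<beta>] by linarith
    define r where "r x = x - w \<odot> ((2 / b w w) *\<^sub>R B w x)" for x
    have rO: "r \<in> O_group" unfolding r_def[abs_def] using wpos by (intro reflection_in_O_group) auto
    have "B w y = of_real (1 + qnorm \<beta>)" using yy fy by (simp add: w_def D)
    also have "\<dots> = of_real (b w w / 2)" by (simp only: ww) (simp add: add_divide_distrib)
    finally have "(2 / b w w) *\<^sub>R B w y = 1" using wpos by (simp add: of_real_def)
    then have ry: "r y = f k" by (simp add: r_def w_def)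
    have rf: "r (f i) = f i" if "i < k" for i
    proof -
      have "B w (f i) = 0" using fyi[OF that] ff kp that by (simp add: w_def D)
      then show ?thesis by (simp add: r_def)
    qed
    have "(\<lambda>x. r (g x)) \<in> O_group" by (rule O_group_compose[OF rO g])
    moreover have "r (g (e i)) \<odot> (a(k := c)) i = f i" "(a(k := c)) i \<in> K" "qnorm ((a(k := c)) i) = 1"
      if "i < Suc k" for i
    proof -
      have kl: "r (z \<odot> t) = r z \<odot> t" if "t \<in> K" for z t
        using K_linearD(2)[OF O_groupD(2)[OF rO] that] .
      show "r (g (e i)) \<odot> (a(k := c)) i = f i"
      proof (cases "i = k")
        case True
        then show ?thesis using kl[OF c(1), of x] ry by (simp add: x_def y_def)
      next
        case False
        then have "i < k" using that by simp
        then show ?thesis using kl[of "a i" "g (e i)"] a[of i] rf[of i] False by simp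
      qed
      show "(a(k := c)) i \<in> K" "qnorm ((a(k := c)) i) = 1" using that a c by (auto simp: less_Suc_eq)
    qed
    ultimately show ?case by blast
  qed
  from this[of p] obtain g a where g: "g \<in> O_group"
    and a: "\<And>i. i < p \<Longrightarrow> a i \<in> K" "\<And>i. i < p \<Longrightarrow> qnorm (a i) = 1" "\<And>i. i < p \<Longrightarrow> g (e i) \<odot> a i = f i"
    by auto
  note gK = K_linearD[OF O_groupD(2)[OF g]]
  have gsum: "g (sum h A) = (\<Sum>i\<in>A. g (h i))" for h :: "nat \<Rightarrow> 'h" and A
    using bounded_linear.linear[OF O_groupD(1)[OF g]] by (rule linear_sum)
  have ge: "g (e i) = f i \<odot> qcnj (a i)" if "i < p" for i
    using rscale_inverse[OF a(1,2)[OF that], of "g (e i)"] a(3)[OF that] by simp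
  have "g ` E0 = E"
  proof (intro equalityI subsetI)
    fix y assume "y \<in> g ` E0"
    then obtain x where x: "x \<in> E0" "y = g x" by auto
    have "y = g (\<Sum>i<p. e i \<odot> B (e i) x)" using K_onbD(3)[OF e x(1)] x(2) by simp
    also have "\<dots> = (\<Sum>i<p. g (e i) \<odot> B (e i) x)" unfolding gsum using gK(2)[OF D(1)] by simp
    also have "\<dots> = (\<Sum>i<p. f i \<odot> qcnj (a i) \<odot> B (e i) x)" using ge by simp
    also have "\<dots> \<in> E" using a(1) D(1)
      by (intro is_subspaceD(7)[OF is_subspace_X[OF E]] is_subspaceD(4)[OF is_subspace_X[OF E]])
        (auto intro: K_onbD(2)[OF f])
    finally show "y \<in> E" .
  next
    fix y assume y: "y \<in> E"
    let ?x = "\<Sum>i<p. e i \<odot> a i \<odot> B (f i) y"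
    have "y = (\<Sum>i<p. f i \<odot> B (f i) y)" using K_onbD(3)[OF f y] .
    also have "\<dots> = g ?x"
      unfolding gsum using a D(1) by (intro sum.cong) (auto simp: gK(2))
    finally have "y = g ?x" .
    moreover have "?x \<in> E0" using a(1) D(1)
      by (intro is_subspaceD(7)[OF E0_subspace] is_subspaceD(4)[OF E0_subspace]) (auto intro: K_onbD(2)[OF e])
    ultimately show "y \<in> g ` E0" by blast
  qed
  with g that show thesis by blast
qed

lemma O_group_image_X:
  assumes g: "g \<in> O_group" and E: "E \<in> X"
  shows "g ` E \<in> X"
proof -
  note gK = K_linearD[OF O_groupD(2)[OF g]]
  obtain h where h: "h \<in> O_group" "\<And>x. g (h x) = x" "\<And>x. h (g x) = x" using O_group_inverse[OF g] by blast
  have g0: "g 0 = 0" using O_groupD(1)[OF g] by (simp add: bounded_linear.linear linear_0)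
  have "is_subspace (g ` E)"
    using is_subspace_X[OF E] unfolding is_subspace_def
    by (auto simp: image_iff g0 intro: bexI[of _ 0]) (metis gK)+
  moreover have "has_dimension (g ` E) p"
  proof -
    obtain c where c: "bij_betw (\<lambda>k. \<Sum>i<p. c i \<odot> k i) ({..<p} \<rightarrow>\<^sub>E K) E"
      using E by (auto simp: X_def has_dimension_def)
    have "bij_betw g E (g ` E)" using h(3) by (metis inj_on_def inj_on_imp_bij_betw)
    from bij_betw_trans[OF c this]
    have "bij_betw (\<lambda>k. g (\<Sum>i<p. c i \<odot> k i)) ({..<p} \<rightarrow>\<^sub>E K) (g ` E)" by (simp add: o_def)
    moreover have "g (\<Sum>i<p. c i \<odot> k i) = (\<Sum>i<p. g (c i) \<odot> k i)" if "k \<in> {..<p} \<rightarrow>\<^sub>E K" for k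
      unfolding linear_sum[OF bounded_linear.linear[OF O_groupD(1)[OF g]]]
      using that by (intro sum.cong) (auto simp: gK(2) PiE_iff)
    ultimately have "bij_betw (\<lambda>k. \<Sum>i<p. g (c i) \<odot> k i) ({..<p} \<rightarrow>\<^sub>E K) (g ` E)"
      by (subst (asm) bij_betw_cong) auto
    then show ?thesis unfolding has_dimension_def by (intro exI[of _ "\<lambda>i. g (c i)"])
  qed
  moreover have "qRe (Q x) > 0" if "x \<in> g ` E" "x \<noteq> 0" for x
  proof -
    from that(1) obtain y where y: "y \<in> E" "x = g y" by auto
    with that g0 have "y \<noteq> 0" by auto
    then show ?thesis using y b_pos_X[OF E] O_groupD(4)[OF g] by (simp add: Q_def qRe_B)
  qed
  ultimately show ?thesis by (simp add: X_def)
qed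

section \<open>Projections onto members of \<open>X\<close>\<close>

lemma B_proj_unique:
  assumes "E \<in> X" "u \<in> E" "v \<in> E" "\<And>z. z \<in> E \<Longrightarrow> b z (x - u) = 0" "\<And>z. z \<in> E \<Longrightarrow> b z (x - v) = 0"
  shows "u = v"
proof (rule ccontr)
  assume "u \<noteq> v"
  have uv: "u - v \<in> E" using assms is_subspaceD(3)[OF is_subspace_X] by blast
  have "b (u - v) (u - v) = b (u - v) (x - v) - b (u - v) (x - u)" by (simp add: b_simps)
  also have "\<dots> = 0" using assms(4,5)[OF uv] by simp
  finally show False using b_pos_X[OF assms(1) uv] \<open>u \<noteq> v\<close> by simp
qed

text \<open>Conjugation from \<open>E0\<close> also shows that the map inside \<open>B_proj\<close>
  is bounded; only then does \<open>Blinfun\<close> return that map.\<close>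

lemma B_proj_g:
  assumes g: "g \<in> O_group" and h: "\<And>x. g (h x) = x" "\<And>x. h (g x) = x" and hO: "h \<in> O_group"
    and E: "g ` E0 = E"
  shows "B_proj E x = g (p0 (h x))"
proof -
  have EX: "E \<in> X" using O_group_image_X[OF g E0_in_X] E by simp
  have *: "g (p0 (h x)) \<in> E \<and> (\<forall>z\<in>E. b z (x - g (p0 (h x))) = 0)" for x
  proof (intro conjI ballI)
    show "g (p0 (h x)) \<in> E" using p0_in E by blast
    fix z assume "z \<in> E"
    then obtain z0 where z0: "z0 \<in> E0" "z = g z0" using E by auto
    have "x - g (p0 (h x)) = g (h x - p0 (h x))"
      using h bounded_linear.linear[OF O_groupD(1)[OF g]] by (simp add: linear_diff)
    then have "b z (x - g (p0 (h x))) = b z0 (h x - p0 (h x))" using z0 O_groupD(4)[OF g] by simp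
    also have "\<dots> = (1/2) * (b z0 (h x) - b z0 (\<Phi> (h x)))"
      by (simp add: p0_def b_simps field_simps)
    also have "\<dots> = 0" using z0 by (simp add: b_\<Phi>_E0)
    finally show "b z (x - g (p0 (h x))) = 0" .
  qed
  have "(THE u. u \<in> E \<and> (\<forall>v\<in>E. B v (x - u) = 0)) = g (p0 (h x))" for x
    unfolding B_zero_iff[OF is_subspace_X[OF EX]]
  proof (rule the_equality, rule *)
    fix u assume "u \<in> E \<and> (\<forall>z\<in>E. b z (x - u) = 0)"
    then show "u = g (p0 (h x))" using B_proj_unique[OF EX, of u "g (p0 (h x))" x] * by blast
  qed
  then have "B_proj E = Blinfun (\<lambda>x. g (p0 (h x)))" by (simp add: B_proj_def)
  moreover have "bounded_linear (\<lambda>x. g (p0 (h x)))"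
    by (rule bounded_linear_compose[OF O_groupD(1)[OF g]
          bounded_linear_compose[OF bounded_linear_p0 O_groupD(1)[OF hO]]])
  ultimately show ?thesis by (simp add: bounded_linear_Blinfun_apply)
qed

lemma X_cases:
  assumes "E \<in> X"
  obtains g h where "g \<in> O_group" "h \<in> O_group" "\<And>x. g (h x) = x" "\<And>x. h (g x) = x" "g ` E0 = E"
    "\<And>x. B_proj E x = g (p0 (h x))"
proof -
  obtain g where g: "g \<in> O_group" "g ` E0 = E" using transitive[OF assms] .
  obtain h where h: "h \<in> O_group" "\<And>x. g (h x) = x" "\<And>x. h (g x) = x" using O_group_inverse[OF g(1)] by blast
  from that[OF g(1) h(1) h(2,3) g(2) B_proj_g[OF g(1) h(2,3) h(1) g(2)]] show thesis .
qed

lemma B_proj_eqI: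
  assumes "E \<in> X" "u \<in> E" "\<And>z. z \<in> E \<Longrightarrow> b z (x - u) = 0"
  shows "B_proj E x = u"
proof -
  obtain g h where g: "g \<in> O_group" "h \<in> O_group" "\<And>x. g (h x) = x" "\<And>x. h (g x) = x" "g ` E0 = E"
    "\<And>x. B_proj E x = g (p0 (h x))" using X_cases[OF assms(1)] by blast
  have 1: "g (p0 (h x)) \<in> E" using p0_in g(5) by blast
  have 2: "b z (x - g (p0 (h x))) = 0" if "z \<in> E" for z
  proof -
    obtain z0 where z0: "z0 \<in> E0" "z = g z0" using g(5) \<open>z \<in> E\<close> by auto
    have "b z (x - g (p0 (h x))) = b z x - b z0 (p0 (h x))" using z0 O_groupD(4)[OF g(1)] by (simp add: b_simps)
    also have "b z0 (p0 (h x)) = b z0 (h x)"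
      using z0 by (simp add: p0_def b_simps b_\<Phi>_E0)
    also have "b z0 (h x) = b z x" using O_groupD(4)[OF g(1), of z0 "h x"] g z0 by simp
    finally show ?thesis by simp
  qed
  show ?thesis unfolding g(6) using B_proj_unique[OF assms(1) 1 assms(2) 2 assms(3)] by blast
qed

lemma B_proj_props:
  assumes E: "E \<in> X"
  shows "B_proj E x \<in> E"
    "x \<in> E \<Longrightarrow> B_proj E x = x"
    "a \<in> K \<Longrightarrow> B_proj E (x \<odot> a) = B_proj E x \<odot> a"
    "b (B_proj E x) y = b x (B_proj E y)"
    "B_proj E (B_proj E x) = B_proj E x"
proof -
  obtain g h where g: "g \<in> O_group" "h \<in> O_group" "\<And>x. g (h x) = x" "\<And>x. h (g x) = x" "g ` E0 = E"
    "\<And>x. B_proj E x = g (p0 (h x))" using X_cases[OF E] by blast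
  show in_E: "B_proj E x \<in> E" for x using g p0_in by auto
  show id: "B_proj E x = x" if "x \<in> E" for x
    using that by (intro B_proj_eqI[OF E]) (auto simp: b_simps)
  show "B_proj E (x \<odot> a) = B_proj E x \<odot> a" if "a \<in> K"
  proof -
    have "p0 (y \<odot> a) = p0 y \<odot> a" for y using that by (simp add: p0_def \<Phi>_rscale rscale_add_left)
    then show ?thesis
      using that by (simp add: g(6) K_linearD(2)[OF O_groupD(2)[OF g(1)]] K_linearD(2)[OF O_groupD(2)[OF g(2)]])
  qed
  have "b (p0 x) y = b x (p0 y)" for x y by (simp add: p0_def b_simps) (simp add: b_def \<Phi>_inner)
  then show "b (B_proj E x) y = b x (B_proj E y)"
    unfolding g(6) using O_groupD(4)[OF g(1)] g(3) by metis
  show "B_proj E (B_proj E x) = B_proj E x"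
    by (rule id[OF in_E])
qed

text \<open>Transported to \<open>E0\<close>, a vector with zero projection lies in
  \<open>orth E0\<close>, where \<open>- b\<close> is the scalar product. So the complement of
  \<open>E\<close> is negative definite and Cauchy--Schwarz holds on it.\<close>

lemma B_orth_negative:
  assumes E: "E \<in> X" and x: "B_proj E x = 0"
  shows "b x x \<le> 0" "b x x = 0 \<Longrightarrow> x = 0"
    "B_proj E y = 0 \<Longrightarrow> \<bar>b x y\<bar> \<le> sqrt (- b x x) * sqrt (- b y y)"
proof -
  obtain g h where g: "g \<in> O_group" "h \<in> O_group" "\<And>x. g (h x) = x" "\<And>x. h (g x) = x" "g ` E0 = E"
    "\<And>x. B_proj E x = g (p0 (h x))" using X_cases[OF E] by blast
  have h0: "h 0 = 0" "g 0 = 0"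
    using O_groupD(1)[OF g(2)] O_groupD(1)[OF g(1)] by (simp_all add: bounded_linear.linear linear_0)
  have b: "b y z = - (h y \<bullet> h z)" if y: "B_proj E y = 0" for y z
  proof -
    have "p0 (h y) = 0" using y g(4)[of "p0 (h y)"] h0 by (simp add: g(6))
    then have "\<Phi> (h y) = - h y" by (simp add: p0_def add_eq_0_iff)
    then have "h y \<in> orth E0" by (simp add: \<Phi>_neg_iff)
    then show ?thesis using b_neg_orth O_groupD(4)[OF g(2), of y z] by simp
  qed
  show "b x x \<le> 0" by (simp add: b[OF x])
  show "x = 0" if "b x x = 0" using that g(3)[of x] h0 by (simp add: b[OF x])
  show "\<bar>b x y\<bar> \<le> sqrt (- b x x) * sqrt (- b y y)" if y: "B_proj E y = 0"
    using Cauchy_Schwarz_ineq2[of "h x" "h y"] by (simp add: b[OF x] b[OF y] norm_eq_sqrt_inner)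
qed

end

section \<open>The Riemannian norm\<close>

text \<open>\<open>riem_norm\<close> differentiates in operator norm, which is stronger than the
  pointwise derivative; the remainder bound is uniform on the unit ball.\<close>

lemma has_vector_derivative_Blinfun_op_exp:
  fixes A :: "'a::{real_normed_vector,complete_space} \<Rightarrow> 'a"
  assumes A: "bounded_linear A"
  shows "((\<lambda>s. Blinfun (exp_op A s)) has_vector_derivative Blinfun A) (at 0)"
proof -
  obtain k where k: "\<And>x. norm (A x) \<le> norm x * k" "0 \<le> k"
    using bounded_linear.nonneg_bounded[OF A] by blast
  let ?E = "\<lambda>s. Blinfun (exp_op A s)"
  let ?r = "\<lambda>h. exp (k * (0 + \<bar>h\<bar>)) - exp (k * 0) - k * \<bar>h\<bar> * exp (k * 0)"
  have E: "blinfun_apply (?E s) = exp_op A s" for s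
    by (rule bounded_linear_Blinfun_apply[OF bounded_linear_op_exp[OF A]])
  have "norm (?E (0 + h) - ?E 0 - h *\<^sub>R Blinfun A) \<le> ?r h" for h
  proof (rule norm_blinfun_bound)
    have "k * \<bar>h\<bar> + 1 \<le> exp (k * \<bar>h\<bar>)" using exp_ge_add_one_self[of "k * \<bar>h\<bar>"] by linarith
    then show "0 \<le> ?r h" by simp
    show "norm (blinfun_apply (?E (0 + h) - ?E 0 - h *\<^sub>R Blinfun A) x) \<le> ?r h * norm x" for x
      using op_exp_remainder[OF A k, of 0 h x]
      by (simp only: blinfun.diff_left blinfun.scaleR_left E bounded_linear_Blinfun_apply[OF A] op_exp_zero abs_zero)
  qed
  then have bd: "norm (norm (?E (0 + h) - ?E 0 - h *\<^sub>R Blinfun A) / norm h) \<le> ?r h / \<bar>h\<bar>" for h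
    by (simp add: divide_right_mono)
  have "((\<lambda>h. norm (?E (0 + h) - ?E 0 - h *\<^sub>R Blinfun A) / norm h) \<longlongrightarrow> 0) (at 0)"
    by (rule Lim_null_comparison[OF always_eventually[OF allI[OF bd]] exp_remainder_tendsto])
  then show ?thesis
    unfolding has_vector_derivative_def has_derivative_at
    by (simp only: bounded_linear_scaleR_left simp_thms)
qed

context hyperbolic_grassmannian
begin

section \<open>Exponentials of elements of \<open>\<pp>\<close>\<close>

lemma pD:
  assumes "A \<in> \<pp>"
  shows "bounded_linear A" "K_linear A" "A x \<bullet> y = x \<bullet> A y" "A (\<Phi> x) = - \<Phi> (A x)"
proof -
  show "bounded_linear A" "K_linear A" using assms by (auto simp: \<pp>_def hilbert_schmidt_def)
  have "form (A x) y = form x (A y)" using assms by (auto simp: \<pp>_def is_adjoint_def)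
  then show "A x \<bullet> y = x \<bullet> A y" by (simp flip: Re_form)
  show "A (\<Phi> x) = - \<Phi> (A x)" using assms by (auto simp: \<pp>_def add_eq_0_iff)
qed

text \<open>\<open>E0\<close> and \<open>orth E0\<close> are the eigenspaces of
  \<open>\<Phi>\<close> for 1 and -1, and an operator that anticommutes with \<open>\<Phi>\<close>
  exchanges them.\<close>

lemma p_E0:
  assumes "\<And>x. A (\<Phi> x) = - \<Phi> (A x)"
  shows "x \<in> E0 \<Longrightarrow> A x \<in> orth E0" "x \<in> orth E0 \<Longrightarrow> bounded_linear A \<Longrightarrow> A x \<in> E0"
proof -
  show "A x \<in> orth E0" if "x \<in> E0"
  proof -
    have "A x = - \<Phi> (A x)" using assms[of x] \<Phi>_fixed_iff[of x] that by simp
    then have "\<Phi> (A x) = - A x" by (metis minus_minus)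
    then show ?thesis by (simp add: \<Phi>_neg_iff)
  qed
  show "A x \<in> E0" if "x \<in> orth E0" "bounded_linear A"
  proof -
    have "A (- x) = - \<Phi> (A x)" using assms[of x] \<Phi>_neg_iff[of x] that by simp
    then have "\<Phi> (A x) = A x" using bounded_linear.linear[OF that(2)] by (simp add: linear_neg)
    then show ?thesis by (simp add: \<Phi>_fixed_iff)
  qed
qed

lemma op_exp_in_O_group:
  assumes A: "A \<in> \<pp>"
  shows "exp_op A s \<in> O_group"
proof -
  note P = pD[OF A]
  note inv = op_exp_inverse[OF P(1,3)]
  have inv': "exp_op A (- s) (exp_op A s x) = x" for x
    using inv[of "- s" x] by (simp only: minus_minus)
  show ?thesis
  proof (rule O_groupI[where h = "exp_op A (- s)"])
    show "K_linear (exp_op A s)"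
      unfolding K_linear_def
    proof (intro conjI allI ballI)
      show "exp_op A s (x + y) = exp_op A s x + exp_op A s y" for x y
        using bounded_linear_op_exp[OF P(1), of s] by (simp add: bounded_linear.linear linear_add)
      fix x a assume a: "a \<in> K"
      show "exp_op A s (x \<odot> a) = exp_op A s x \<odot> a"
        using op_exp_intertwine[OF P(1) bounded_linear_rscale[OF a], of 1 s x] K_linearD(2)[OF P(2) a]
        by simp
    qed
    show "b (exp_op A s x) (exp_op A s y) = b x y" for x y
    proof -
      have "\<Phi> (exp_op A s y) = exp_op A (- 1 * s) (\<Phi> y)"
        using P(4) by (intro op_exp_intertwine[OF P(1) bounded_linear_\<Phi>]) simp
      then have "b (exp_op A s x) (exp_op A s y)
          = x \<bullet> exp_op A s (exp_op A (- s) (\<Phi> y))"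
        by (simp only: b_def op_exp_self_adjoint[OF P(1,3)] mult_minus1)
      then show ?thesis by (simp only: inv b_def)
    qed
  qed (rule bounded_linear_op_exp[OF P(1)] inv inv')+
qed

text \<open>At \<open>E0\<close> the projection moves as the conjugate of \<open>p0\<close> by the
  exponential, with derivative the commutator \<open>A p0 - p0 A\<close>. Since \<open>p0\<close> is
  half of \<open>1 + \<Phi>\<close> and \<open>A\<close> anticommutes with \<open>\<Phi>\<close>,
  this commutator is \<open>A \<Phi>\<close>.\<close>

lemma B_proj_exp_derivative:
  assumes A: "A \<in> \<pp>" and g: "g \<in> O_group" and h: "h \<in> O_group" "\<And>x. g (h x) = x" "\<And>x. h (g x) = x"
  shows "((\<lambda>s. B_proj (g ` exp_op A s ` E0)) has_vector_derivative
    Blinfun (\<lambda>x. g (A (\<Phi> (h x))))) (at 0)"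
proof -
  note P = pD[OF A]
  let ?e = "\<lambda>s. exp_op A s"
  note inv = op_exp_inverse[OF P(1,3)]
  have inv': "?e (- s) (?e s x) = x" for x s
    using inv[of "- s" x] by (simp only: minus_minus)
  define E where "E s = Blinfun (?e s)" for s
  define G where "G = Blinfun g"
  define H where "H = Blinfun h"
  define R where "R = Blinfun p0"
  have E: "blinfun_apply (E s) = ?e s" for s
    unfolding E_def by (rule bounded_linear_Blinfun_apply[OF bounded_linear_op_exp[OF P(1)]])
  have G: "blinfun_apply G = g" and H: "blinfun_apply H = h" and R: "blinfun_apply R = p0"
    unfolding G_def H_def R_def
    using bounded_linear_Blinfun_apply O_groupD(1) g h bounded_linear_p0 by auto
  have eq: "B_proj (g ` ?e s ` E0) = G o\<^sub>L (E s o\<^sub>L (R o\<^sub>L E (- s))) o\<^sub>L H" for s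
  proof (rule blinfun_eqI)
    fix x
    have "blinfun_apply (B_proj ((\<lambda>x. g (?e s x)) ` E0)) x = g (?e s (p0 (?e (- s) (h x))))"
      by (rule B_proj_g[where h = "\<lambda>x. ?e (- s) (h x)"])
        (auto simp: h inv inv' intro: O_group_compose g h op_exp_in_O_group[OF A]
          simp del: scaleR_minus_left)
    then show "B_proj (g ` ?e s ` E0) x =
        blinfun_apply (G o\<^sub>L (E s o\<^sub>L (R o\<^sub>L E (- s))) o\<^sub>L H) x"
      by (simp only: blinfun_apply_blinfun_compose E G H R image_image)
  qed
  have dE: "(E has_vector_derivative Blinfun A) (at 0)"
    unfolding E_def[abs_def] by (rule has_vector_derivative_Blinfun_op_exp[OF P(1)])
  have dE': "((\<lambda>s. E (- s)) has_vector_derivative (- 1) *\<^sub>R Blinfun A) (at 0)"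
    using vector_diff_chain_at[of uminus "- 1" 0 E "Blinfun A"] dE
    by (simp add: o_def has_vector_derivative_minus)
  have E0: "E 0 = id_blinfun" by (rule blinfun_eqI) (simp only: E op_exp_zero blinfun_apply_id_blinfun id_apply)
  note bb = bounded_bilinear.has_vector_derivative[OF bounded_bilinear_blinfun_compose]
  have dRE: "((\<lambda>s. R o\<^sub>L E (- s)) has_vector_derivative R o\<^sub>L ((- 1) *\<^sub>R Blinfun A)) (at 0)"
    using bb[OF has_vector_derivative_const dE', of R] by simp
  have "((\<lambda>s. E s o\<^sub>L (R o\<^sub>L E (- s))) has_vector_derivative
      (R o\<^sub>L ((- 1) *\<^sub>R Blinfun A)) + (Blinfun A o\<^sub>L R)) (at 0)"
  proof -
    have "id_blinfun o\<^sub>L Z = Z" "Z o\<^sub>L id_blinfun = Z" for Z :: "'h \<Rightarrow>\<^sub>L 'h"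
      by (auto intro!: blinfun_eqI)
    then show ?thesis using bb[OF dE dRE] by (simp only: E0 minus_zero)
  qed
  from bb[OF bb[OF has_vector_derivative_const this, of G] has_vector_derivative_const, of H]
  have "((\<lambda>s. G o\<^sub>L (E s o\<^sub>L (R o\<^sub>L E (- s))) o\<^sub>L H) has_vector_derivative
      G o\<^sub>L ((R o\<^sub>L ((- 1) *\<^sub>R Blinfun A)) + (Blinfun A o\<^sub>L R)) o\<^sub>L H) (at 0)"
    by simp
  moreover have "G o\<^sub>L ((R o\<^sub>L ((- 1) *\<^sub>R Blinfun A)) + (Blinfun A o\<^sub>L R)) o\<^sub>L H = Blinfun (\<lambda>x. g (A (\<Phi> (h x))))"
  proof (rule blinfun_eqI)
    fix x
    have bl: "bounded_linear (\<lambda>x. g (A (\<Phi> (h x))))"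
      by (rule bounded_linear_compose[OF O_groupD(1)[OF g] bounded_linear_compose[OF P(1)
            bounded_linear_compose[OF bounded_linear_\<Phi> O_groupD(1)[OF h(1)]]]])
    have lin: "linear A" by (rule bounded_linear.linear[OF P(1)])
    have "A (p0 y) - p0 (A y) = A (\<Phi> y)" for y
    proof -
      have "A (p0 y) - p0 (A y) = (1/2) *\<^sub>R (A (\<Phi> y) - \<Phi> (A y))"
        by (simp add: p0_def linear_add[OF lin] linear_scale[OF lin] scaleR_add_right scaleR_diff_right)
      also have "\<dots> = (1/2) *\<^sub>R (2 *\<^sub>R A (\<Phi> y))" unfolding scaleR_2 by (simp add: P(4))
      finally show ?thesis by simp
    qed
    then show "blinfun_apply (G o\<^sub>L ((R o\<^sub>L ((- 1) *\<^sub>R Blinfun A)) + (Blinfun A o\<^sub>L R)) o\<^sub>L H) x =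
        blinfun_apply (Blinfun (\<lambda>x. g (A (\<Phi> (h x))))) x"
      by (simp add: bounded_linear_Blinfun_apply[OF bl] bounded_linear_Blinfun_apply[OF P(1)] G H R
          blinfun.add_left blinfun.minus_left blinfun.minus_right linear_neg[OF bounded_linear.linear[OF bounded_linear_p0]])
  qed
  ultimately show ?thesis unfolding eq by simp
qed

section \<open>Tangent operators and their norm\<close>

definition b_on :: "'h set \<Rightarrow> bool" where
  "b_on T \<longleftrightarrow> (\<forall>u\<in>T. \<forall>v\<in>T. b u v = (if u = v then 1 else 0))"

text \<open>The derivatives of three identities that hold for every \<open>B_proj E\<close>:
  compatibility with scalars, symmetry for \<open>b\<close>, and idempotence.\<close>

definition tangent :: "'h set \<Rightarrow> ('h \<Rightarrow>\<^sub>L 'h) \<Rightarrow> bool" where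
  "tangent E V \<longleftrightarrow> (\<forall>x. \<forall>a\<in>K. V (x \<odot> a) = V x \<odot> a) \<and>
     (\<forall>x y. b (V x) y = b x (V y)) \<and>
     (\<forall>x. V x = V (B_proj E x) + B_proj E (V x))"

lemma tangentI:
  assumes V: "((\<lambda>s. B_proj (\<gamma> s)) has_vector_derivative V) (at t)"
    and d: "\<delta> > 0" and X: "\<And>s. dist s t < \<delta> \<Longrightarrow> \<gamma> s \<in> X"
  shows "tangent (\<gamma> t) V"
proof -
  let ?P = "\<lambda>s. blinfun_apply (B_proj (\<gamma> s))"
  have Vx: "((\<lambda>s. ?P s x) has_vector_derivative V x) (at t)" for x
    by (rule bounded_linear.has_vector_derivative[OF blinfun.bounded_linear_left V])
  \<comment> \<open>An identity valid on all of \<open>X\<close> holds along the curve near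
    \<open>t\<close>, so its two sides have the same derivative.\<close>
  have uni: "D = D'" if "(f has_vector_derivative D) (at t)" "(f' has_vector_derivative D') (at t)"
    "\<And>s. \<gamma> s \<in> X \<Longrightarrow> f s = f' s" for f f' :: "real \<Rightarrow> 'c::real_normed_vector" and D D'
  proof -
    have "(f' has_vector_derivative D) (at t)"
      by (rule has_vector_derivative_transform_within[OF that(1) d]) (use that(3) X in auto)
    then show ?thesis using that(2) vector_derivative_unique_at by blast
  qed
  show ?thesis
    unfolding tangent_def
  proof (intro conjI allI ballI)
    fix x a assume a: "a \<in> K"
    show "V (x \<odot> a) = V x \<odot> a"
      by (rule uni[OF Vx bounded_linear.has_vector_derivative[OF bounded_linear_rscale[OF a] Vx]])
        (simp add: B_proj_props a)
  next
    fix x y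
    show "b (V x) y = b x (V y)"
      by (rule uni[OF bounded_linear.has_vector_derivative[OF bounded_bilinear.bounded_linear_left[OF bounded_bilinear_b] Vx]
            bounded_linear.has_vector_derivative[OF bounded_bilinear.bounded_linear_right[OF bounded_bilinear_b] Vx]])
        (rule B_proj_props(4))
  next
    fix x
    have "((\<lambda>s. ?P s (?P s x)) has_vector_derivative
        B_proj (\<gamma> t) (V x) + V (?P t x)) (at t)"
      by (rule bounded_bilinear.has_vector_derivative[OF bounded_bilinear_blinfun_apply V Vx])
    then have "V x = ?P t (V x) + V (?P t x)"
      by (rule uni[OF Vx]) (simp only: B_proj_props(5))
    then show "V x = V (?P t x) + ?P t (V x)"
      by (simp only: add.commute)
  qed
qed

lemma quat_zeroI: "z \<in> K \<Longrightarrow> (\<And>a. a \<in> K \<Longrightarrow> qRe (z * a) = 0) \<Longrightarrow> z = 0"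
  using qRe_cnj_mult_self_eq_0[of z] qRe_mult_commute[of z "qcnj z"] K_closed(8)[of z] by metis

lemma p_trace:
  assumes A: "bounded_linear A" "\<And>x y. A x \<bullet> y = x \<bullet> A y" "\<And>x. A (\<Phi> x) = - \<Phi> (A x)"
    and M: "onset M" "finite M" "span M = E0"
  shows "op_trace (adjoint A \<circ> A) = 2 * (\<Sum>u\<in>M. (norm (A u))\<^sup>2)"
    and "\<exists>S. orthonormal_basis S \<and> (\<lambda>e. (norm (A e))\<^sup>2) summable_on S"
proof -
  note lin = bounded_linear.linear[OF A(1)]
  have d1: "A x \<bullet> y = 0" if "x \<in> span M" "y \<in> span M" for x y
    using p_E0(1)[of A x, OF A(3)] that M(3) orth_iff_real[OF E0_subspace] by (metis inner_commute)
  have d2: "A x \<in> span M" if *: "\<And>y. y \<in> M \<Longrightarrow> y \<bullet> x = 0" for x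
  proof -
    have "span M \<subseteq> {y. y \<bullet> x = 0}"
      by (rule span_minimal) (auto simp: subspace_def inner_simps *)
    then have "x \<in> orth E0" using M(3) by (auto simp: orth_iff_real[OF E0_subspace])
    then show ?thesis using p_E0(2)[of A x, OF A(3)] A(1) M(3) by simp
  qed
  have ex: "\<exists>S::'h set. orthonormal_basis S" by (rule orthonormal_basis_exists[OF separable])
  show "op_trace (adjoint A \<circ> A) = 2 * (\<Sum>u\<in>M. (norm (A u))\<^sup>2)"
    by (rule off_diagonal_op_trace[OF lin A(2) M(1,2) d1 d2 ex])
  from ex obtain S :: "'h set" where S: "orthonormal_basis S" ..
  from off_diagonal_has_sum[OF lin A(2) M(1,2) d1 d2 S]
  have "(\<lambda>e. (norm (A e))\<^sup>2) summable_on S" by (rule has_sum_imp_summable)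
  with S show "\<exists>S. orthonormal_basis S \<and> (\<lambda>e. (norm (A e))\<^sup>2) summable_on S" by blast
qed

lemma b_on_pullback:
  assumes g: "g \<in> O_group" and h: "h \<in> O_group" "\<And>x. g (h x) = x" "\<And>x. h (g x) = x" and E: "g ` E0 = E"
    and T: "b_on T" "T \<subseteq> E"
  shows "onset (h ` T)" "h ` T \<subseteq> E0" "inj h"
proof -
  show sub: "h ` T \<subseteq> E0" using T(2) E h(3) by auto
  show inj: "inj h" using h(2) by (metis injI)
  show "onset (h ` T)"
    unfolding onset_def
  proof safe
    fix u v assume uv: "u \<in> T" "v \<in> T"
    then have "h u \<bullet> h v = b (h u) (h v)" using sub b_pos_E0 by (metis image_subset_iff)
    also have "\<dots> = b u v" by (rule O_groupD(4)[OF h(1)])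
    finally show "h u \<bullet> h v = (if h u = h v then 1 else 0)"
      using T(1) uv inj by (auto simp: b_on_def inj_def)
  qed
qed

text \<open>In terms of a tangent vector \<open>V\<close>, viewed as an operator, the squared Riemannian norm is
  \<open>- Trace (V \<circ> V)\<close>, which visibly does not depend on the choice of \<open>g\<close>.\<close>

lemma riem_norm_eq:
  assumes EX: "E \<in> X" and V: "tangent E V" and T: "b_on T" "finite T" "T \<subseteq> E" "E \<subseteq> span T"
  shows "riem_norm E V = sqrt (2 * (\<Sum>u\<in>T. - b (V u) (V u)))"
  unfolding riem_norm_def
proof (rule the_equality)
  let ?r = "sqrt (2 * (\<Sum>u\<in>T. - b (V u) (V u)))"
  \<comment> \<open>Every admissible pair \<open>g\<close>, \<open>A\<close> gives the same value,
    which is the uniqueness half of the definite description.\<close>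
  have *: "sqrt (op_trace (adjoint A \<circ> A)) = ?r"
    if g: "g \<in> O_group" and A: "A \<in> \<pp>" and E: "g ` E0 = E"
      and D: "((\<lambda>s. B_proj (g ` exp_op A s ` E0)) has_vector_derivative V) (at 0)" for g A
  proof -
    obtain h where h: "h \<in> O_group" "\<And>x. g (h x) = x" "\<And>x. h (g x) = x"
      using O_group_inverse[OF g] by blast
    note P = pD[OF A]
    note pb = b_on_pullback[OF g h E T(1,3)]
    have linh: "linear h" by (rule bounded_linear.linear[OF O_groupD(1)[OF h(1)]])
    have "V = Blinfun (\<lambda>x. g (A (\<Phi> (h x))))"
      using vector_derivative_unique_at[OF D B_proj_exp_derivative[OF A g h]] .
    moreover have bl: "bounded_linear (\<lambda>x. g (A (\<Phi> (h x))))"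
      by (rule bounded_linear_compose[OF O_groupD(1)[OF g] bounded_linear_compose[OF P(1)
            bounded_linear_compose[OF bounded_linear_\<Phi> O_groupD(1)[OF h(1)]]]])
    ultimately have Vx: "V x = g (A (\<Phi> (h x)))" for x
      by (simp add: bounded_linear_Blinfun_apply)
    have span: "span (h ` T) = E0"
    proof
      show "span (h ` T) \<subseteq> E0" by (rule span_minimal[OF pb(2) subspace_is_subspace[OF E0_subspace]])
      have "E0 = h ` E" using E h(3) by (auto simp: image_iff)
      also have "\<dots> \<subseteq> h ` span T" using T(4) by blast
      also have "\<dots> = span (h ` T)" using linh by (simp add: linear_span_image)
      finally show "E0 \<subseteq> span (h ` T)" .
    qed
    have "op_trace (adjoint A \<circ> A) = 2 * (\<Sum>u\<in>h ` T. (norm (A u))\<^sup>2)"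
      by (rule p_trace(1)[OF P(1,3,4) pb(1) _ span]) (use T in auto)
    also have "(\<Sum>u\<in>h ` T. (norm (A u))\<^sup>2) = (\<Sum>u\<in>T. (norm (A (h u)))\<^sup>2)"
      using pb(3) by (subst sum.reindex) (auto intro: inj_on_subset)
    also have "\<dots> = (\<Sum>u\<in>T. - b (V u) (V u))"
    proof (intro sum.cong refl)
      fix u assume u: "u \<in> T"
      have hu: "h u \<in> E0" using u pb(2) by auto
      then have "\<Phi> (h u) = h u" by (simp add: \<Phi>_fixed_iff)
      then have "b (V u) (V u) = b (A (h u)) (A (h u))"
        by (simp add: Vx O_groupD(4)[OF g])
      also have "\<dots> = - (norm (A (h u)))\<^sup>2"
        using b_neg_orth[OF p_E0(1)[of A "h u", OF P(4) hu]] by (simp add: power2_norm_eq_inner)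
      finally show "(norm (A (h u)))\<^sup>2 = - b (V u) (V u)" by simp
    qed
    finally show ?thesis by (simp only:)
  qed
  show "r = ?r" if "\<exists>g\<in>O_group. \<exists>A\<in>\<pp>. g ` E0 = E \<and>
     ((\<lambda>s. B_proj (g ` exp_op A s ` E0)) has_vector_derivative V) (at 0) \<and>
     r = sqrt (op_trace (adjoint A \<circ> A))" for r
    using that * by blast
  obtain g h where g: "g \<in> O_group" and h: "h \<in> O_group" "\<And>x. g (h x) = x" "\<And>x. h (g x) = x"
    and E: "g ` E0 = E" and P: "\<And>x. B_proj E x = g (p0 (h x))"
    using X_cases[OF EX] by blast
  have VK: "V (x \<odot> a) = V x \<odot> a" if "a \<in> K" for x a
    using V that unfolding tangent_def by blast
  have Vb: "b (V x) y = b x (V y)" for x y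
    using V unfolding tangent_def by blast
  have VP: "V x = V (g (p0 (h x))) + g (p0 (h (V x)))" for x
    using V unfolding tangent_def P by blast
  define W where "W x = h (V (g x))" for x
  have blW: "bounded_linear W" unfolding W_def[abs_def]
    by (rule bounded_linear_compose[OF O_groupD(1)[OF h(1)]
          bounded_linear_compose[OF blinfun.bounded_linear_right O_groupD(1)[OF g]]])
  note linW = bounded_linear.linear[OF blW]
  have linh: "linear h" by (rule bounded_linear.linear[OF O_groupD(1)[OF h(1)]])
  \<comment> \<open>Conjugated to \<open>E0\<close>, the derivative of idempotence reads
    \<open>W = W p0 + p0 W\<close>, and for \<open>p0\<close> equal to half of
    \<open>1 + \<Phi>\<close> this says that \<open>W\<close> and \<open>\<Phi>\<close>
    anticommute.\<close>
  have W\<Phi>: "W (\<Phi> x) = - \<Phi> (W x)" for x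
  proof -
    have "W x = h (V (g (p0 (h (g x)))) + g (p0 (h (V (g x)))))"
      unfolding W_def by (subst VP) simp
    then have "W x = W (p0 x) + p0 (W x)" by (simp add: W_def linear_add[OF linh] h)
    also have "\<dots> = W x + (1/2) *\<^sub>R (W (\<Phi> x) + \<Phi> (W x))"
    proof -
      have half: "W x = (1/2) *\<^sub>R W x + (1/2) *\<^sub>R W x" by (metis scaleR_half_double scaleR_add_right)
      show ?thesis unfolding p0_def linear_scale[OF linW] linear_add[OF linW] scaleR_add_right
        by (subst (3) half) (simp only: add_ac)
    qed
    finally have "(1/2) *\<^sub>R (W (\<Phi> x) + \<Phi> (W x)) = 0" by simp
    then show ?thesis by (simp add: eq_neg_iff_add_eq_0)
  qed
  \<comment> \<open>The velocity produced by \<open>A\<close> is the conjugate of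
    \<open>A \<Phi>\<close>. As \<open>\<Phi>\<close> is an involution, matching it with
    \<open>V\<close> leaves \<open>A = W \<Phi>\<close> as the only candidate.\<close>
  define A where "A x = W (\<Phi> x)" for x
  have blA: "bounded_linear A" unfolding A_def[abs_def] by (rule bounded_linear_compose[OF blW bounded_linear_\<Phi>])
  have AK: "K_linear A"
    unfolding K_linear_def A_def W_def
    by (simp add: \<Phi>_add \<Phi>_rscale K_linearD[OF O_groupD(2)[OF g]] K_linearD[OF O_groupD(2)[OF h(1)]]
        VK blinfun.add_right)
  have Wb: "b (W x) y = b x (W y)" for x y
    unfolding W_def using O_groupD(4)[OF g] h(2) Vb by metis
  have Asa: "A x \<bullet> y = x \<bullet> A y" for x y
  proof -
    have "A x \<bullet> y = b (W (\<Phi> x)) (\<Phi> y)" by (simp add: A_def b_def)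
    also have "\<dots> = b (\<Phi> x) (A y)" by (simp add: Wb A_def)
    also have "\<dots> = x \<bullet> A y" by (simp add: b_def \<Phi>_inner)
    finally show ?thesis .
  qed
  have A\<Phi>: "A (\<Phi> x) = - \<Phi> (A x)" for x by (simp add: A_def W\<Phi> \<Phi>_minus)
  have "form (A x) y = form x (A y)" for x y
  proof -
    have "form (A x) y - form x (A y) = 0"
    proof (rule quat_zeroI)
      show "form (A x) y - form x (A y) \<in> K" by (simp add: form_in_K K_closed(5))
      fix a assume a: "a \<in> K"
      have "form (A x) (y \<odot> a) = form (A x) y * a" "form x (A (y \<odot> a)) = form x (A y) * a"
        using a by (simp_all add: hermitianD(4)[OF hermitian_form] K_linearD(2)[OF AK])
      then show "qRe ((form (A x) y - form x (A y)) * a) = 0"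
        using Asa[of x "y \<odot> a"] by (simp add: left_diff_distrib flip: Re_form)
    qed
    then show ?thesis by simp
  qed
  moreover obtain M where M: "onset M" "finite M" "span M = E0" by (rule E0_real_basis)
  moreover note p_trace(2)[OF blA Asa A\<Phi> M]
  ultimately have Ap: "A \<in> \<pp>"
    using AK blA A\<Phi> by (simp add: \<pp>_def is_adjoint_def hilbert_schmidt_def)
  have "V = Blinfun (\<lambda>x. g (A (\<Phi> (h x))))"
    by (simp add: A_def W_def h blinfun_apply_inverse)
  then have D: "((\<lambda>s. B_proj (g ` exp_op A s ` E0)) has_vector_derivative V) (at 0)"
    using B_proj_exp_derivative[OF Ap g h] by simp
  then show "\<exists>g\<in>O_group. \<exists>A\<in>\<pp>. g ` E0 = E \<and>
     ((\<lambda>s. B_proj (g ` exp_op A s ` E0)) has_vector_derivative V) (at 0) \<and>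
     ?r = sqrt (op_trace (adjoint A \<circ> A))"
    by (intro bexI[OF _ g] bexI[OF _ Ap] conjI E D *[OF g Ap E D, symmetric])
qed

text \<open>In \<open>V = V P + P V\<close>, applied to a vector of \<open>E\<close>, the first
  summand is already the whole left side. Hence \<open>- b\<close> is nonnegative on the image of
  \<open>E\<close> under \<open>V\<close>.\<close>

lemma tangent_normal:
  assumes "E \<in> X" "tangent E V" "u \<in> E"
  shows "B_proj E (V u) = 0"
proof -
  have "V u = V u + B_proj E (V u)"
    using assms(2) B_proj_props(2)[OF assms(1,3)] unfolding tangent_def by metis
  then show ?thesis by simp
qed

text \<open>The vectors that complete \<open>T\<close> to a frame only add nonnegative terms. The
  isotropic flag in general gives such a partial system, shorter than a frame when some angles
  vanish.\<close>

lemma riem_norm_ge: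
  assumes EX: "E \<in> X" and V: "tangent E V" and T: "b_on T" "finite T" "T \<subseteq> E"
  shows "sqrt (2 * (\<Sum>u\<in>T. - b (V u) (V u))) \<le> riem_norm E V"
proof -
  obtain g h where g: "g \<in> O_group" and h: "h \<in> O_group" "\<And>x. g (h x) = x" "\<And>x. h (g x) = x"
    and E: "g ` E0 = E" and "\<And>x. B_proj E x = g (p0 (h x))"
    using X_cases[OF EX] by blast
  note pb = b_on_pullback[OF g h E T(1,3)]
  obtain M where M: "onset M" "finite M" "span M = E0" by (rule E0_real_basis)
  obtain S where S: "onset S" "finite S" "h ` T \<subseteq> S" "M \<subseteq> span S" "S \<subseteq> span (h ` T \<union> M)"
    using onset_extend[OF pb(1) _ M(2)] T(2) by blast
  have "span (h ` T \<union> M) \<subseteq> E0"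
    using pb(2) M(3) span_superset by (intro span_minimal subspace_is_subspace E0_subspace) blast
  then have SE: "S \<subseteq> E0" using S(5) by blast
  have "E0 \<subseteq> span S" using M(3) S(4) by (metis span_minimal subspace_span)
  have gS: "b_on (g ` S)"
    unfolding b_on_def
  proof safe
    fix u v assume uv: "u \<in> S" "v \<in> S"
    have "b (g u) (g v) = u \<bullet> v" using uv SE b_pos_E0 O_groupD(4)[OF g] by auto
    moreover have "g u = g v \<longleftrightarrow> u = v" using h(3) by metis
    ultimately show "b (g u) (g v) = (if g u = g v then 1 else 0)" using S(1) uv by (simp add: onset_def)
  qed
  have sub: "g ` S \<subseteq> E" using SE E by blast
  have "E = g ` E0" using E by simp
  also have "\<dots> \<subseteq> g ` span S" using \<open>E0 \<subseteq> span S\<close> by blast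
  also have "\<dots> = span (g ` S)" using bounded_linear.linear[OF O_groupD(1)[OF g]] by (simp add: linear_span_image)
  finally have eq: "riem_norm E V = sqrt (2 * (\<Sum>u\<in>g ` S. - b (V u) (V u)))"
    using S(2) by (intro riem_norm_eq[OF EX V gS _ sub]) auto
  have "T = g ` h ` T" using h(2) by (auto simp: image_iff)
  then have "T \<subseteq> g ` S" using S(3) by blast
  then have "(\<Sum>u\<in>T. - b (V u) (V u))
      \<le> (\<Sum>u\<in>g ` S. - b (V u) (V u))"
    using S(2) sub B_orth_negative(1)[OF EX tangent_normal[OF EX V]]
    by (intro sum_mono2) auto
  then show ?thesis unfolding eq by simp
qed

end

section \<open>Principal angles\<close>

context hyperbolic_grassmannian
begin


lemma K_span_in_X:
  assumes f: "K_on B f p"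
  shows "K_span f p \<in> X"
proof -
  note D = hermitianD[OF hermitian_B]
  have "qRe (Q x) > 0" if x: "x \<in> K_span f p" "x \<noteq> 0" for x
  proof -
    note e = K_onb_K_span[OF hermitian_B f]
    define c where "c i = B (f i) x" for i
    have ex: "x = (\<Sum>i<p. f i \<odot> c i)" unfolding c_def by (rule K_onbD(3)[OF e x(1)])
    have "B x x = (\<Sum>i<p. B x (f i \<odot> c i))" by (subst (2) ex) (rule D(14))
    also have "\<dots> = (\<Sum>i<p. qcnj (c i) * c i)"
    proof (intro sum.cong refl)
      fix i
      have "B x (f i \<odot> c i) = B x (f i) * c i" unfolding c_def by (rule D(4)[OF D(1)])
      then show "B x (f i \<odot> c i) = qcnj (c i) * c i"
        using hermitian_cnj[OF hermitian_B, of x "f i"] by (simp only: c_def)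
    qed
    finally have "qRe (Q x) = (\<Sum>i<p. (qnorm (c i))\<^sup>2)"
      by (simp add: Q_def qRe_sum qcnj_mult_self del: of_real_power)
    moreover have "\<exists>i<p. c i \<noteq> 0"
    proof (rule ccontr)
      assume "\<not> (\<exists>i<p. c i \<noteq> 0)"
      then have "x = 0" by (subst ex) simp
      then show False using x(2) by simp
    qed
    ultimately show ?thesis by (auto intro!: sum_pos2)
  qed
  then show ?thesis
    using is_subspace_K_span has_dimension_K_span[OF hermitian_B f] by (simp add: X_def)
qed

lemma b_on_independent:
  assumes "b_on S" "finite S"
  shows "independent S"
proof (rule independent_if_scalars_zero[OF assms(2)])
  fix c u assume z: "(\<Sum>v\<in>S. c v *\<^sub>R v) = 0" and u: "u \<in> S"
  have "0 = b u (\<Sum>v\<in>S. c v *\<^sub>R v)" by (simp add: z b_simps)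
  also have "\<dots> = (\<Sum>v\<in>S. if u = v then c v else 0)"
    unfolding b_sum using assms(1) u by (intro sum.cong) (auto simp: b_simps b_on_def)
  finally show "c u = 0" using assms(2) u by simp
qed

text \<open>A dimension count over the reals: a nonzero residual, once normalised, would give one
  independent vector more than a real frame of \<open>E\<close> contains.\<close>

lemma K_on_complete:
  assumes E: "E \<in> X" and f: "K_on B f p" and fE: "\<And>i. i < p \<Longrightarrow> f i \<in> E"
  shows "K_onb B f p E"
proof -
  note D = hermitianD[OF hermitian_B]
  obtain e where e: "K_onb B e p E" using X_basis[OF E] .
  obtain U where U: "K_real_basis U" by (rule K_real_basis_exists)
  note re = real_frame[OF hermitian_B e is_subspace_X[OF E] U]
  note fs = K_onb_K_span[OF hermitian_B f]
  note rf = real_frame[OF hermitian_B fs is_subspace_K_span U]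
  have card: "card (real_frame U f p) = card (real_frame U e p)"
    using card_image[OF rf(5)] card_image[OF re(5)] by (simp add: real_frame_def)
  have "x = (\<Sum>i<p. f i \<odot> B (f i) x)" if x: "x \<in> E" for x
  proof (rule ccontr)
    define w where "w = x - (\<Sum>i<p. f i \<odot> B (f i) x)"
    assume "x \<noteq> (\<Sum>i<p. f i \<odot> B (f i) x)"
    then have w0: "w \<noteq> 0" by (simp add: w_def)
    have wE: "w \<in> E" unfolding w_def
      by (intro is_subspaceD(3)[OF is_subspace_X[OF E] x] is_subspaceD(7)[OF is_subspace_X[OF E]]
          is_subspaceD(4)[OF is_subspace_X[OF E]] fE D(1)) simp
    then have wpos: "b w w > 0" using b_pos_X[OF E] w0 by blast
    have fw: "B (f k) w = 0" if "k < p" for k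
      using K_on_expand_component[OF hermitian_B f that, of "\<lambda>i. B (f i) x"] D(1) by (simp add: w_def D(10))
    define v where "v = (1 / sqrt (b w w)) *\<^sub>R w"
    have vv: "b v v = 1" using wpos by (simp add: v_def b_simps)
    have uv: "b u v = 0" if u: "u \<in> real_frame U f p" for u
    proof -
      from u obtain i a where ia: "u = f i \<odot> a" "i < p" "a \<in> U" by (auto simp: real_frame_def)
      then have "B u w = 0" using fw[of i] K_real_basisD(4)[OF U] by (simp add: D(5))
      then have "b u w = 0" by (simp flip: qRe_B)
      then show ?thesis by (simp add: v_def b_simps)
    qed
    have vn: "v \<notin> real_frame U f p" using uv[of v] vv by auto
    have "b_on (insert v (real_frame U f p))"
    proof -
      have vu: "b v u = 0" if "u \<in> real_frame U f p" for u
        using uv[OF that] by (simp only: b_commute[of v u])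
      have uu: "b u t = (if u = t then 1 else 0)" if "u \<in> real_frame U f p" "t \<in> real_frame U f p" for u t
        using rf(4)[OF that] by (simp only: qRe_B)
      show ?thesis
        unfolding b_on_def ball_simps using uv vu uu vv vn by auto
    qed
    then have ind: "independent (insert v (real_frame U f p))" using rf(1) by (intro b_on_independent) auto
    have "real_frame U f p \<subseteq> E"
      using fE K_real_basisD(4)[OF U] is_subspaceD(4)[OF is_subspace_X[OF E]] by (auto simp: real_frame_def)
    moreover have "v \<in> E" unfolding v_def using wE is_subspaceD(5)[OF is_subspace_X[OF E]] by blast
    ultimately have "insert v (real_frame U f p) \<subseteq> span (real_frame U e p)" using re(3) by blast
    then have "card (insert v (real_frame U f p)) \<le> card (real_frame U e p)"
      using independent_span_bound[OF re(1) ind] by blast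
    then show False using vn rf(1) card by simp
  qed
  then show ?thesis using f fE unfolding K_onb_def by blast
qed

text \<open>Makes the set in the definition of the \<open>c\<^sub>i\<close> bounded above, without
  which its \<open>Sup\<close> would say nothing about its members. The unit sphere of
  \<open>E\<close> is the image of a genuine unit sphere of \<open>E0\<close> under a bounded
  operator.\<close>

lemma X_unit_bounded:
  assumes "E \<in> X"
  obtains C where "\<And>u. u \<in> E \<Longrightarrow> b u u = 1 \<Longrightarrow> norm u \<le> C"
proof -
  obtain g where g: "g \<in> O_group" "g ` E0 = E" using transitive[OF assms] .
  obtain k where k: "\<And>x. norm (g x) \<le> norm x * k"
    using bounded_linear.bounded[OF O_groupD(1)[OF g(1)]] by blast
  have "norm u \<le> k" if u: "u \<in> E" "b u u = 1" for u
  proof -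
    from u(1) g(2) obtain u0 where u0: "u0 \<in> E0" "u = g u0" by auto
    then have "u0 \<bullet> u0 = 1" using u(2) O_groupD(4)[OF g(1)] b_pos_E0 by simp
    then have "norm u0 = 1" by (simp add: norm_eq_sqrt_inner)
    then show ?thesis using k[of u0] u0 by simp
  qed
  then show thesis by (rule that)
qed

text \<open>The right side exceeds \<open>c\<close> only to second order in \<open>s\<close>, while
  the left side is linear in \<open>s\<close>; hence the slope vanishes.\<close>

lemma first_order_optimality:
  fixes c q t :: real
  assumes "c \<ge> 0" "q \<ge> 0" and le: "\<And>s. c + s * t \<le> c * sqrt (1 + s\<^sup>2 * q)"
  shows "t = 0"
proof -
  define k where "k = c * q / 2"
  have k: "k \<ge> 0" using assms by (simp add: k_def)
  have 1: "s * t \<le> k * s\<^sup>2" for s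
  proof -
    have "1 + s\<^sup>2 * q \<le> (1 + s\<^sup>2 * q / 2)\<^sup>2"
    proof -
      have "(1 + a / 2)\<^sup>2 = 1 + a + (a / 2)\<^sup>2" for a :: real
        by (simp add: power2_eq_square algebra_simps)
      then show ?thesis by simp
    qed
    then have "sqrt (1 + s\<^sup>2 * q) \<le> 1 + s\<^sup>2 * q / 2"
      using assms by (intro real_le_lsqrt) auto
    then have "c * sqrt (1 + s\<^sup>2 * q) \<le> c * (1 + s\<^sup>2 * q / 2)" using assms by (intro mult_left_mono)
    then show ?thesis using le[of s] by (simp add: k_def algebra_simps)
  qed
  \<comment> \<open>The choice \<open>s = t / (k + 1)\<close> has a positive denominator even for
    \<open>k = 0\<close>.\<close>
  have "t / (k + 1) * t * (k + 1)\<^sup>2 \<le> k * (t / (k + 1))\<^sup>2 * (k + 1)\<^sup>2"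
    using 1[of "t / (k + 1)"] by (intro mult_right_mono) auto
  moreover have "t / (k + 1) * t * (k + 1)\<^sup>2 = t\<^sup>2 * (k + 1)" "k * (t / (k + 1))\<^sup>2 * (k + 1)\<^sup>2 = k * t\<^sup>2"
  proof -
    have "t / m * t * m\<^sup>2 = t\<^sup>2 * m" "k * (t / m)\<^sup>2 * m\<^sup>2 = k * t\<^sup>2" if "m \<noteq> 0" for m
      using that by (simp_all add: power2_eq_square)
    then show "t / (k + 1) * t * (k + 1)\<^sup>2 = t\<^sup>2 * (k + 1)" "k * (t / (k + 1))\<^sup>2 * (k + 1)\<^sup>2 = k * t\<^sup>2"
      using k by auto
  qed
  ultimately have "t\<^sup>2 * (k + 1) \<le> k * t\<^sup>2" by (simp only:)
  then have "t\<^sup>2 \<le> 0" by (simp add: algebra_simps)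
  then show ?thesis by simp
qed

text \<open>First variation of the maximum in the directions \<open>u \<odot> a\<close>, all of
  which are \<open>b\<close>-orthogonal to \<open>x\<close>. Stating the maximality with the factor
  \<open>sqrt (b u u)\<close> spares a normalisation of the varied vector.\<close>

lemma maximal_pair_orthogonal:
  assumes S: "is_subspace S" and x: "x \<in> S" "b x x = 1" and "b x y = c" "c \<ge> 0"
    and max: "\<And>u. u \<in> S \<Longrightarrow> b u y \<le> c * sqrt (b u u)"
    and pos: "\<And>u. u \<in> S \<Longrightarrow> b u u \<ge> 0"
    and u: "u \<in> S" "B x u = 0"
  shows "B u y = 0"
  unfolding hermitian_zero_iff_left[OF hermitian_B] qRe_B
proof
  fix a assume a: "a \<in> K"
  have ua: "u \<odot> a \<in> S" using is_subspaceD(4)[OF S u(1) a] .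
  have xu: "b x (u \<odot> a) = 0" using u(2) a by (simp add: hermitianD(4)[OF hermitian_B] flip: qRe_B)
  show "b (u \<odot> a) y = 0"
  proof (rule first_order_optimality[OF assms(5) pos[OF ua]])
    fix s
    have "x + s *\<^sub>R (u \<odot> a) \<in> S" using x(1) ua is_subspaceD(2,5)[OF S] by blast
    from max[OF this] show "c + s * b (u \<odot> a) y \<le> c * sqrt (1 + s\<^sup>2 * b (u \<odot> a) (u \<odot> a))"
      using xu assms(4) x(2) by (simp add: b_simps b_commute[of "u \<odot> a" x] power2_eq_square mult.assoc)
  qed
qed

lemma B_orth_in_subspace: "is_subspace E \<Longrightarrow> is_subspace (B_orth_in E x l)"
  unfolding is_subspace_def B_orth_in_def
  by (auto simp: hermitianD(2,4,6)[OF hermitian_B])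

lemma Q_eq_1_iff: "Q x = 1 \<longleftrightarrow> b x x = 1"
proof -
  have "Q x = of_real (b x x)"
    unfolding Q_def by (subst hermitian_self[OF hermitian_B]) (simp add: qRe_B)
  then show ?thesis by simp
qed

lemma B_proj_zero:
  assumes E: "E \<in> X" and f: "K_onb B f p E" and z: "\<And>i. i < p \<Longrightarrow> B (f i) w = 0"
  shows "B_proj E w = 0"
proof (rule B_proj_eqI[OF E is_subspaceD(1)[OF is_subspace_X[OF E]]])
  note D = hermitianD[OF hermitian_B]
  fix v assume v: "v \<in> E"
  have "B v w = (\<Sum>j<p. qcnj (B (f j) v) * B (f j) w)"
    by (subst K_onbD(3)[OF f v]) (simp only: D(15) D(5)[OF D(1)])
  also have "\<dots> = 0" using z by simp
  finally show "b v (w - 0) = 0" by (simp flip: qRe_B)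
qed

lemma principal_angles_normal_form:
  assumes E: "E \<in> X" and F: "F \<in> X" and \<alpha>: "hyperbolic_principal_angles E F \<alpha>"
  obtains x z where "K_onb B x p E"
    "K_onb B (\<lambda>i. cosh (\<alpha> (Suc i)) *\<^sub>R x i + sinh (\<alpha> (Suc i)) *\<^sub>R z i) p F"
    "\<And>i j. i < p \<Longrightarrow> j < p \<Longrightarrow> B (x i) (z j) = 0"
    "\<And>i j. i < p \<Longrightarrow> j < p \<Longrightarrow> B (z i) (z j) = (if i = j \<and> \<alpha> (Suc i) \<noteq> 0 then - 1 else 0)"
proof -
  note D = hermitianD[OF hermitian_B]
  obtain x' y' c' where "\<forall>l<p.
        c' (Suc l) = Sup {qRe (B u v) |u v.
          u \<in> B_orth_in E x' l \<and> v \<in> B_orth_in F y' l \<and> Q u = 1 \<and> Q v = 1} \<and>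
        x' (Suc l) \<in> B_orth_in E x' l \<and> y' (Suc l) \<in> B_orth_in F y' l \<and>
        Q (x' (Suc l)) = 1 \<and> Q (y' (Suc l)) = 1 \<and>
        B (x' (Suc l)) (y' (Suc l)) = of_real (c' (Suc l)) \<and>
        \<alpha> (Suc l) = arcosh (c' (Suc l))"
    using \<alpha> unfolding hyperbolic_principal_angles_def by (elim exE)
  then have H: "c' (Suc l) = Sup {b u v |u v.
          u \<in> B_orth_in E x' l \<and> v \<in> B_orth_in F y' l \<and> b u u = 1 \<and> b v v = 1}"
        "x' (Suc l) \<in> B_orth_in E x' l" "y' (Suc l) \<in> B_orth_in F y' l"
        "Q (x' (Suc l)) = 1" "Q (y' (Suc l)) = 1"
        "B (x' (Suc l)) (y' (Suc l)) = of_real (c' (Suc l))"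
        "\<alpha> (Suc l) = arcosh (c' (Suc l))" if "l < p" for l
    using that unfolding qRe_B Q_eq_1_iff by (blast+)
  \<comment> \<open>The definition numbers its vectors from 1; from here on they are numbered from
    0.\<close>
  define x where "x i = x' (Suc i)" for i
  define y where "y i = y' (Suc i)" for i
  define c where "c i = c' (Suc i)" for i
  define EL where "EL l = B_orth_in E x' l" for l
  define FL where "FL l = B_orth_in F y' l" for l
  have EL_iff: "u \<in> EL l \<longleftrightarrow> u \<in> E \<and> (\<forall>j<l. B (x j) u = 0)" for u l
  proof -
    have "(\<forall>j\<in>{1..l}. B (x' j) u = 0) \<longleftrightarrow> (\<forall>j<l. B (x j) u = 0)"
      unfolding x_def image_Suc_lessThan[symmetric] by auto
    then show ?thesis by (simp add: EL_def B_orth_in_def)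
  qed
  have FL_iff: "u \<in> FL l \<longleftrightarrow> u \<in> F \<and> (\<forall>j<l. B (y j) u = 0)" for u l
  proof -
    have "(\<forall>j\<in>{1..l}. B (y' j) u = 0) \<longleftrightarrow> (\<forall>j<l. B (y j) u = 0)"
      unfolding y_def image_Suc_lessThan[symmetric] by auto
    then show ?thesis by (simp add: FL_def B_orth_in_def)
  qed
  have ELs: "is_subspace (EL l)" and FLs: "is_subspace (FL l)" for l
    unfolding EL_def FL_def using B_orth_in_subspace is_subspace_X E F by auto
  have xE: "x i \<in> EL i" and yF: "y i \<in> FL i" if "i < p" for i
    using H(2,3)[OF that] by (simp_all add: x_def y_def EL_def FL_def)
  have Bxx: "B (x i) (x i) = 1" and Byy: "B (y i) (y i) = 1" and Bxy: "B (x i) (y i) = of_real (c i)"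
    and \<alpha>c: "\<alpha> (Suc i) = arcosh (c i)" if "i < p" for i
    using H(4-7)[OF that] by (simp_all add: x_def y_def c_def Q_def)
  have bxx: "b (x i) (x i) = 1" and byy: "b (y i) (y i) = 1" and bxy: "b (x i) (y i) = c i" if "i < p" for i
    using Bxx[OF that] Byy[OF that] Bxy[OF that] by (simp_all flip: qRe_B)
  have max: "b u v \<le> c l * (sqrt (b u u) * sqrt (b v v))" if l: "l < p" and u: "u \<in> EL l" and v: "v \<in> FL l" for l u v
  proof (cases "u = 0 \<or> v = 0")
    case True
    then show ?thesis by (auto simp: b_simps)
  next
    case False
    let ?S = "{b u v |u v. u \<in> EL l \<and> v \<in> FL l \<and> b u u = 1 \<and> b v v = 1}"
    obtain C where C: "\<And>u. u \<in> E \<Longrightarrow> b u u = 1 \<Longrightarrow> norm u \<le> C" using X_unit_bounded[OF E] by blast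
    obtain C' where C': "\<And>u. u \<in> F \<Longrightarrow> b u u = 1 \<Longrightarrow> norm u \<le> C'" using X_unit_bounded[OF F] by blast
    have bdd: "bdd_above ?S"
    proof (rule bdd_aboveI, safe)
      fix u v assume *: "u \<in> EL l" "v \<in> FL l" "b u u = 1" "b v v = 1"
      have nu: "norm u \<le> C" using C[of u] * EL_iff by blast
      have nv: "norm v \<le> C'" using C'[of v] * FL_iff by blast
      have "b u v \<le> norm u * norm (\<Phi> v)" unfolding b_def by (rule norm_cauchy_schwarz)
      also have "\<dots> \<le> C * C'" unfolding norm_\<Phi> using nu nv
        by (intro mult_mono) (auto intro: order_trans[OF norm_ge_zero])
      finally show "b u v \<le> C * C'" .
    qed
    have up: "b u u > 0" using b_pos_X[OF E] u False EL_iff by blast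
    have vp: "b v v > 0" using b_pos_X[OF F] v False FL_iff by blast
    define u1 where "u1 = (1 / sqrt (b u u)) *\<^sub>R u"
    define v1 where "v1 = (1 / sqrt (b v v)) *\<^sub>R v"
    have "u1 \<in> EL l" "v1 \<in> FL l" unfolding u1_def v1_def
      using u v is_subspaceD(5)[OF ELs] is_subspaceD(5)[OF FLs] by auto
    moreover have "b u1 u1 = 1" "b v1 v1 = 1" using up vp by (simp_all add: u1_def v1_def b_simps)
    ultimately have "b u1 v1 \<in> ?S" by blast
    then have "b u1 v1 \<le> Sup ?S" using bdd by (rule cSup_upper)
    also have "\<dots> = c l" using H(1)[OF l] by (simp add: c_def EL_def FL_def)
    finally have "b u v / (sqrt (b u u) * sqrt (b v v)) \<le> c l" by (simp add: u1_def v1_def b_simps mult.commute)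
    then show ?thesis using up vp by (simp add: pos_divide_le_eq)
  qed
  \<comment> \<open>With \<open>x i\<close> also \<open>- x i\<close> competes for the supremum, so
    \<open>- c i \<le> c i\<close>.\<close>
  have c0: "c i \<ge> 0" if i: "i < p" for i
  proof -
    have "b (- x i) (y i) \<le> c i * (sqrt (b (- x i) (- x i)) * sqrt (b (y i) (y i)))"
      by (rule max[OF i is_subspaceD(6)[OF ELs xE[OF i]] yF[OF i]])
    then show ?thesis using bxx[OF i] byy[OF i] bxy[OF i] by (simp add: b_simps)
  qed
  have posE: "b u u \<ge> 0" if "u \<in> EL l" for u l
    using that EL_iff b_pos_X[OF E, of u] by (cases "u = 0") (auto simp: b_simps intro: less_imp_le)
  have posF: "b u u \<ge> 0" if "u \<in> FL l" for u l
    using that FL_iff b_pos_X[OF F, of u] by (cases "u = 0") (auto simp: b_simps intro: less_imp_le)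
  \<comment> \<open>For \<open>l < i\<close> the vector \<open>x i\<close> still lies in
    \<open>EL l\<close> and is orthogonal to \<open>x l\<close>, so it is an admissible variation of
    the maximal pair at stage \<open>l\<close>. The fact \<open>down\<close> exchanges the two
    subspaces.\<close>
  have up: "B (x i) (y l) = 0" if "l < i" "i < p" for i l
  proof (rule maximal_pair_orthogonal[OF ELs xE bxx bxy c0 _ posE])
    have l: "l < p" using that by simp
    show "b u (y l) \<le> c l * sqrt (b u u)" if "u \<in> EL l" for u
      using max[OF l that yF[OF l]] byy[OF l] by simp
    show "x i \<in> EL l" "B (x l) (x i) = 0" using xE[OF that(2)] that(1) unfolding EL_iff by auto
  qed (use that in auto)
  have down: "B (y i) (x l) = 0" if "l < i" "i < p" for i l
  proof (rule maximal_pair_orthogonal[OF FLs yF byy _ c0 _ posF])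
    have l: "l < p" using that by simp
    show "b u (x l) \<le> c l * sqrt (b u u)" if "u \<in> FL l" for u
      using max[OF l xE[OF l] that] bxx[OF l] b_commute[of u "x l"] by simp
    show "y i \<in> FL l" "B (y l) (y i) = 0" using yF[OF that(2)] that(1) unfolding FL_iff by auto
    show "b (y l) (x l) = c l" using bxy[OF l] b_commute[of "x l"] by simp
  qed (use that in auto)
  have xx: "B (x i) (x j) = (if i = j then 1 else 0)" if ij: "i < p" "j < p" for i j
  proof (cases i j rule: linorder_cases)
    case less
    then show ?thesis using xE[OF ij(2)] by (simp add: EL_iff)
  next
    case greater
    then have "B (x j) (x i) = 0" using xE[OF ij(1)] by (simp add: EL_iff)
    then show ?thesis using greater hermitian_cnj[OF hermitian_B, of "x i" "x j"] by simp
  qed (use Bxx ij in simp)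
  have yy: "B (y i) (y j) = (if i = j then 1 else 0)" if ij: "i < p" "j < p" for i j
  proof (cases i j rule: linorder_cases)
    case less
    then show ?thesis using yF[OF ij(2)] by (simp add: FL_iff)
  next
    case greater
    then have "B (y j) (y i) = 0" using yF[OF ij(1)] by (simp add: FL_iff)
    then show ?thesis using greater hermitian_cnj[OF hermitian_B, of "y i" "y j"] by simp
  qed (use Byy ij in simp)
  have xy: "B (x i) (y j) = (if i = j then of_real (c i) else 0)" if ij: "i < p" "j < p" for i j
  proof (cases i j rule: linorder_cases)
    case less
    then show ?thesis using down[of i j] ij hermitian_cnj[OF hermitian_B, of "x i" "y j"] by simp
  qed (use up Bxy ij in auto)
  have yx: "B (y j) (x i) = (if i = j then of_real (c i) else 0)" if ij: "i < p" "j < p" for i j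
    using xy[OF ij] hermitian_cnj[OF hermitian_B, of "y j" "x i"] by simp
  have onx: "K_onb B x p E"
    by (rule K_on_complete[OF E]) (use xx xE EL_iff in \<open>auto simp: K_on_def\<close>)
  have ony: "K_onb B y p F"
    by (rule K_on_complete[OF F]) (use yy yF FL_iff in \<open>auto simp: K_on_def\<close>)
  \<comment> \<open>By the diagonal shape of \<open>B (x i) (y j)\<close>, this is the component of
    \<open>y i\<close> that is \<open>B\<close>-orthogonal to \<open>E\<close>.\<close>
  define w where "w i = y i - c i *\<^sub>R x i" for i
  have xw: "B (x i) (w j) = 0" if "i < p" "j < p" for i j
    using xx[OF that] xy[OF that] by (auto simp: w_def D(10,12) of_real_def)
  have ww: "B (w i) (w j) = (if i = j then of_real (1 - (c i)\<^sup>2) else 0)" if ij: "i < p" "j < p" for i j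
  proof -
    have "B (w i) (w j) = B (y i) (w j)" using xw[OF ij] by (subst (1) w_def) (simp add: D(11,13))
    also have "\<dots> = B (y i) (y j) - c j *\<^sub>R B (y i) (x j)" by (simp add: w_def D(10,12))
    also have "\<dots> = (if i = j then of_real (1 - (c i)\<^sup>2) else 0)"
      using yy[OF ij] yx[OF ij(2,1)] by (auto simp: of_real_def power2_eq_square scaleR_diff_left)
    finally show ?thesis .
  qed
  have bww: "b (w i) (w i) = 1 - (c i)\<^sup>2" if "i < p" for i
    using ww[OF that that] qRe_B[of "w i" "w i"] by (simp del: of_real_diff of_real_power)
  have Pw: "B_proj E (w i) = 0" if i: "i < p" for i
    by (rule B_proj_zero[OF E onx xw[OF _ i]])
  \<comment> \<open>\<open>w i\<close> lies in the negative definite complement of \<open>E\<close>,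
    so \<open>1 - (c i)\<^sup>2 \<le> 0\<close>. This is what makes \<open>arcosh\<close> an inverse
    of \<open>cosh\<close> here.\<close>
  have c1: "c i \<ge> 1" if i: "i < p" for i
  proof -
    have "1 \<le> (c i)\<^sup>2" using B_orth_negative(1)[OF E Pw[OF i]] bww[OF i] by simp
    then show ?thesis using c0[OF i] power2_le_imp_le[of 1 "c i"] by simp
  qed
  have cosh: "cosh (\<alpha> (Suc i)) = c i" if "i < p" for i
    using c1[OF that] \<alpha>c[OF that] by (simp add: cosh_arcosh_real)
  have sinh: "(sinh (\<alpha> (Suc i)))\<^sup>2 = (c i)\<^sup>2 - 1" if "i < p" for i
    using cosh_square_eq[of "\<alpha> (Suc i)"] cosh[OF that] by simp
  have w0: "w i = 0" if i: "i < p" "\<alpha> (Suc i) = 0" for i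
  proof -
    have "c i = 1" using cosh[OF i(1)] i(2) by simp
    then show ?thesis using B_orth_negative(2)[OF E Pw[OF i(1)]] bww[OF i(1)] by simp
  qed
  \<comment> \<open>For \<open>\<alpha> (Suc i) = 0\<close> the division by zero gives
    \<open>z i = 0\<close>, which is consistent because \<open>w i\<close> vanishes as well.\<close>
  define z where "z i = (1 / sinh (\<alpha> (Suc i))) *\<^sub>R w i" for i
  have y_eq: "cosh (\<alpha> (Suc i)) *\<^sub>R x i + sinh (\<alpha> (Suc i)) *\<^sub>R z i = y i" if i: "i < p" for i
    using w0[OF i] cosh[OF i] by (cases "\<alpha> (Suc i) = 0") (auto simp: z_def w_def)
  show thesis
  proof (rule that[of x z, OF onx])
    show "K_onb B (\<lambda>i. cosh (\<alpha> (Suc i)) *\<^sub>R x i + sinh (\<alpha> (Suc i)) *\<^sub>R z i) p F"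
      by (rule K_on_complete[OF F]) (use ony y_eq in \<open>simp_all add: K_on_def K_onbD(2,4)[OF ony]\<close>)
    show "B (x i) (z j) = 0" if "i < p" "j < p" for i j
      using xw[OF that] by (simp add: z_def D(12))
    show "B (z i) (z j) = (if i = j \<and> \<alpha> (Suc i) \<noteq> 0 then - 1 else 0)" if "i < p" "j < p" for i j
    proof (cases "i = j \<and> \<alpha> (Suc i) \<noteq> 0")
      case True
      then have "\<alpha> (Suc i) \<noteq> 0" by (elim conjE)
      then have s: "sinh (\<alpha> (Suc i)) \<noteq> 0" by simp
      have "B (z i) (z i) = (1 / (sinh (\<alpha> (Suc i)))\<^sup>2) *\<^sub>R B (w i) (w i)"
        by (simp add: z_def D(12,13) power2_eq_square)
      also have "\<dots> = (1 / (sinh (\<alpha> (Suc i)))\<^sup>2) *\<^sub>R of_real (- (sinh (\<alpha> (Suc i)))\<^sup>2)"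
        using ww[OF that(1,1)] sinh[OF that(1)] by (simp del: of_real_diff of_real_power of_real_minus)
      also have "\<dots> = - 1" using s by (simp add: of_real_def)
      finally have "B (z i) (z i) = - 1" .
      with True show ?thesis by (elim conjE) (simp only: simp_thms if_True)
    next
      case False
      then have "B (w i) (w j) = 0 \<or> z i = 0" using ww[OF that] by (auto simp: z_def)
      then show ?thesis using False by (auto simp: z_def D(7,12,13))
    qed
  qed
qed

end

section \<open>Gram--Schmidt for a moving inner product\<close>

text \<open>The process is left unnormalised: each \<open>gs \<beta> \<xi> i\<close> is
  \<open>\<xi> i\<close> plus a combination of earlier vectors, so that a change of
  \<open>\<beta>\<close> moves it only within the span of the earlier ones.\<close>

function gs :: "('a::real_vector \<Rightarrow> 'a \<Rightarrow> real) \<Rightarrow> (nat \<Rightarrow> 'a) \<Rightarrow> nat \<Rightarrow> 'a" where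
  "gs \<beta> \<xi> i = \<xi> i - (\<Sum>j\<in>{..<i}. (\<beta> (gs \<beta> \<xi> j) (\<xi> i) / \<beta> (gs \<beta> \<xi> j) (gs \<beta> \<xi> j)) *\<^sub>R gs \<beta> \<xi> j)"
  by auto
termination by (relation "Wellfounded.measure (\<lambda>(\<beta>, \<xi>, i). i)") auto

declare gs.simps [simp del]

lemma gs_in_span: "gs \<beta> \<xi> i \<in> span (\<xi> ` {..i})"
proof (induction i rule: less_induct)
  case (less i)
  have "gs \<beta> \<xi> j \<in> span (\<xi> ` {..i})" if "j < i" for j
    using less.IH[OF that] span_mono[of "\<xi> ` {..j}" "\<xi> ` {..i}"] that by fastforce
  then show ?case
    by (subst gs.simps) (intro span_diff span_sum span_scale; auto intro: span_base)
qed

lemma in_span_gs: "\<xi> i \<in> span (gs \<beta> \<xi> ` {..i})"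
proof -
  have "\<xi> i = gs \<beta> \<xi> i + (\<Sum>j\<in>{..<i}. (\<beta> (gs \<beta> \<xi> j) (\<xi> i) / \<beta> (gs \<beta> \<xi> j) (gs \<beta> \<xi> j)) *\<^sub>R gs \<beta> \<xi> j)"
    by (subst gs.simps) simp
  also have "\<dots> \<in> span (gs \<beta> \<xi> ` {..i})"
    by (intro span_add span_sum span_scale span_base) auto
  finally show ?thesis .
qed

text \<open>The forms to which this is applied vanish on the complement of a subspace, so
  definiteness is replaced by the condition that the lengths actually used as denominators are
  nonzero.\<close>

lemma gs_orthogonal:
  fixes \<beta> :: "'a::real_vector \<Rightarrow> 'a \<Rightarrow> real"
  assumes lin: "\<And>x. linear (\<beta> x)" and sym: "\<And>x y. \<beta> x y = \<beta> y x"
    and nz: "\<And>j. j < i \<Longrightarrow> \<beta> (gs \<beta> \<xi> j) (gs \<beta> \<xi> j) \<noteq> 0"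
  shows "k < i \<Longrightarrow> \<beta> (gs \<beta> \<xi> k) (gs \<beta> \<xi> i) = 0"
  using nz
proof (induction i arbitrary: k rule: less_induct)
  case (less i)
  let ?g = "gs \<beta> \<xi>"
  have orth: "\<beta> (?g k) (?g j) = 0" if "j < i" "j \<noteq> k" for j
  proof (cases "j < k")
    case True
    then show ?thesis using less.IH[OF less.prems(1), of j] less.prems sym[of "?g k"] by simp
  next
    case False
    then show ?thesis using less.IH[OF that(1), of k] less.prems that by simp
  qed
  have "\<beta> (?g k) (?g i) = \<beta> (?g k) (\<xi> i) - (\<Sum>j\<in>{..<i}. (\<beta> (?g j) (\<xi> i) / \<beta> (?g j) (?g j)) * \<beta> (?g k) (?g j))"
    by (subst gs.simps) (simp add: linear_diff[OF lin] linear_sum[OF lin] linear_scale[OF lin])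
  also have "(\<Sum>j\<in>{..<i}. (\<beta> (?g j) (\<xi> i) / \<beta> (?g j) (?g j)) * \<beta> (?g k) (?g j))
      = (\<Sum>j\<in>{..<i}. if j = k then \<beta> (?g k) (\<xi> i) else 0)"
    using orth less.prems by (intro sum.cong) auto
  also have "\<dots> = \<beta> (?g k) (\<xi> i)" using less.prems(1) by simp
  finally show ?case by simp
qed

lemma gs_orthogonal_span:
  fixes \<beta> :: "'a::real_vector \<Rightarrow> 'a \<Rightarrow> real"
  assumes lin: "\<And>x. linear (\<beta> x)" and sym: "\<And>x y. \<beta> x y = \<beta> y x"
    and nz: "\<And>j. j < i \<Longrightarrow> \<beta> (gs \<beta> \<xi> j) (gs \<beta> \<xi> j) \<noteq> 0"
    and v: "v \<in> span (\<xi> ` {..<i})"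
  shows "\<beta> (gs \<beta> \<xi> i) v = 0"
proof -
  have sub: "subspace {v. \<beta> (gs \<beta> \<xi> i) v = 0}"
    by (auto simp: subspace_def linear_add[OF lin] linear_scale[OF lin] linear_0[OF lin])
  have "\<xi> j \<in> {v. \<beta> (gs \<beta> \<xi> i) v = 0}" if j: "j < i" for j
  proof -
    have "gs \<beta> \<xi> ` {..j} \<subseteq> {v. \<beta> (gs \<beta> \<xi> i) v = 0}"
      using gs_orthogonal[OF lin sym nz, where i = i] j sym[of "gs \<beta> \<xi> i"] by auto
    then have "span (gs \<beta> \<xi> ` {..j}) \<subseteq> {v. \<beta> (gs \<beta> \<xi> i) v = 0}" using sub by (rule span_minimal)
    then show ?thesis using in_span_gs by blast
  qed
  then have "span (\<xi> ` {..<i}) \<subseteq> {v. \<beta> (gs \<beta> \<xi> i) v = 0}" by (intro span_minimal sub) auto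
  with v show ?thesis by blast
qed

lemma gs_diagonal:
  assumes "\<And>i j. i < n \<Longrightarrow> j < n \<Longrightarrow> i \<noteq> j \<Longrightarrow> \<beta> (\<xi> i) (\<xi> j) = 0" "i < n"
  shows "gs \<beta> \<xi> i = \<xi> i"
  using assms(2)
proof (induction i rule: less_induct)
  case (less i)
  have "(\<Sum>j\<in>{..<i}. (\<beta> (gs \<beta> \<xi> j) (\<xi> i) / \<beta> (gs \<beta> \<xi> j) (gs \<beta> \<xi> j)) *\<^sub>R gs \<beta> \<xi> j) = 0"
    using less assms(1) by (intro sum.neutral) auto
  then show ?case by (subst gs.simps) simp
qed

text \<open>The moving form is the fixed scalar product composed with a moving bounded operator,
  which brings it under the product rule. The coefficient of \<open>\<xi> i\<close> is constantly 1,
  hence the derivative involves earlier vectors only.\<close>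

lemma gs_has_vector_derivative:
  fixes S :: "real \<Rightarrow> 'a::real_inner \<Rightarrow>\<^sub>L 'a" and \<xi> :: "nat \<Rightarrow> 'a"
  defines "\<beta> \<equiv> \<lambda>s x y. x \<bullet> blinfun_apply (S s) y"
  assumes S: "(S has_vector_derivative S') (at t)"
    and nz: "\<And>j. j < i \<Longrightarrow> \<beta> t (gs (\<beta> t) \<xi> j) (gs (\<beta> t) \<xi> j) \<noteq> 0"
  shows "\<exists>d\<in>span (\<xi> ` {..<i}). ((\<lambda>s. gs (\<beta> s) \<xi> i) has_vector_derivative d) (at t)"
  using nz
proof (induction i rule: less_induct)
  case (less i)
  let ?g = "\<lambda>j s. gs (\<beta> s) \<xi> j"
  have "\<forall>j. \<exists>d. j < i \<longrightarrow> d \<in> span (\<xi> ` {..<j}) \<and> (?g j has_vector_derivative d) (at t)"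
  proof
    fix j
    show "\<exists>d. j < i \<longrightarrow> d \<in> span (\<xi> ` {..<j}) \<and> (?g j has_vector_derivative d) (at t)"
    proof (cases "j < i")
      case True
      have "\<exists>d\<in>span (\<xi> ` {..<j}). (?g j has_vector_derivative d) (at t)"
        by (rule less.IH[OF True less.prems]) (use True in simp)
      then show ?thesis by blast
    qed simp
  qed
  from choice[OF this] obtain d where d: "\<And>j. j < i \<Longrightarrow> d j \<in> span (\<xi> ` {..<j})"
    "\<And>j. j < i \<Longrightarrow> (?g j has_vector_derivative d j) (at t)" by auto
  note ap = bounded_bilinear.has_vector_derivative[OF bounded_bilinear_blinfun_apply S]
  note inn = bounded_bilinear.has_vector_derivative[OF bounded_bilinear_inner]
  let ?q = "\<lambda>j s. \<beta> s (?g j s) (\<xi> i) / \<beta> s (?g j s) (?g j s)"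
  have "\<exists>e. (?q j has_real_derivative e) (at t)" if j: "j < i" for j
  proof -
    obtain a where a: "((\<lambda>s. \<beta> s (?g j s) (\<xi> i)) has_real_derivative a) (at t)"
      unfolding \<beta>_def has_real_derivative_iff_has_vector_derivative
      using inn[OF d(2)[OF j, unfolded \<beta>_def] ap[OF has_vector_derivative_const[of "\<xi> i"]]] by blast
    obtain a' where a': "((\<lambda>s. \<beta> s (?g j s) (?g j s)) has_real_derivative a') (at t)"
      unfolding \<beta>_def has_real_derivative_iff_has_vector_derivative
      using inn[OF d(2)[OF j, unfolded \<beta>_def] ap[OF d(2)[OF j, unfolded \<beta>_def]]] by blast
    from DERIV_divide[OF a a' less.prems[OF j]] show ?thesis ..
  qed
  then have "\<forall>j. \<exists>e. j < i \<longrightarrow> (?q j has_real_derivative e) (at t)" by blast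
  from choice[OF this] obtain e where e: "\<And>j. j < i \<Longrightarrow> (?q j has_real_derivative e j) (at t)" by blast
  have "((\<lambda>s. \<xi> i - (\<Sum>j\<in>{..<i}. ?q j s *\<^sub>R ?g j s)) has_vector_derivative
      0 - (\<Sum>j\<in>{..<i}. ?q j t *\<^sub>R d j + e j *\<^sub>R ?g j t)) (at t)"
    by (intro has_vector_derivative_diff has_vector_derivative_const has_vector_derivative_sum
        has_vector_derivative_scaleR e d) auto
  then have "((\<lambda>s. ?g i s) has_vector_derivative
      0 - (\<Sum>j\<in>{..<i}. ?q j t *\<^sub>R d j + e j *\<^sub>R ?g j t)) (at t)"
    by (subst gs.simps)
  moreover have "0 - (\<Sum>j\<in>{..<i}. ?q j t *\<^sub>R d j + e j *\<^sub>R ?g j t) \<in> span (\<xi> ` {..<i})"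
  proof (intro span_diff span_zero span_sum span_add span_scale)
    fix j assume "j \<in> {..<i}"
    then have j: "j < i" by simp
    show "d j \<in> span (\<xi> ` {..<i})"
      using d(1)[OF j] span_mono[of "\<xi> ` {..<j}" "\<xi> ` {..<i}"] j by fastforce
    show "?g j t \<in> span (\<xi> ` {..<i})"
      using gs_in_span[of "\<beta> t" \<xi> j] span_mono[of "\<xi> ` {..j}" "\<xi> ` {..<i}"] j by fastforce
  qed
  ultimately show ?case by blast
qed

text \<open>Curves may fail to be differentiable at finitely many break points; there the
  fundamental theorem of calculus still asks for continuity.\<close>

lemma gs_continuous_on:
  fixes S :: "real \<Rightarrow> 'a::real_inner \<Rightarrow>\<^sub>L 'a" and \<xi> :: "nat \<Rightarrow> 'a"
  defines "\<beta> \<equiv> \<lambda>s x y. x \<bullet> blinfun_apply (S s) y"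
  assumes S: "continuous_on T S"
    and nz: "\<And>j t. j < i \<Longrightarrow> t \<in> T \<Longrightarrow> \<beta> t (gs (\<beta> t) \<xi> j) (gs (\<beta> t) \<xi> j) \<noteq> 0"
  shows "continuous_on T (\<lambda>s. gs (\<beta> s) \<xi> i)"
  using nz
proof (induction i rule: less_induct)
  case (less i)
  have c: "continuous_on T (\<lambda>s. gs (\<beta> s) \<xi> j)" if "j < i" for j
    using less.IH[OF that] less.prems that by auto
  have \<beta>c: "continuous_on T (\<lambda>s. \<beta> s (f s) (g s))" if "continuous_on T f" "continuous_on T g" for f g
    unfolding \<beta>_def by (intro continuous_on_inner that
        bounded_bilinear.continuous_on[OF bounded_bilinear_blinfun_apply S])
  show ?case
    by (subst gs.simps)
      (intro continuous_on_diff continuous_on_const continuous_on_sum continuous_on_scaleR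
        continuous_on_divide \<beta>c c less.prems ballI; simp add: less.prems)
qed

section \<open>The lower bound\<close>

context hyperbolic_grassmannian
begin

text \<open>By \<open>\<beta>_eq\<close> this is the Gram form of the projections to
  \<open>E\<close>. Writing only one projection keeps it linear in \<open>B_proj E\<close>, so its
  derivative along a curve with velocity \<open>V\<close> is \<open>b x (V y)\<close>.\<close>

definition \<beta> :: "'h set \<Rightarrow> 'h \<Rightarrow> 'h \<Rightarrow> real" where
  "\<beta> E x y = b x (B_proj E y)"

lemma \<beta>_linear: "linear (\<beta> E x)"
  by (rule linearI) (simp_all add: \<beta>_def blinfun.add_right blinfun.scaleR_right b_simps)

lemma \<beta>_sym: "E \<in> X \<Longrightarrow> \<beta> E x y = \<beta> E y x"
  using B_proj_props(4)[of E y x] by (simp add: \<beta>_def b_commute)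

lemma \<beta>_eq: "E \<in> X \<Longrightarrow> \<beta> E x y = b (B_proj E x) (B_proj E y)"
  using B_proj_props(4)[of E x "B_proj E y"] by (simp add: \<beta>_def B_proj_props(5))

text \<open>A nonzero isotropic vector cannot project to zero, as the complement of \<open>E\<close>
  is negative definite.\<close>

lemma \<beta>_pos:
  assumes "E \<in> X" "b v v = 0" "v \<noteq> 0"
  shows "\<beta> E v v > 0"
  unfolding \<beta>_eq[OF assms(1)]
  using b_pos_X[OF assms(1) B_proj_props(1)[OF assms(1)]] B_orth_negative(2)[OF assms(1) _ assms(2)] assms(3)
  by blast

lemma isotropic_span:
  assumes "\<And>u v. u \<in> N \<Longrightarrow> v \<in> N \<Longrightarrow> b u v = 0" "v \<in> span N"
  shows "b v v = 0"
proof -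
  have "u \<in> N \<Longrightarrow> w \<in> span N \<Longrightarrow> b u w = 0" for u w
    using span_minimal[of N "{w. b u w = 0}"] assms(1) by (fastforce simp: subspace_def b_simps)
  then have "span N \<subseteq> {u. b u v = 0}" using assms(2)
    by (intro span_minimal) (auto simp: subspace_def b_simps)
  then show ?thesis using assms(2) by blast
qed

section \<open>Variation of the Gram--Schmidt lengths along a curve\<close>

definition \<Phi>b :: "'h \<Rightarrow>\<^sub>L 'h" where
  "\<Phi>b = Blinfun \<Phi>"

lemma \<Phi>b_apply: "blinfun_apply \<Phi>b = \<Phi>"
  unfolding \<Phi>b_def by (rule bounded_linear_Blinfun_apply[OF bounded_linear_\<Phi>])

lemma \<beta>_blinfun: "\<beta> E = (\<lambda>x y. x \<bullet> blinfun_apply (\<Phi>b o\<^sub>L B_proj E) y)"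
  by (intro ext) (simp add: \<beta>_def b_def \<Phi>b_apply)

text \<open>\<open>gs (\<beta> E) \<xi> i\<close> depends on \<open>E\<close> only up to earlier vectors of the flag, to which it is
  \<open>\<beta> E\<close>-orthogonal; so the logarithmic derivative of its length only sees the derivative of \<open>\<beta> E\<close>.\<close>

lemma gs_length_derivative:
  assumes V: "((\<lambda>s. B_proj (\<gamma> s)) has_vector_derivative V) (at t)" and X: "\<gamma> t \<in> X"
    and nz: "\<And>j. j < i \<Longrightarrow> \<beta> (\<gamma> t) (gs (\<beta> (\<gamma> t)) \<xi> j) (gs (\<beta> (\<gamma> t)) \<xi> j) \<noteq> 0"
  shows "((\<lambda>s. \<beta> (\<gamma> s) (gs (\<beta> (\<gamma> s)) \<xi> i) (gs (\<beta> (\<gamma> s)) \<xi> i)) has_real_derivative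
    b (gs (\<beta> (\<gamma> t)) \<xi> i) (V (gs (\<beta> (\<gamma> t)) \<xi> i))) (at t)"
proof -
  let ?S = "\<lambda>s. \<Phi>b o\<^sub>L B_proj (\<gamma> s)" and ?g = "\<lambda>s. gs (\<beta> (\<gamma> s)) \<xi> i"
  have S: "(?S has_vector_derivative \<Phi>b o\<^sub>L V) (at t)"
    using bounded_bilinear.has_vector_derivative[OF bounded_bilinear_blinfun_compose has_vector_derivative_const V]
    by simp
  obtain d where d: "d \<in> span (\<xi> ` {..<i})" "(?g has_vector_derivative d) (at t)"
    using gs_has_vector_derivative[OF S, of i \<xi>] nz by (auto simp: \<beta>_blinfun)
  have "((\<lambda>s. b (?g s) (B_proj (\<gamma> s) (?g s))) has_vector_derivative
      b (?g t) (B_proj (\<gamma> t) d + V (?g t))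
      + b d (B_proj (\<gamma> t) (?g t))) (at t)"
    by (intro bounded_bilinear.has_vector_derivative[OF bounded_bilinear_b] d
        bounded_bilinear.has_vector_derivative[OF bounded_bilinear_blinfun_apply] V)
  moreover have "\<beta> (\<gamma> t) (?g t) d = 0"
    by (rule gs_orthogonal_span[OF \<beta>_linear \<beta>_sym[OF X] nz d(1)])
  moreover have "\<beta> (\<gamma> t) d (?g t) = \<beta> (\<gamma> t) (?g t) d" by (rule \<beta>_sym[OF X])
  ultimately show ?thesis
    unfolding has_real_derivative_iff_has_vector_derivative \<beta>_def by (simp add: b_simps)
qed

text \<open>Split \<open>\<eta>\<close> into \<open>p\<close> in \<open>E\<close> and
  \<open>v\<close> in the complement. Isotropy gives \<open>b v v = - b p p\<close>, and since
  \<open>V\<close> exchanges \<open>E\<close> and its complement, only the two equal cross terms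
  \<open>b v (V p)\<close> survive; they account for the factor 2. Cauchy--Schwarz on the complement
  finishes.\<close>

lemma isotropic_derivative_bound:
  assumes E: "E \<in> X" and V: "tangent E V" and \<eta>: "b \<eta> \<eta> = 0" "\<eta> \<noteq> 0"
  defines "u \<equiv> (1 / sqrt (\<beta> E \<eta> \<eta>)) *\<^sub>R B_proj E \<eta>"
  shows "\<bar>b \<eta> (V \<eta>) / \<beta> E \<eta> \<eta>\<bar> \<le> 2 * sqrt (- b (V u) (V u))"
proof -
  let ?P = "blinfun_apply (B_proj E)" and ?V = "blinfun_apply V"
  define p where "p = ?P \<eta>"
  define v where "v = \<eta> - p"
  define r where "r = \<beta> E \<eta> \<eta>"
  have r: "r > 0" unfolding r_def by (rule \<beta>_pos[OF E \<eta>])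
  have pE: "p \<in> E" unfolding p_def by (rule B_proj_props(1)[OF E])
  have Pv: "?P v = 0" by (simp add: v_def p_def blinfun.diff_right B_proj_props(5)[OF E])
  have PVp: "?P (?V p) = 0" by (rule tangent_normal[OF E V pE])
  have perp: "b x y = 0" if "x \<in> E" "?P y = 0" for x y
    using B_proj_props(4)[OF E, of x y] B_proj_props(2)[OF E that(1)] that(2) by (simp add: b_simps)
  have "?V v = ?V (?P v) + ?P (?V v)" using V unfolding tangent_def by blast
  then have VvE: "?V v \<in> E" using Pv B_proj_props(1)[OF E] by (metis add_0 blinfun.zero_right)
  have bp: "b p p = r" unfolding r_def p_def \<beta>_eq[OF E] ..
  have bv: "b v v = - r"
  proof -
    have "b \<eta> \<eta> = b p p + 2 * b p v + b v v"
      by (simp add: v_def b_simps b_commute[of \<eta> p])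
    then show ?thesis using \<eta>(1) bp perp[OF pE Pv] by simp
  qed
  have sym: "b (?V x) y = b x (?V y)" for x y using V unfolding tangent_def by blast
  have "b \<eta> (?V \<eta>) = b p (?V p) + b p (?V v) + b v (?V p) + b v (?V v)"
    by (simp add: v_def blinfun.diff_right b_simps)
  also have "\<dots> = 2 * b v (?V p)"
    using perp[OF pE PVp] perp[OF VvE Pv] b_commute[of v "?V v"] sym[of p v] b_commute[of v "?V p"] by simp
  finally have 1: "\<bar>b \<eta> (?V \<eta>)\<bar> = 2 * \<bar>b v (?V p)\<bar>" by (simp add: abs_mult)
  have "\<bar>b v (?V p)\<bar> \<le> sqrt r * sqrt (- b (?V p) (?V p))"
    using B_orth_negative(3)[OF E Pv PVp] bv by simp
  with 1 have 2: "\<bar>b \<eta> (?V \<eta>)\<bar> \<le> 2 * (sqrt r * sqrt (- b (?V p) (?V p)))" by simp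
  have "- b (?V u) (?V u) = (- b (?V p) (?V p)) / r"
    using r by (simp add: u_def p_def[symmetric] r_def[symmetric] blinfun.scaleR_right b_simps)
  then have s0: "sqrt (- b (?V u) (?V u)) = sqrt (- b (?V p) (?V p)) / sqrt r" by (simp only: real_sqrt_divide)
  have 3: "2 * sqrt (- b (?V u) (?V u)) * r = 2 * (sqrt r * sqrt (- b (?V p) (?V p)))"
  proof -
    have s: "sqrt (- b (?V u) (?V u)) * sqrt r = sqrt (- b (?V p) (?V p))" using r unfolding s0 by simp
    have "2 * sqrt (- b (?V u) (?V u)) * r = 2 * (sqrt (- b (?V u) (?V u)) * sqrt r) * sqrt r"
      using r by (simp add: mult.assoc)
    also have "\<dots> = 2 * (sqrt r * sqrt (- b (?V p) (?V p)))" unfolding s by (simp only: mult_ac)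
    finally show ?thesis .
  qed
  have "\<bar>b \<eta> (?V \<eta>) / r\<bar> = \<bar>b \<eta> (?V \<eta>)\<bar> / r" using r by simp
  also have "\<dots> \<le> 2 * sqrt (- b (?V u) (?V u))"
    using 2 3 r by (simp only: pos_divide_le_eq)
  finally show ?thesis unfolding r_def .
qed

text \<open>A calibration argument: the weighted sum of logarithms changes along a curve at a rate
  of at most \<open>sqrt 2\<close> times the speed, because each logarithmic derivative is at most
  \<open>2 * sqrt (q i)\<close> while the speed is at least
  \<open>sqrt (2 * (\<Sum>i<n. q i))\<close>. The hypothesis on \<open>w\<close> is an inequality so
  that it admits \<open>w = 0\<close>, which occurs when all angles vanish.\<close>

lemma length_lower_bound:
  fixes n :: nat and \<xi> :: "nat \<Rightarrow> 'h" and w :: "nat \<Rightarrow> real"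
  assumes len: "has_length \<gamma> L"
    and iso: "\<And>i j. i < n \<Longrightarrow> j < n \<Longrightarrow> b (\<xi> i) (\<xi> j) = 0"
    and ind: "\<And>i. i < n \<Longrightarrow> \<xi> i \<notin> span (\<xi> ` {..<i})"
    and w: "(\<Sum>i<n. (w i)\<^sup>2) \<le> 1"
  defines "r \<equiv> \<lambda>E i. \<beta> E (gs (\<beta> E) \<xi> i) (gs (\<beta> E) \<xi> i)"
  shows "(\<Sum>i<n. w i * (ln (r (\<gamma> 0) i) - ln (r (\<gamma> 1) i))) \<le> sqrt 2 * L"
proof -
  define D where "D t = vector_derivative (\<lambda>t. B_proj (\<gamma> t)) (at t)" for t
  have X: "\<gamma> t \<in> X" if "0 \<le> t" "t \<le> 1" for t using len that by (auto simp: has_length_def)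
  have "(\<lambda>t. B_proj (\<gamma> t)) piecewise_C1_differentiable_on {0..1}" using len by (simp add: has_length_def)
  then obtain S where S: "finite S" "continuous_on {0..1} (\<lambda>t. B_proj (\<gamma> t))"
    "(\<lambda>t. B_proj (\<gamma> t)) C1_differentiable_on ({0..1} - S)"
    by (auto simp: piecewise_C1_differentiable_on_def)
  have DV: "((\<lambda>t. B_proj (\<gamma> t)) has_vector_derivative D t) (at t)" if "t \<in> {0..1} - S" for t
    using S(3) that unfolding C1_differentiable_on_eq D_def by (meson vector_derivative_works)
  \<comment> \<open>\<open>tangentI\<close> wants the curve in \<open>X\<close> on both sides of
    \<open>t\<close>, so the end points are left out.\<close>
  have tan: "tangent (\<gamma> t) (D t)" if "t \<in> {0<..<1} - S" for t
  proof (rule tangentI[OF DV])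
    show "min t (1 - t) > 0" "t \<in> {0..1} - S" using that by auto
    show "\<gamma> s \<in> X" if "dist s t < min t (1 - t)" for s
      using that by (intro X) (auto simp: dist_real_def)
  qed
  have isoN: "b v v = 0" if "v \<in> span (\<xi> ` {..<n})" for v
    using that by (rule isotropic_span[rotated]) (use iso in auto)
  have gs_span: "gs (\<beta> E) \<xi> i \<in> span (\<xi> ` {..<n})" if "i < n" for i E
    using gs_in_span[of "\<beta> E" \<xi> i] span_mono[of "\<xi> ` {..i}" "\<xi> ` {..<n}"] that by fastforce
  have gs0: "gs (\<beta> E) \<xi> i \<noteq> 0" if i: "i < n" for i E
  proof
    assume z: "gs (\<beta> E) \<xi> i = 0"
    have "gs (\<beta> E) \<xi> j \<in> span (\<xi> ` {..<i})" if "j < i" for j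
      using gs_in_span[of "\<beta> E" \<xi> j] span_mono[of "\<xi> ` {..j}" "\<xi> ` {..<i}"] that by fastforce
    then have "(\<Sum>j\<in>{..<i}. (\<beta> E (gs (\<beta> E) \<xi> j) (\<xi> i) / \<beta> E (gs (\<beta> E) \<xi> j) (gs (\<beta> E) \<xi> j)) *\<^sub>R gs (\<beta> E) \<xi> j)
        \<in> span (\<xi> ` {..<i})" by (intro span_sum span_scale) auto
    moreover have "\<xi> i = (\<Sum>j\<in>{..<i}. (\<beta> E (gs (\<beta> E) \<xi> j) (\<xi> i) / \<beta> E (gs (\<beta> E) \<xi> j) (gs (\<beta> E) \<xi> j)) *\<^sub>R gs (\<beta> E) \<xi> j)"
      using z gs.simps[of "\<beta> E" \<xi> i] by simp
    ultimately show False using ind[OF i] by simp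
  qed
  have rpos: "r E i > 0" if "E \<in> X" "i < n" for E i
    unfolding r_def using that by (intro \<beta>_pos isoN gs_span gs0)
  have r_eq: "r E i = b (gs (\<beta> E) \<xi> i) (B_proj E (gs (\<beta> E) \<xi> i))" for E i
    unfolding r_def by (rule \<beta>_def)
  define r' where "r' t i = b (gs (\<beta> (\<gamma> t)) \<xi> i) (D t (gs (\<beta> (\<gamma> t)) \<xi> i))" for t i
  define f where "f t = - (\<Sum>i<n. w i * ln (r (\<gamma> t) i))" for t
  define f' where "f' t = - (\<Sum>i<n. w i * (r' t i / r (\<gamma> t) i))" for t
  have df: "(f has_vector_derivative f' t) (at t)" if t: "t \<in> {0<..<1} - S" for t
  proof -
    have Xt: "\<gamma> t \<in> X" using t X by auto
    have "((\<lambda>s. r (\<gamma> s) i) has_real_derivative r' t i) (at t)" if "i < n" for i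
      unfolding r_def r'_def
      by (rule gs_length_derivative[OF DV Xt])
        (use t that rpos[OF Xt, unfolded r_def] in \<open>auto simp: less_imp_neq[THEN not_sym]\<close>)
    then have "((\<lambda>s. ln (r (\<gamma> s) i)) has_real_derivative r' t i / r (\<gamma> t) i) (at t)" if "i < n" for i
      using that rpos[OF Xt that] by (auto intro!: derivative_eq_intros simp: field_simps)
    then have "(f has_real_derivative f' t) (at t)"
      unfolding f_def f'_def by (intro DERIV_minus DERIV_sum DERIV_cmult) auto
    then show ?thesis by (simp add: has_real_derivative_iff_has_vector_derivative)
  qed
  have cf: "continuous_on {0..1} f"
  proof -
    have cS: "continuous_on {0..1} (\<lambda>s. \<Phi>b o\<^sub>L B_proj (\<gamma> s))"
      by (intro bounded_bilinear.continuous_on[OF bounded_bilinear_blinfun_compose] continuous_on_const S(2))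
    have "continuous_on {0..1} (\<lambda>s. r (\<gamma> s) i)" if i: "i < n" for i
    proof -
      have g: "continuous_on {0..1} (\<lambda>s. gs (\<beta> (\<gamma> s)) \<xi> i)"
        unfolding \<beta>_blinfun
      proof (rule gs_continuous_on[OF cS])
        fix j t assume "j < i" "t \<in> {0..1::real}"
        then have "r (\<gamma> t) j > 0" using i by (intro rpos X) auto
        then have "r (\<gamma> t) j \<noteq> 0" by simp
        then show "gs (\<lambda>x y. x \<bullet> blinfun_apply (\<Phi>b o\<^sub>L B_proj (\<gamma> t)) y) \<xi> j \<bullet>
            blinfun_apply (\<Phi>b o\<^sub>L B_proj (\<gamma> t))
              (gs (\<lambda>x y. x \<bullet> blinfun_apply (\<Phi>b o\<^sub>L B_proj (\<gamma> t)) y) \<xi> j) \<noteq> 0"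
          unfolding r_def \<beta>_blinfun .
      qed
      show ?thesis
        unfolding r_eq
        by (intro bounded_bilinear.continuous_on[OF bounded_bilinear_b]
            bounded_bilinear.continuous_on[OF bounded_bilinear_blinfun_apply] g S(2))
    qed
    then show ?thesis
      unfolding f_def
      by (intro continuous_on_minus continuous_on_sum continuous_on_mult continuous_on_const continuous_on_ln)
        (use rpos X in \<open>auto simp: less_imp_neq[THEN not_sym]\<close>)
  qed
  have bound: "f' t \<le> sqrt 2 * riem_norm (\<gamma> t) (D t)" if t: "t \<in> {0<..<1} - S" for t
  proof -
    have Xt: "\<gamma> t \<in> X" using t X by auto
    note T = tan[OF t]
    let ?E = "\<gamma> t" and ?V = "blinfun_apply (D t)"
    let ?g = "\<lambda>i. gs (\<beta> (\<gamma> t)) \<xi> i"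
    define u where "u i = (1 / sqrt (\<beta> ?E (?g i) (?g i))) *\<^sub>R B_proj ?E (?g i)" for i
    define q where "q i = - b (?V (u i)) (?V (u i))" for i
    have uE: "u i \<in> ?E" for i
      unfolding u_def by (intro is_subspaceD(5)[OF is_subspace_X[OF Xt]] B_proj_props(1)[OF Xt])
    have q0: "q i \<ge> 0" for i
      unfolding q_def using B_orth_negative(1)[OF Xt tangent_normal[OF Xt T uE]] by simp
    \<comment> \<open>\<open>\<beta>\<close> is \<open>b\<close> of the projections, so
      orthogonality of the Gram--Schmidt vectors turns into \<open>b\<close>-orthonormality of the
      \<open>u i\<close>, and \<open>riem_norm_ge\<close> applies to them.\<close>
    have uu: "b (u i) (u j) = (if i = j then 1 else 0)" if ij: "i < n" "j < n" for i j
    proof -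
      have nz: "\<beta> ?E (?g k) (?g k) \<noteq> 0" if "k < n" for k using rpos[OF Xt that] by (simp add: r_def)
      have orth: "\<beta> ?E (?g k) (?g l) = 0" if "k < l" "l < n" for k l
        using gs_orthogonal[where \<beta> = "\<beta> ?E", OF \<beta>_linear \<beta>_sym[OF Xt] nz that(1)] that by auto
      have "b (u i) (u j) = \<beta> ?E (?g i) (?g j) / (sqrt (\<beta> ?E (?g i) (?g i)) * sqrt (\<beta> ?E (?g j) (?g j)))"
        by (simp add: u_def b_simps \<beta>_eq[OF Xt])
      moreover have "\<beta> ?E (?g i) (?g j) = 0" if "i \<noteq> j"
        using that orth[of i j] orth[of j i] ij \<beta>_sym[OF Xt, of "?g i"] by (cases "i < j") auto
      ultimately show ?thesis using rpos[OF Xt ij(1)] by (auto simp: r_def)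
    qed
    have inj: "inj_on u {..<n}"
      by (rule inj_onI) (metis lessThan_iff uu zero_neq_one)
    have bon: "b_on (u ` {..<n})"
      unfolding b_on_def using uu inj by (auto simp: inj_on_eq_iff)
    have "sqrt (2 * (\<Sum>x\<in>u ` {..<n}. - b (?V x) (?V x))) \<le> riem_norm ?E (D t)"
      by (rule riem_norm_ge[OF Xt T bon]) (use uE in auto)
    also have "(\<Sum>x\<in>u ` {..<n}. - b (?V x) (?V x)) = (\<Sum>i<n. q i)"
      by (subst sum.reindex[OF inj]) (simp add: q_def)
    finally have norm: "sqrt (2 * (\<Sum>i<n. q i)) \<le> riem_norm ?E (D t)" .
    have "f' t = (\<Sum>i<n. - (w i * (r' t i / r ?E i)))" by (simp add: f'_def sum_negf)
    also have "\<dots> \<le> (\<Sum>i<n. \<bar>w i\<bar> * (2 * sqrt (q i)))"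
    proof (rule sum_mono)
      fix i assume "i \<in> {..<n}"
      then have i: "i < n" by simp
      have "\<bar>r' t i / r ?E i\<bar> \<le> 2 * sqrt (q i)"
        unfolding r'_def r_def q_def u_def
        by (rule isotropic_derivative_bound[OF Xt T isoN[OF gs_span[OF i]] gs0[OF i]])
      then have "\<bar>w i\<bar> * \<bar>r' t i / r ?E i\<bar> \<le> \<bar>w i\<bar> * (2 * sqrt (q i))" by (rule mult_left_mono) simp
      then show "- (w i * (r' t i / r ?E i)) \<le> \<bar>w i\<bar> * (2 * sqrt (q i))"
        unfolding abs_mult[symmetric] by linarith
    qed
    also have "\<dots> = 2 * (\<Sum>i<n. \<bar>w i\<bar> * \<bar>sqrt (q i)\<bar>)"
      using q0 by (simp add: sum_distrib_left mult_ac)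
    also have "\<dots> \<le> 2 * (L2_set w {..<n} * L2_set (\<lambda>i. sqrt (q i)) {..<n})"
      by (intro mult_left_mono L2_set_mult_ineq) auto
    also have "L2_set (\<lambda>i. sqrt (q i)) {..<n} = sqrt (\<Sum>i<n. q i)"
      using q0 by (simp add: L2_set_def)
    also have "2 * (L2_set w {..<n} * sqrt (\<Sum>i<n. q i)) \<le> 2 * (1 * sqrt (\<Sum>i<n. q i))"
      using w q0 by (intro mult_left_mono mult_right_mono) (auto simp: L2_set_def intro: sum_nonneg)
    also have "\<dots> = sqrt 2 * sqrt (2 * (\<Sum>i<n. q i))"
      by (simp add: real_sqrt_mult)
    also have "\<dots> \<le> sqrt 2 * riem_norm ?E (D t)" using norm by (intro mult_left_mono) auto
    finally show ?thesis .
  qed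
  let ?S = "S \<union> {0, 1}"
  have int1: "(f' has_integral (f 1 - f 0)) {0..1}"
    by (rule fundamental_theorem_of_calculus_interior_strong[OF S(1) _ _ cf]) (use df in auto)
  have "((\<lambda>t. sqrt 2 * riem_norm (\<gamma> t) (D t)) has_integral sqrt 2 * L) {0..1}"
    using len by (intro has_integral_mult_right) (simp add: has_length_def D_def)
  then have int2: "((\<lambda>t. if t \<in> ?S then f' t else sqrt 2 * riem_norm (\<gamma> t) (D t)) has_integral sqrt 2 * L) {0..1}"
    by (rule has_integral_spike_finite[rotated 2, of _ _ _ ?S]) (use S(1) in auto)
  have "f 1 - f 0 \<le> sqrt 2 * L"
    by (rule has_integral_le[OF int1 int2]) (use bound in auto)
  moreover have "f 1 - f 0 = (\<Sum>i<n. w i * (ln (r (\<gamma> 0) i) - ln (r (\<gamma> 1) i)))"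
    by (simp add: f_def sum_subtractf right_diff_distrib)
  ultimately show ?thesis by simp
qed

end

section \<open>The geodesic\<close>

context hyperbolic_grassmannian
begin

lemma rscale_expand:
  assumes U: "K_real_basis U" and a: "a \<in> K"
  shows "x \<odot> a = (\<Sum>u\<in>U. qRe (qcnj u * a) *\<^sub>R (x \<odot> u))"
proof -
  have "x \<odot> a = x \<odot> (\<Sum>u\<in>U. qRe (qcnj u * a) *\<^sub>R u)" using K_real_basisD(6)[OF U a] by (rule arg_cong)
  also have "\<dots> = (\<Sum>u\<in>U. x \<odot> (qRe (qcnj u * a) *\<^sub>R u))"
    using rscale_sum_right[of U "\<lambda>u. qRe (qcnj u * a) *\<^sub>R u" x] K_real_basisD(4)[OF U] by simp
  also have "\<dots> = (\<Sum>u\<in>U. qRe (qcnj u * a) *\<^sub>R (x \<odot> u))"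
    using K_real_basisD(4)[OF U] by (intro sum.cong) auto
  finally show ?thesis .
qed

lemma b_rscale:
  assumes "u \<in> K" "v \<in> K"
  shows "b (x \<odot> u) (y \<odot> v) = qRe (qcnj u * B x y * v)"
  using assms by (simp add: hermitianD(4,5)[OF hermitian_B] mult.assoc flip: qRe_B)

text \<open>Building blocks of \<open>B_proj\<close>: as the operator depends bilinearly on its two
  vectors, differentiability of a moving basis carries over to the projections in operator
  norm.\<close>

definition rank_one :: "'h \<Rightarrow> 'h \<Rightarrow> 'h \<Rightarrow>\<^sub>L 'h" where
  "rank_one a c = Blinfun (\<lambda>v. b a v *\<^sub>R c)"

lemma rank_one_apply: "blinfun_apply (rank_one a c) v = b a v *\<^sub>R c"
  and norm_rank_one: "norm (rank_one a c) \<le> norm a * norm c"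
proof -
  have le: "norm (b a v *\<^sub>R c) \<le> norm v * (norm a * norm c)" for v
  proof -
    have "\<bar>b a v\<bar> \<le> norm a * norm v" unfolding b_def using Cauchy_Schwarz_ineq2[of a "\<Phi> v"] norm_\<Phi> by simp
    from mult_right_mono[OF this norm_ge_zero[of c]] show ?thesis by (simp add: mult_ac)
  qed
  have "bounded_linear (\<lambda>v. b a v *\<^sub>R c)"
    by (rule bounded_linear_intro[OF _ _ le]) (simp_all add: b_simps scaleR_add_left)
  then show r: "blinfun_apply (rank_one a c) v = b a v *\<^sub>R c" for v
    unfolding rank_one_def by (simp add: bounded_linear_Blinfun_apply)
  show "norm (rank_one a c) \<le> norm a * norm c"
    using le by (intro norm_blinfun_bound) (simp_all add: r mult_ac)
qed

lemma bounded_bilinear_rank_one: "bounded_bilinear rank_one"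
proof
  show "\<exists>K. \<forall>a c. norm (rank_one a c) \<le> norm a * norm c * K"
    using norm_rank_one by (intro exI[of _ 1]) simp
qed (auto intro!: blinfun_eqI simp: rank_one_apply b_simps blinfun.add_left blinfun.scaleR_left
    scaleR_add_left scaleR_add_right)

lemma B_proj_rank_one:
  assumes E: "E \<in> X" and f: "K_onb B f p E" and U: "K_real_basis U"
  shows "B_proj E = (\<Sum>i<p. \<Sum>u\<in>U. rank_one (f i \<odot> u) (f i \<odot> u))"
proof (rule blinfun_eqI)
  fix v
  let ?P = "blinfun_apply (B_proj E)"
  have "?P v = (\<Sum>i<p. f i \<odot> B (f i) (?P v))" by (rule K_onbD(3)[OF f B_proj_props(1)[OF E]])
  also have "\<dots> = (\<Sum>i<p. \<Sum>u\<in>U. b (f i \<odot> u) v *\<^sub>R (f i \<odot> u))"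
  proof (intro sum.cong refl)
    fix i assume "i \<in> {..<p}"
    then have i: "f i \<in> E" using K_onbD(2)[OF f] by simp
    have "f i \<odot> B (f i) (?P v) = (\<Sum>u\<in>U. qRe (qcnj u * B (f i) (?P v)) *\<^sub>R (f i \<odot> u))"
      by (rule rscale_expand[OF U hermitianD(1)[OF hermitian_B]])
    also have "\<dots> = (\<Sum>u\<in>U. b (f i \<odot> u) v *\<^sub>R (f i \<odot> u))"
    proof (intro sum.cong refl)
      fix u assume "u \<in> U"
      then have u: "u \<in> K" using K_real_basisD(4)[OF U] by blast
      have fu: "f i \<odot> u \<in> E" by (rule is_subspaceD(4)[OF is_subspace_X[OF E] i u])
      have "qRe (qcnj u * B (f i) (?P v)) = b (f i \<odot> u) (?P v)"
        using u by (simp add: hermitianD(5)[OF hermitian_B] flip: qRe_B)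
      also have "\<dots> = b (?P (f i \<odot> u)) v" by (rule B_proj_props(4)[OF E, symmetric])
      also have "\<dots> = b (f i \<odot> u) v" by (simp add: B_proj_props(2)[OF E fu])
      finally show "qRe (qcnj u * B (f i) (?P v)) *\<^sub>R (f i \<odot> u) = b (f i \<odot> u) v *\<^sub>R (f i \<odot> u)"
        by (simp only:)
    qed
    finally show "f i \<odot> B (f i) (?P v) = (\<Sum>u\<in>U. b (f i \<odot> u) v *\<^sub>R (f i \<odot> u))" .
  qed
  finally show "?P v = blinfun_apply (\<Sum>i<p. \<Sum>u\<in>U. rank_one (f i \<odot> u) (f i \<odot> u)) v"
    by (simp add: blinfun.sum_left rank_one_apply)
qed

text \<open>The derivatives \<open>Y' t i\<close> are \<open>B\<close>-orthogonal to the moving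
  subspace, so \<open>V t\<close> sends \<open>Y t i \<odot> u\<close> to
  \<open>Y' t i \<odot> u\<close>. These have \<open>- b\<close> equal to
  \<open>(a i)\<^sup>2\<close> for every \<open>t\<close>, once for each of the \<open>dim K\<close>
  scalars \<open>u\<close>; hence the speed is constant.\<close>

lemma geodesic_has_length:
  fixes x z :: "nat \<Rightarrow> 'h" and a :: "nat \<Rightarrow> real"
  assumes xx: "\<And>i j. i < p \<Longrightarrow> j < p \<Longrightarrow> B (x i) (x j) = (if i = j then 1 else 0)"
    and xz: "\<And>i j. i < p \<Longrightarrow> j < p \<Longrightarrow> B (x i) (z j) = 0"
    and zz: "\<And>i j. i < p \<Longrightarrow> j < p \<Longrightarrow> B (z i) (z j) = (if i = j \<and> a i \<noteq> 0 then - 1 else 0)"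
  shows "has_length (\<lambda>t. K_span (\<lambda>i. cosh (t * a i) *\<^sub>R x i + sinh (t * a i) *\<^sub>R z i) p)
    (sqrt (2 * real (dim K) * (\<Sum>i<p. (a i)\<^sup>2)))"
proof -
  note D = hermitianD[OF hermitian_B]
  obtain U where U: "K_real_basis U" by (rule K_real_basis_exists)
  note UK = K_real_basisD(4)[OF U]
  define Y where "Y t i = cosh (t * a i) *\<^sub>R x i + sinh (t * a i) *\<^sub>R z i" for t i
  define Y' where "Y' t i = (sinh (t * a i) * a i) *\<^sub>R x i + (cosh (t * a i) * a i) *\<^sub>R z i" for t i
  define \<gamma> where "\<gamma> t = K_span (Y t) p" for t
  have zx: "B (z i) (x j) = 0" if "i < p" "j < p" for i j
    using xz[OF that(2,1)] hermitian_cnj[OF hermitian_B, of "z i" "x j"] by simp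
  \<comment> \<open>For \<open>a i = 0\<close> the vector \<open>z i\<close> pairs to zero with all
    the others and with itself; the inner conditional carries this case through the
    computations.\<close>
  have comb: "B (r *\<^sub>R x i + s *\<^sub>R z i) (r' *\<^sub>R x j + s' *\<^sub>R z j)
      = (if i = j then of_real (r * r' - (if a i = 0 then 0 else s * s')) else 0)"
    if "i < p" "j < p" for i j r s r' s'
    using xx[OF that] xz[OF that] zz[OF that] zx[OF that] by (auto simp: D(2,3,12,13) of_real_def scaleR_diff_left mult.commute)
  have YY: "B (Y t i) (Y t j) = (if i = j then 1 else 0)" if "i < p" "j < p" for i j t
  proof -
    have "cosh s * cosh s - sinh s * sinh s = 1" for s :: real
      using hyperbolic_pythagoras[of s] by (simp add: power2_eq_square)
    then have "cosh (t * a i) * cosh (t * a i) - (if a i = 0 then 0 else sinh (t * a i) * sinh (t * a i)) = 1"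
      by auto
    note 1 = this
    show ?thesis
    proof (cases "i = j")
      case True
      show ?thesis unfolding Y_def comb[OF that] unfolding True[symmetric] by (simp only: refl if_True 1 of_real_1)
    qed (simp add: Y_def comb[OF that])
  qed
  have YY': "B (Y t i) (Y' t j) = 0" if "i < p" "j < p" for i j t
  proof -
    have "cosh (t * a i) * (sinh (t * a i) * a i) -
        (if a i = 0 then 0 else sinh (t * a i) * (cosh (t * a i) * a i)) = 0" by auto
    note 0 = this
    show ?thesis
    proof (cases "i = j")
      case True
      show ?thesis unfolding Y_def Y'_def comb[OF that] unfolding True[symmetric] by (simp only: refl if_True 0 of_real_0)
    qed (simp add: Y_def Y'_def comb[OF that])
  qed
  have Y'Y': "B (Y' t i) (Y' t i) = of_real (- (a i)\<^sup>2)" if "i < p" for i t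
  proof -
    have "sinh s * r * (sinh s * r) - cosh s * r * (cosh s * r) = - r\<^sup>2" for s r :: real
    proof -
      have "sinh s * r * (sinh s * r) - cosh s * r * (cosh s * r) = - ((cosh s)\<^sup>2 - (sinh s)\<^sup>2) * r\<^sup>2"
        by (simp add: power2_eq_square algebra_simps)
      then show ?thesis by (simp add: hyperbolic_pythagoras)
    qed
    then have "sinh (t * a i) * a i * (sinh (t * a i) * a i) -
        (if a i = 0 then 0 else cosh (t * a i) * a i * (cosh (t * a i) * a i)) = - (a i)\<^sup>2" by auto
    then show ?thesis unfolding Y'_def comb[OF that that] by (simp only: refl if_True)
  qed
  have on: "K_on B (Y t) p" for t using YY by (simp add: K_on_def)
  have X: "\<gamma> t \<in> X" for t unfolding \<gamma>_def by (rule K_span_in_X[OF on])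
  have onb: "K_onb B (Y t) p (\<gamma> t)" for t unfolding \<gamma>_def by (rule K_onb_K_span[OF hermitian_B on])
  have dY: "((\<lambda>t. Y t i) has_vector_derivative Y' t i) (at t)" for t i
  proof -
    have "((\<lambda>t. cosh (t * a i)) has_real_derivative sinh (t * a i) * a i) (at t)"
      "((\<lambda>t. sinh (t * a i)) has_real_derivative cosh (t * a i) * a i) (at t)"
      by (auto intro!: derivative_eq_intros)
    from has_vector_derivative_add[OF has_vector_derivative_scaleR[OF this(1) has_vector_derivative_const[of "x i"]]
        has_vector_derivative_scaleR[OF this(2) has_vector_derivative_const[of "z i"]]]
    show ?thesis unfolding Y_def Y'_def by simp
  qed
  have dYu: "((\<lambda>t. Y t i \<odot> u) has_vector_derivative Y' t i \<odot> u) (at t)" if "u \<in> U" for t i u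
    by (rule bounded_linear.has_vector_derivative[OF bounded_linear_rscale[OF UK[OF that]] dY])
  define V where "V t = (\<Sum>i<p. \<Sum>u\<in>U. rank_one (Y t i \<odot> u) (Y' t i \<odot> u) + rank_one (Y' t i \<odot> u) (Y t i \<odot> u))" for t
  have P: "B_proj (\<gamma> t) = (\<Sum>i<p. \<Sum>u\<in>U. rank_one (Y t i \<odot> u) (Y t i \<odot> u))" for t
    by (rule B_proj_rank_one[OF X onb U])
  have dP: "((\<lambda>t. B_proj (\<gamma> t)) has_vector_derivative V t) (at t)" for t
    unfolding P V_def
    by (intro has_vector_derivative_sum bounded_bilinear.has_vector_derivative[OF bounded_bilinear_rank_one] dYu)
  have cY: "continuous_on S (\<lambda>t. Y t i)" for S i
    unfolding Y_def by (intro continuous_intros)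
  have cY': "continuous_on S (\<lambda>t. Y' t i)" for S i
    unfolding Y'_def by (intro continuous_intros)
  have cu: "continuous_on S (\<lambda>t. f t \<odot> u)" if "u \<in> U" "continuous_on S f" for S u and f :: "real \<Rightarrow> 'h"
    by (rule bounded_linear.continuous_on[OF bounded_linear_rscale[OF UK[OF that(1)]] that(2)])
  have cV: "continuous_on S V" for S
    unfolding V_def
    by (intro continuous_on_sum continuous_on_add bounded_bilinear.continuous_on[OF bounded_bilinear_rank_one]
        cu cY cY')
  have C1: "(\<lambda>t. B_proj (\<gamma> t)) piecewise_C1_differentiable_on {0..1}"
    by (rule C1_differentiable_imp_piecewise) (use dP cV in \<open>auto simp: C1_differentiable_on_def\<close>)
  have tan: "tangent (\<gamma> t) (V t)" for t by (rule tangentI[OF dP zero_less_one X])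
  \<comment> \<open>Differentiate the identity that the projection fixes
    \<open>Y s i \<odot> u\<close>; the term with the projected derivative vanishes by
    orthogonality.\<close>
  have Vu: "V t (Y t i \<odot> u) = Y' t i \<odot> u" if i: "i < p" and u: "u \<in> U" for t i u
  proof -
    have d: "((\<lambda>s. B_proj (\<gamma> s) (Y s i \<odot> u)) has_vector_derivative
        B_proj (\<gamma> t) (Y' t i \<odot> u) + V t (Y t i \<odot> u)) (at t)"
      by (rule bounded_bilinear.has_vector_derivative[OF bounded_bilinear_blinfun_apply dP dYu[OF u]])
    have id: "B_proj (\<gamma> s) (Y s i \<odot> u) = Y s i \<odot> u" for s
      by (rule B_proj_props(2)[OF X is_subspaceD(4)[OF is_subspace_X[OF X] K_onbD(2)[OF onb i] UK[OF u]]])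
    have "B_proj (\<gamma> t) (Y' t i \<odot> u) + V t (Y t i \<odot> u) = Y' t i \<odot> u"
      by (rule vector_derivative_unique_at[OF d[unfolded id] dYu[OF u]])
    moreover have "B_proj (\<gamma> t) (Y' t i \<odot> u) = 0"
      by (rule B_proj_zero[OF X onb]) (use YY' i UK[OF u] in \<open>simp add: D(4)\<close>)
    ultimately show ?thesis by simp
  qed
  have norm: "riem_norm (\<gamma> t) (V t) = sqrt (2 * real (dim K) * (\<Sum>i<p. (a i)\<^sup>2))" for t
  proof -
    let ?T = "real_frame U (Y t) p"
    note rf = real_frame[OF hermitian_B onb[of t] is_subspace_X[OF X] U]
    have "riem_norm (\<gamma> t) (V t) = sqrt (2 * (\<Sum>u\<in>?T. - b (V t u) (V t u)))"
      by (rule riem_norm_eq[OF X tan _ rf(1-3)]) (use rf(4) in \<open>simp add: b_on_def qRe_B\<close>)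
    also have "(\<Sum>u\<in>?T. - b (V t u) (V t u))
        = (\<Sum>(i, u)\<in>{..<p} \<times> U. - b (V t (Y t i \<odot> u)) (V t (Y t i \<odot> u)))"
      unfolding real_frame_def by (subst sum.reindex[OF rf(5)]) (simp add: o_def case_prod_unfold)
    also have "\<dots> = (\<Sum>(i, u)\<in>{..<p} \<times> U. (a i)\<^sup>2)"
    proof (rule sum.cong[OF refl])
      fix s assume "s \<in> {..<p} \<times> U"
      then obtain i u where s: "s = (i, u)" and i: "i < p" and u: "u \<in> U" by auto
      have "b (Y' t i \<odot> u) (Y' t i \<odot> u) = qRe (qcnj u * of_real (- (a i)\<^sup>2) * u)"
        using Y'Y' i UK[OF u] by (simp add: b_rscale)
      also have "\<dots> = - (a i)\<^sup>2 * qRe (qcnj u * u)"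
        by (simp add: of_real_mult_quat del: of_real_minus of_real_power)
      also have "\<dots> = - (a i)\<^sup>2" using K_real_basisD(5)[OF U u u] by simp
      finally have "- b (V t (Y t i \<odot> u)) (V t (Y t i \<odot> u)) = (a i)\<^sup>2"
        using Vu[OF i u] by simp
      then show "(case s of (i, u) \<Rightarrow> - b (V t (Y t i \<odot> u)) (V t (Y t i \<odot> u)))
          = (case s of (i, u) \<Rightarrow> (a i)\<^sup>2)"
        by (simp only: s prod.case)
    qed
    also have "\<dots> = real (dim K) * (\<Sum>i<p. (a i)\<^sup>2)"
      using K_real_basisD(3)[OF U] by (simp add: sum.cartesian_product[symmetric] sum_distrib_left)
    finally show ?thesis by (simp add: mult.assoc)
  qed
  have "has_length \<gamma> (sqrt (2 * real (dim K) * (\<Sum>i<p. (a i)\<^sup>2)))"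
    unfolding has_length_def
  proof (intro conjI ballI X C1)
    have "vector_derivative (\<lambda>t. B_proj (\<gamma> t)) (at t) = V t" for t by (rule vector_derivative_at[OF dP])
    then show "((\<lambda>t. riem_norm (\<gamma> t) (vector_derivative (\<lambda>t. B_proj (\<gamma> t)) (at t))) has_integral
        sqrt (2 * real (dim K) * (\<Sum>i<p. (a i)\<^sup>2))) {0..1}"
      using has_integral_const_real[of "sqrt (2 * real (dim K) * (\<Sum>i<p. (a i)\<^sup>2))" 0 1] by (simp add: norm)
  qed
  then show ?thesis unfolding \<gamma>_def Y_def[abs_def] .
qed

section \<open>The distance\<close>

text \<open>On the isotropic vectors \<open>\<xi> m\<close> the form \<open>\<beta> E\<close> is the
  identity matrix and \<open>\<beta> F\<close> is diagonal with entries
  \<open>exp (- 2 * a (i m))\<close>. So Gram--Schmidt changes nothing at the two end points and the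
  logarithms can be read off; in between the order of the flag enters, but any enumeration of
  \<open>J\<close> gives the same bound.\<close>

lemma length_ge_principal_angles:
  assumes len: "has_length \<gamma> L" and \<gamma>: "\<gamma> 0 = E" "\<gamma> 1 = F" and E: "E \<in> X" and F: "F \<in> X"
    and onx: "K_onb B x p E"
    and ony: "K_onb B (\<lambda>i. cosh (a i) *\<^sub>R x i + sinh (a i) *\<^sub>R z i) p F"
    and xz: "\<And>i j. i < p \<Longrightarrow> j < p \<Longrightarrow> B (x i) (z j) = 0"
    and zz: "\<And>i j. i < p \<Longrightarrow> j < p \<Longrightarrow> B (z i) (z j) = (if i = j \<and> a i \<noteq> 0 then - 1 else 0)"
  shows "sqrt (2 * real (dim K) * (\<Sum>i<p. (a i)\<^sup>2)) \<le> L"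
proof -
  note D = hermitianD[OF hermitian_B]
  define y where "y i = cosh (a i) *\<^sub>R x i + sinh (a i) *\<^sub>R z i" for i
  have ony: "K_onb B y p F" using ony unfolding y_def[abs_def] .
  note xx = K_onbD(4)[OF onx]
  have zx: "B (z i) (x j) = 0" if "i < p" "j < p" for i j
    using xz[OF that(2,1)] hermitian_cnj[OF hermitian_B, of "z i" "x j"] by simp
  obtain U where U: "K_real_basis U" by (rule K_real_basis_exists)
  note UK = K_real_basisD(4)[OF U]
  \<comment> \<open>Only pairs with a nonzero angle: otherwise \<open>x (i m) + z (i m)\<close>
    would not be isotropic.\<close>
  define J where "J = {i. i < p \<and> a i \<noteq> 0} \<times> U"
  have "finite J" using K_real_basisD(1)[OF U] by (simp add: J_def)
  then obtain e where e: "bij_betw e {..<card J} J"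
    using ex_bij_betw_nat_finite[of J] by (auto simp: atLeast0LessThan)
  define n where "n = card J"
  define i where "i m = fst (e m)" for m
  define u where "u m = snd (e m)" for m
  have em: "i m < p" "a (i m) \<noteq> 0" "u m \<in> U" "u m \<in> K" if "m < n" for m
    using bij_betwE[OF e] that UK by (force simp: J_def i_def u_def n_def)+
  have inj: "i k = i m \<and> u k = u m \<longleftrightarrow> k = m" if "k < n" "m < n" for k m
    using e that by (auto simp: bij_betw_def inj_on_def i_def u_def n_def prod_eq_iff)
  have delta: "(if i k = i m then qRe (qcnj (u k) * u m) else 0) = (if k = m then 1 else 0)" if "k < n" "m < n" for k m
    using inj[OF that] K_real_basisD(5)[OF U em(3)[OF that(1)] em(3)[OF that(2)]] by auto
  define \<xi> where "\<xi> m = (x (i m) + z (i m)) \<odot> u m" for m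
  have iso: "b (\<xi> k) (\<xi> m) = 0" if "k < n" "m < n" for k m
  proof -
    have "B (x (i k) + z (i k)) (x (i m) + z (i m)) = 0"
      using xx xz zz zx em(1,2) that by (simp add: D(2,3))
    then show ?thesis unfolding \<xi>_def using em(4) that by (simp add: b_rscale)
  qed
  \<comment> \<open>The vectors \<open>x (i k) \<odot> u k\<close> are dual to the
    \<open>\<xi> m\<close>; this yields both the independence of the flag and the matrix of
    \<open>\<beta> E\<close>.\<close>
  have dual: "b (x (i k) \<odot> u k) (\<xi> m) = (if k = m then 1 else 0)" if "k < n" "m < n" for k m
  proof -
    have "B (x (i k)) (x (i m) + z (i m)) = (if i k = i m then 1 else 0)"
      using xx xz em(1) that by (simp add: D(2))
    then have "b (x (i k) \<odot> u k) (\<xi> m) = (if i k = i m then qRe (qcnj (u k) * u m) else 0)"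
      unfolding \<xi>_def using em(4) that by (simp add: b_rscale)
    then show ?thesis using delta[OF that] by simp
  qed
  have ind: "\<xi> m \<notin> span (\<xi> ` {..<m})" if m: "m < n" for m
  proof
    assume s: "\<xi> m \<in> span (\<xi> ` {..<m})"
    have "span (\<xi> ` {..<m}) \<subseteq> {v. b (x (i m) \<odot> u m) v = 0}"
      using dual m by (intro span_minimal) (auto simp: subspace_def b_simps)
    with s have "b (x (i m) \<odot> u m) (\<xi> m) = 0" by blast
    then show False using dual[OF m m] by simp
  qed
  have sum_a: "(\<Sum>m<n. (a (i m))\<^sup>2) = real (dim K) * (\<Sum>i<p. (a i)\<^sup>2)"
  proof -
    have "(\<Sum>m<n. (a (i m))\<^sup>2) = (\<Sum>j\<in>J. (a (fst j))\<^sup>2)"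
      unfolding n_def i_def by (rule sum.reindex_bij_betw[OF e])
    also have "\<dots> = (\<Sum>k | k < p \<and> a k \<noteq> 0. \<Sum>v\<in>U. (a k)\<^sup>2)"
      unfolding J_def sum.cartesian_product by (simp only: case_prod_unfold)
    also have "\<dots> = real (dim K) * (\<Sum>k | k < p \<and> a k \<noteq> 0. (a k)\<^sup>2)"
      using K_real_basisD(3)[OF U] by (simp add: sum_distrib_left)
    also have "(\<Sum>k | k < p \<and> a k \<noteq> 0. (a k)\<^sup>2) = (\<Sum>i<p. (a i)\<^sup>2)"
      by (rule sum.mono_neutral_left) auto
    finally show ?thesis .
  qed
  \<comment> \<open>Normalises the weights. If all angles vanish then \<open>N = 0\<close>, division
    by zero makes every weight zero, and the bound on their squares still holds.\<close>
  define N where "N = sqrt (\<Sum>m<n. (a (i m))\<^sup>2)"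
  have N2: "N\<^sup>2 = (\<Sum>m<n. (a (i m))\<^sup>2)" by (simp add: N_def sum_nonneg)
  have wle: "(\<Sum>m<n. (a (i m) / N)\<^sup>2) \<le> 1"
    by (simp add: power_divide sum_divide_distrib[symmetric] N2[symmetric])
  have \<beta>E: "\<beta> E (\<xi> k) (\<xi> m) = (if k = m then 1 else 0)" if "k < n" "m < n" for k m
  proof -
    have "B_proj E (z (i m) \<odot> u m) = 0"
      by (rule B_proj_zero[OF E onx]) (use xz em that in \<open>simp add: D(4)\<close>)
    moreover have "x (i m) \<odot> u m \<in> E"
      by (rule is_subspaceD(4)[OF is_subspace_X[OF E] K_onbD(2)[OF onx em(1)[OF that(2)]] em(4)[OF that(2)]])
    ultimately have "B_proj E (\<xi> m) = x (i m) \<odot> u m"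
      using B_proj_props(2)[OF E] em(4)[OF that(2)]
      by (simp add: \<xi>_def rscale_add_left blinfun.add_right)
    then show ?thesis using dual[OF that(2,1)] b_commute[of "\<xi> k"] by (auto simp: \<beta>_def)
  qed
  \<comment> \<open>Pairing \<open>cosh\<close> and \<open>sinh\<close> with the two halves of the
    isotropic vector, of opposite sign, leaves
    \<open>cosh (a m) - sinh (a m) = exp (- a m)\<close>.\<close>
  have yx: "B (y k) (x m + z m) = (if k = m then of_real (exp (- a m)) else 0)" if "k < p" "m < p" "a m \<noteq> 0" for k m
    using xx[OF that(1,2)] xz[OF that(1,2)] zz[OF that(1,2)] zx[OF that(1,2)] that(3)
    by (auto simp: y_def D(2,3,12,13) of_real_def scaleR_diff_left[symmetric] cosh_minus_sinh)
  \<comment> \<open>The projection of \<open>\<xi> m\<close> to \<open>F\<close> is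
    \<open>exp (- a (i m))\<close> times \<open>y (i m) \<odot> u m\<close>; pairing it with
    \<open>\<xi> k\<close> supplies the second exponential factor.\<close>
  have \<beta>F: "\<beta> F (\<xi> k) (\<xi> m) = (if k = m then exp (- 2 * a (i m)) else 0)" if "k < n" "m < n" for k m
  proof -
    let ?c = "exp (- a (i m))"
    have m: "i m < p" "a (i m) \<noteq> 0" "u m \<in> K" using em that by auto
    have "B_proj F ((x (i m) + z (i m) - ?c *\<^sub>R y (i m)) \<odot> u m) = 0"
    proof (rule B_proj_zero[OF F ony])
      fix l assume l: "l < p"
      have "B (y l) (x (i m) + z (i m) - ?c *\<^sub>R y (i m)) = 0"
        using yx[OF l m(1,2)] K_onbD(4)[OF ony l m(1)] by (simp add: D(10,12) of_real_def)
      then show "B (y l) ((x (i m) + z (i m) - ?c *\<^sub>R y (i m)) \<odot> u m) = 0" using m(3) by (simp add: D(4))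
    qed
    moreover have "(x (i m) + z (i m) - ?c *\<^sub>R y (i m)) \<odot> u m = \<xi> m - ?c *\<^sub>R (y (i m) \<odot> u m)"
      using rscale_add_left[OF m(3), of "x (i m) + z (i m)" "- (?c *\<^sub>R y (i m))"] m(3) by (simp add: \<xi>_def)
    moreover have "?c *\<^sub>R (y (i m) \<odot> u m) \<in> F"
      by (intro is_subspaceD(4,5)[OF is_subspace_X[OF F]] K_onbD(2)[OF ony] m)
    ultimately have "B_proj F (\<xi> m) = ?c *\<^sub>R (y (i m) \<odot> u m)"
      using B_proj_props(2)[OF F] by (simp add: blinfun.diff_right)
    then have "\<beta> F (\<xi> k) (\<xi> m) = ?c * b (y (i m) \<odot> u m) (\<xi> k)"
      by (simp add: \<beta>_def b_simps b_commute[of "\<xi> k"])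
    also have "b (y (i m) \<odot> u m) (\<xi> k) = (if i m = i k then exp (- a (i k)) * qRe (qcnj (u m) * u k) else 0)"
      using yx[OF m(1) em(1,2)[OF that(1)]] m(3) em(4)[OF that(1)]
      by (simp add: \<xi>_def b_rscale of_real_mult_quat)
    also have "\<dots> = exp (- a (i k)) * (if m = k then 1 else 0)"
      using delta[OF that(2,1)] by auto
    finally show ?thesis by (auto simp flip: exp_add)
  qed
  have gE: "gs (\<beta> E) \<xi> m = \<xi> m" if "m < n" for m
    by (rule gs_diagonal[OF _ that]) (simp add: \<beta>E)
  have gF: "gs (\<beta> F) \<xi> m = \<xi> m" if "m < n" for m
    by (rule gs_diagonal[OF _ that]) (simp add: \<beta>F)
  have "(\<Sum>m<n. a (i m) / N * (ln (\<beta> (\<gamma> 0) (gs (\<beta> (\<gamma> 0)) \<xi> m) (gs (\<beta> (\<gamma> 0)) \<xi> m)) -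
      ln (\<beta> (\<gamma> 1) (gs (\<beta> (\<gamma> 1)) \<xi> m) (gs (\<beta> (\<gamma> 1)) \<xi> m)))) \<le> sqrt 2 * L"
    by (rule length_lower_bound[OF len iso ind wle])
  also have "(\<Sum>m<n. a (i m) / N * (ln (\<beta> (\<gamma> 0) (gs (\<beta> (\<gamma> 0)) \<xi> m) (gs (\<beta> (\<gamma> 0)) \<xi> m)) -
      ln (\<beta> (\<gamma> 1) (gs (\<beta> (\<gamma> 1)) \<xi> m) (gs (\<beta> (\<gamma> 1)) \<xi> m)))) = (\<Sum>m<n. 2 * (a (i m))\<^sup>2 / N)"
    unfolding \<gamma> by (intro sum.cong refl) (simp add: gE gF \<beta>E \<beta>F power2_eq_square)
  also have "\<dots> = 2 * N\<^sup>2 / N" by (simp only: N2 sum_divide_distrib[symmetric] sum_distrib_left[symmetric])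
  \<comment> \<open>Also correct for \<open>N = 0\<close>, where both sides are zero.\<close>
  also have "\<dots> = 2 * N" by (simp add: power2_eq_square)
  also have "2 * N = sqrt 2 * (sqrt 2 * N)" by (simp flip: mult.assoc)
  finally have "sqrt 2 * (sqrt 2 * N) \<le> sqrt 2 * L" .
  then have "sqrt 2 * N \<le> L" by (rule mult_left_le_imp_le) simp
  then show ?thesis by (simp add: N_def sum_a real_sqrt_mult mult.assoc)
qed

theorem riem_dist_eq:
  assumes E: "E \<in> X" and F: "F \<in> X" and \<alpha>: "hyperbolic_principal_angles E F \<alpha>"
  shows "(riem_dist E F)\<^sup>2 = 2 * real (dim K) * (\<Sum>i=1..p. (\<alpha> i)\<^sup>2)"
proof -
  obtain x z where xz: "K_onb B x p E"
    "K_onb B (\<lambda>i. cosh (\<alpha> (Suc i)) *\<^sub>R x i + sinh (\<alpha> (Suc i)) *\<^sub>R z i) p F"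
    "\<And>i j. i < p \<Longrightarrow> j < p \<Longrightarrow> B (x i) (z j) = 0"
    "\<And>i j. i < p \<Longrightarrow> j < p \<Longrightarrow> B (z i) (z j) = (if i = j \<and> \<alpha> (Suc i) \<noteq> 0 then - 1 else 0)"
    using principal_angles_normal_form[OF E F \<alpha>] by blast
  let ?d = "sqrt (2 * real (dim K) * (\<Sum>i<p. (\<alpha> (Suc i))\<^sup>2))"
  let ?\<gamma> = "\<lambda>t. K_span (\<lambda>i. cosh (t * \<alpha> (Suc i)) *\<^sub>R x i + sinh (t * \<alpha> (Suc i)) *\<^sub>R z i) p"
  have "has_length ?\<gamma> ?d"
    by (rule geodesic_has_length[OF K_onbD(4)[OF xz(1)] xz(3,4)])
  moreover have "?\<gamma> 0 = E" using K_onb_imp_K_span[OF hermitian_B xz(1) is_subspace_X[OF E]] by simp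
  moreover have "?\<gamma> 1 = F" using K_onb_imp_K_span[OF hermitian_B xz(2) is_subspace_X[OF F]] by simp
  ultimately have "?d \<in> {L. \<exists>\<gamma>. has_length \<gamma> L \<and> \<gamma> 0 = E \<and> \<gamma> 1 = F}" by blast
  moreover have "?d \<le> L" if "L \<in> {L. \<exists>\<gamma>. has_length \<gamma> L \<and> \<gamma> 0 = E \<and> \<gamma> 1 = F}" for L
    using that length_ge_principal_angles[OF _ _ _ E F xz(1-4)] by blast
  ultimately have "riem_dist E F = ?d" unfolding riem_dist_def by (rule cInf_eq_minimum)
  then show ?thesis
    by (simp add: sum_nonneg sum.atLeast1_atMost_eq)
qed

end

theorem proposition3p5:
  fixes K :: "quat set"
    and rscale :: "'h::{real_inner,complete_space} \<Rightarrow> quat \<Rightarrow> 'h"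
    and form :: "'h \<Rightarrow> 'h \<Rightarrow> quat"
    and p :: nat
    and E0 E F :: "'h set"
    and \<alpha> :: "nat \<Rightarrow> real"
  assumes "hyperbolic_grassmannian K rscale form p E0"
    and "E \<in> hyperbolic_grassmannian.X K rscale form p E0"
    and "F \<in> hyperbolic_grassmannian.X K rscale form p E0"
    and "hyperbolic_grassmannian.hyperbolic_principal_angles form p E0 E F \<alpha>"
  shows "(hyperbolic_grassmannian.riem_dist K rscale form p E0 E F)\<^sup>2
    = 2 * real (dim K) * (\<Sum>i=1..p. (\<alpha> i)\<^sup>2)"
  using hyperbolic_grassmannian.riem_dist_eq[OF assms] .

end
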